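(* Let $\alpha>0$, $\beta\in\mathbb{R}$, $\rho_0>0$, and let $F:\operatorname{dom}(F)\subseteq\bigcap_{\rho\geq\rho_0}H^\beta_\rho(\mathbb{R};H)\to\bigcap_{\rho\geq\rho_0}H^{\beta-\alpha}_\rho(\mathbb{R};H)$ be eventually $(\beta,\beta-\alpha)$-contracting. Then there exists $\nu\geq\rho_0$ such that for each $\rho\geq\nu$ there is a unique $u_\rho\in H^\beta_\rho(\mathbb{R};H)$ satisfying \[\partial_{0,\rho}^\alpha u_\rho=F_\rho(u_\rho),\] where $F_\rho:H^\beta_\rho(\mathbb{R};H)\to H^{\beta-\alpha}_\rho(\mathbb{R};H)$ is the Lipschitz continuous extension of $F$.
   Context: $H$ is a complex Hilbert space. For $\rho\in\mathbb{R}$, $L^2_\rho(\mathbb{R};H)$ is the Hilbert space of locally Bochner integrable $f:\mathbb{R}\to H$ with $\int_{\mathbb{R}}\|f(t)\|_H^2e^{-2\rho t}\,dt<\infty$. The Fourier–Laplace transform $\mathcal{L}_\rho:=\mathcal{F}e^{-\rho m}:L^2_\rho(\mathbb{R};H)\to L^2(\mathbb{R};H)$ is unitary, where $(e^{-\rho m}f)(t)=e^{-\rho t}f(t)$ and $\mathcal{F}$ is the unitary Fourier transform on $L^2(\mathbb{R};H)$, $(\mathcal{F}f)(\xi)=(2\pi)^{-1/2}\int_{\mathbb{R}}f(t)e^{-i\xi t}\,dt$ for $f\in L^1\cap L^2$. Powers $z^\gamma$ use the principal branch. For $\rho\neq0$, $\gamma\in\mathbb{R}$: $H^\gamma(im+\rho)$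 is the Hilbert space of $g\in L^1_{\mathrm{loc}}(\mathbb{R};H)$ with $\int_{\mathbb{R}}\|(it+\rho)^\gamma g(t)\|_H^2dt<\infty$, with inner product $\langle g,h\rangle=\int\langle (it+\rho)^\gamma g(t),(it+\rho)^\gamma h(t)\rangle_H\,dt$. $W^\gamma_\rho(\mathbb{R};H):=\{u\in L^2_\rho(\mathbb{R};H):\mathcal{L}_\rho u\in H^\gamma(im+\rho)\}$ with inner product $\langle u,v\rangle_{\rho,\gamma}:=\langle\mathcal{L}_\rho u,\mathcal{L}_\rho v\rangle_{H^\gamma(im+\rho)}$, and $H^\gamma_\rho(\mathbb{R};H)$ is its completion, with norm $\|\cdot\|_{\rho,\gamma}$. $\mathcal{L}_\rho$ extends to a unitary map $H^\gamma_\rho(\mathbb{R};H)\to H^\gamma(im+\rho)$, and for $\delta\in\mathbb{R}$ the fractional derivative $\partial^\delta_{0,\rho}$ denotes the unitary operator $H^\gamma_\rho(\mathbb{R};H)\to H^{\gamma-\delta}_\rho(\mathbb{R};H)$, $u\mapsto\mathcal{L}_\rho^{-1}\big((i\xi+\rho)^\delta(\mathcal{L}_\rho u)(\xi)\big)$. Each $f\in H^\gamma_\rho(\mathbb{R};H)$ defines the distribution $\varphi\mapsto\langle f,\varphi\rangle:=\int_{\mathbb{R}}\langle(\mathcal{L}_\rho f)(t),(\mathcal{L}_{-\rho}\varphi)(t)\rangle_H\,dt$ on $C_c^\infty(\mathbb{R};H)$; elements of the various $H^\gamma_\rho(\mathbb{R};H)$ are identified when they define the same distribution (this is how the intersections over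 $\rho$ are understood). Definition: for $\rho_0>0$, $\beta,\gamma\in\mathbb{R}$, a map $F:\operatorname{dom}(F)\subseteq\bigcap_{\rho\geq\rho_0}H^\beta_\rho(\mathbb{R};H)\to\bigcap_{\rho\geq\rho_0}H^\gamma_\rho(\mathbb{R};H)$ is eventually $(\beta,\gamma)$-Lipschitz continuous if $C_c^\infty(\mathbb{R};H)\subseteq\operatorname{dom}(F)$ and there is $\nu\geq\rho_0$ such that for each $\rho\geq\nu$, $F$ has a Lipschitz continuous extension $F_\rho:H^\beta_\rho(\mathbb{R};H)\to H^\gamma_\rho(\mathbb{R};H)$ with $\sup_{\rho\geq\nu}|F_\rho|_{\mathrm{Lip}}<\infty$, where $|F_\rho|_{\mathrm{Lip}}=\sup_{f\neq g}\|F_\rho(f)-F_\rho(g)\|_{\rho,\gamma}/\|f-g\|_{\rho,\beta}$. It is eventually $(\beta,\gamma)$-contracting if moreover $\limsup_{\rho\to\infty}|F_\rho|_{\mathrm{Lip}}<1$. *)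

theory Defs
  imports "HOL-Analysis.Analysis"
begin

text \<open>The complex Hilbert space H is modelled as a real Hilbert space (type class real_inner
plus completeness) together with an orthogonal complex structure J (multiplication by i).
Complex scalar multiplication and the complex inner product are derived from J.\<close>

definition complex_structure :: "('h::real_inner \<Rightarrow> 'h) \<Rightarrow> bool" where
  "complex_structure J \<longleftrightarrow> linear J \<and> (\<forall>x. J (J x) = - x) \<and> (\<forall>x y. inner (J x) (J y) = inner x y)"

definition scaleJ :: "('h::real_inner \<Rightarrow> 'h) \<Rightarrow> complex \<Rightarrow> 'h \<Rightarrow> 'h" where
  "scaleJ J c x = Re c *\<^sub>R x + Im c *\<^sub>R J x"

text \<open>complex inner product, linear in the first and conjugate-linear in the second argument\<close>
definition cinner :: "('h::real_inner \<Rightarrow> 'h) \<Rightarrow> 'h \<Rightarrow> 'h \<Rightarrow> complex" where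
  "cinner J x y = Complex (inner x y) (inner x (J y))"

text \<open>Distributions on C_c^infty(R;H), represented as functions on H-valued functions
(value 0 off the test functions).\<close>
type_synonym 'h distr = "(real \<Rightarrow> 'h) \<Rightarrow> complex"

definition test_fun :: "(real \<Rightarrow> 'h::real_normed_vector) \<Rightarrow> bool" where
  "test_fun \<phi> \<longleftrightarrow> compact (closure {t. \<phi> t \<noteq> 0}) \<and>
     (\<exists>D :: nat \<Rightarrow> real \<Rightarrow> 'h. D 0 = \<phi> \<and> (\<forall>n t. (D n has_vector_derivative D (Suc n) t) (at t)))"

text \<open>Fourier-Laplace transform L_rho (only applied to test functions, where the integral is classical).\<close>
definition fourier_laplace :: "('h::real_inner \<Rightarrow> 'h) \<Rightarrow> real \<Rightarrow> (real \<Rightarrow> 'h) \<Rightarrow> real \<Rightarrow> 'h" where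
  "fourier_laplace J \<rho> f \<xi> =
     integral UNIV (\<lambda>t. (exp (- \<rho> * t) / sqrt (2 * pi)) *\<^sub>R scaleJ J (cis (- \<xi> * t)) (f t))"

definition weight :: "real \<Rightarrow> real \<Rightarrow> real \<Rightarrow> complex" where
  "weight \<rho> \<gamma> t = (Complex \<rho> t) powr (complex_of_real \<gamma>)"

definition strongly_measurable :: "(real \<Rightarrow> 'h::real_normed_vector) \<Rightarrow> bool" where
  "strongly_measurable g \<longleftrightarrow>
     (\<exists>s :: nat \<Rightarrow> real \<Rightarrow> 'h. (\<forall>n. s n \<in> borel_measurable lebesgue \<and> finite (range (s n))) \<and>
        (AE t in lebesgue. (\<lambda>n. s n t) \<longlonglongrightarrow> g t))"

definition loc_bochner_integrable :: "(real \<Rightarrow> 'h::real_normed_vector) \<Rightarrow> bool" where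
  "loc_bochner_integrable g \<longleftrightarrow> strongly_measurable g \<and>
     (\<forall>a b. (\<integral>\<^sup>+ t \<in> {a..b}. ennreal (norm (g t)) \<partial>lebesgue) < \<infinity>)"

text \<open>The space H^gamma(im + rho) (as a set of representatives, before identifying a.e. equal ones).\<close>
definition Hsp :: "('h::real_inner \<Rightarrow> 'h) \<Rightarrow> real \<Rightarrow> real \<Rightarrow> (real \<Rightarrow> 'h) set" where
  "Hsp J \<rho> \<gamma> = {g. loc_bochner_integrable g \<and>
      (\<integral>\<^sup>+ t. ennreal ((norm (scaleJ J (weight \<rho> \<gamma> t) (g t)))\<^sup>2) \<partial>lebesgue) < \<infinity>}"

text \<open>The distribution  phi |-> <f, phi> = int <(L_rho f)(t), (L_{-rho} phi)(t)> dt  defined by the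
element f of H^gamma_rho with L_rho f = g.\<close>
definition dist_of :: "('h::real_inner \<Rightarrow> 'h) \<Rightarrow> real \<Rightarrow> (real \<Rightarrow> 'h) \<Rightarrow> 'h distr" where
  "dist_of J \<rho> g = (\<lambda>\<phi>. if test_fun \<phi>
      then integral\<^sup>L lebesgue (\<lambda>t. cinner J (g t) (fourier_laplace J (- \<rho>) \<phi> t)) else 0)"

text \<open>H^gamma_rho(R;H), realised (via the unitary L_rho onto H^gamma(im+rho) and the
identification of elements with distributions) as a set of distributions.\<close>
definition Hrho :: "('h::real_inner \<Rightarrow> 'h) \<Rightarrow> real \<Rightarrow> real \<Rightarrow> 'h distr set" where
  "Hrho J \<rho> \<gamma> = dist_of J \<rho> ` Hsp J \<rho> \<gamma>"

text \<open>A representative of L_rho u.\<close>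
definition rep :: "('h::real_inner \<Rightarrow> 'h) \<Rightarrow> real \<Rightarrow> 'h distr \<Rightarrow> real \<Rightarrow> 'h" where
  "rep J \<rho> T = (SOME g. (\<exists>\<gamma>. g \<in> Hsp J \<rho> \<gamma>) \<and> dist_of J \<rho> g = T)"

definition hnorm :: "('h::real_inner \<Rightarrow> 'h) \<Rightarrow> real \<Rightarrow> real \<Rightarrow> 'h distr \<Rightarrow> real" where
  "hnorm J \<rho> \<gamma> T = sqrt (enn2real
     (\<integral>\<^sup>+ t. ennreal ((norm (scaleJ J (weight \<rho> \<gamma> t) (rep J \<rho> T t)))\<^sup>2) \<partial>lebesgue))"

definition frac_deriv :: "('h::real_inner \<Rightarrow> 'h) \<Rightarrow> real \<Rightarrow> real \<Rightarrow> 'h distr \<Rightarrow> 'h distr" where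
  "frac_deriv J \<rho> \<delta> T = dist_of J \<rho> (\<lambda>t. scaleJ J (weight \<rho> \<delta> t) (rep J \<rho> T t))"

definition dminus :: "'h distr \<Rightarrow> 'h distr \<Rightarrow> 'h distr" where
  "dminus S T = (\<lambda>\<phi>. S \<phi> - T \<phi>)"

definition lip_norm ::
  "('h::real_inner \<Rightarrow> 'h) \<Rightarrow> real \<Rightarrow> real \<Rightarrow> real \<Rightarrow> ('h distr \<Rightarrow> 'h distr) \<Rightarrow> real" where
  "lip_norm J \<rho> \<beta> \<gamma> G =
     (let P = {(f, g). f \<in> Hrho J \<rho> \<beta> \<and> g \<in> Hrho J \<rho> \<beta> \<and> f \<noteq> g} in
      if P = {} then 0
      else Sup ((\<lambda>(f, g). hnorm J \<rho> \<gamma> (dminus (G f) (G g)) / hnorm J \<rho> \<beta> (dminus f g)) ` P))"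

definition lip_extension ::
  "('h::real_inner \<Rightarrow> 'h) \<Rightarrow> real \<Rightarrow> real \<Rightarrow> real \<Rightarrow> 'h distr set \<Rightarrow> ('h distr \<Rightarrow> 'h distr)
     \<Rightarrow> ('h distr \<Rightarrow> 'h distr) \<Rightarrow> bool" where
  "lip_extension J \<rho> \<beta> \<gamma> Dom F G \<longleftrightarrow>
     G ` Hrho J \<rho> \<beta> \<subseteq> Hrho J \<rho> \<gamma> \<and> (\<forall>f\<in>Dom. G f = F f) \<and>
     (\<exists>L. \<forall>f\<in>Hrho J \<rho> \<beta>. \<forall>g\<in>Hrho J \<rho> \<beta>.
        hnorm J \<rho> \<gamma> (dminus (G f) (G g)) \<le> L * hnorm J \<rho> \<beta> (dminus f g))"

text \<open>The element of H^beta_rho given by a test function psi (independent of rho).\<close>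
definition test_dist :: "('h::real_inner \<Rightarrow> 'h) \<Rightarrow> real \<Rightarrow> (real \<Rightarrow> 'h) \<Rightarrow> 'h distr" where
  "test_dist J \<rho> \<psi> = dist_of J \<rho> (fourier_laplace J \<rho> \<psi>)"

definition eventually_contracting ::
  "('h::real_inner \<Rightarrow> 'h) \<Rightarrow> real \<Rightarrow> real \<Rightarrow> real \<Rightarrow> 'h distr set \<Rightarrow> ('h distr \<Rightarrow> 'h distr) \<Rightarrow> bool" where
  "eventually_contracting J \<rho>\<^sub>0 \<beta> \<gamma> Dom F \<longleftrightarrow>
     (\<forall>\<psi>. test_fun \<psi> \<longrightarrow> test_dist J \<rho>\<^sub>0 \<psi> \<in> Dom) \<and>
     (\<exists>\<nu>\<ge>\<rho>\<^sub>0. \<exists>Fr :: real \<Rightarrow> 'h distr \<Rightarrow> 'h distr.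
        (\<forall>\<rho>\<ge>\<nu>. lip_extension J \<rho> \<beta> \<gamma> Dom F (Fr \<rho>)) \<and>
        bdd_above ((\<lambda>\<rho>. lip_norm J \<rho> \<beta> \<gamma> (Fr \<rho>)) ` {\<nu>..}) \<and>
        Limsup at_top (\<lambda>\<rho>. ereal (lip_norm J \<rho> \<beta> \<gamma> (Fr \<rho>))) < 1)"

end

theory Submission
  imports Defs "HOL-Probability.Probability" "HOL-Computational_Algebra.Polynomial"
begin

text \<open>Multiplication by \<open>(i t + \<rho>)\<^sup>\<beta>\<close> identifies \<open>H\<^sup>\<beta>\<^sub>\<rho>\<close> with \<open>L\<^sup>2(\<real>; H)\<close>, and turns
  \<open>\<partial>\<^sup>\<alpha> : H\<^sup>\<beta>\<^sub>\<rho> \<rightarrow> H\<^sup>\<beta>\<^sup>-\<^sup>\<alpha>\<^sub>\<rho>\<close> into the identity; the equation \<open>\<partial>\<^sup>\<alpha> u = F\<^sub>\<rho> u\<close> becomes a fixed point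
  equation for a contraction of the complete space \<open>L\<^sup>2\<close> as soon as the Lipschitz norm at \<open>\<rho>\<close> is below 1.
  That an arbitrary Lipschitz extension agrees with the contracting one needs test functions to be dense,
  and to define distributions independently of \<open>\<rho>\<close>.  The latter is Parseval's identity; both
  the density and the injectivity of \<open>g \<mapsto> \<langle>g, \<cdot>\<rangle>\<close> follow because pairing \<open>g\<close> with all translates of
  a bump function shows that a scalar integrable function has vanishing Fourier transform, hence is
  zero by Levy's uniqueness theorem.\<close>

section \<open>Strongly measurable functions\<close>

text \<open>H need not be separable, and its type is only a complete inner product space.
  Measurability therefore means strong measurability, whose closure under limits has to be proved,
  and vector identities for the transform are established after pairing with a fixed vector, as
  identities of scalar integrals. Elements of the scale are distributions, and \<open>rep\<close>
  recovers a function by a choice that does not record the exponent. Injectivity of the pairing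
  across different exponents is thus needed before norms and derivatives can be computed at all. Two
  gaps separate hypothesis from conclusion: the bound on the Lipschitz norms concerns one family of
  extensions \<open>Fr\<close>, while the conclusion speaks of every extension \<open>G\<close>; and
  test distributions are known to lie in \<open>Dom\<close> only in the form computed at the weight
  \<open>\<rho>\<^sub>0\<close>. Density closes the first gap, independence of the weight the
  second.\<close>

lemma borel_measurable_finite_range_iff:
  fixes s :: "real \<Rightarrow> 'a::real_normed_vector"
  shows "s \<in> borel_measurable lebesgue \<and> finite (range s) \<longleftrightarrow> simple_function lebesgue s"
proof (intro iffI conjI)
  assume s: "s \<in> borel_measurable lebesgue \<and> finite (range s)"
  have "s -` {x} \<inter> space lebesgue \<in> sets lebesgue" for x
    using s by (intro measurable_sets[of s lebesgue borel]) auto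
  then show "simple_function lebesgue s" using s by (auto simp: simple_function_def)
qed (auto simp: simple_function_def intro!: borel_measurable_simple_function)

lemma strongly_measurable_iff_simple:
  "strongly_measurable g \<longleftrightarrow>
     (\<exists>s. (\<forall>n::nat. simple_function lebesgue (s n)) \<and> (AE t in lebesgue. (\<lambda>n. s n t) \<longlonglongrightarrow> g t))"
  by (simp add: strongly_measurable_def borel_measurable_finite_range_iff)

text \<open>The approximating simple functions are pushed through \<open>F\<close>. Joint continuity
  is asked in sequential form so that rules such as \<open>tendsto_diff\<close>,
  \<open>tendsto_inner\<close> or \<open>tendsto_scaleJ\<close> discharge it directly.\<close>

lemma strongly_measurable_compose2:
  fixes F :: "'a::real_normed_vector \<Rightarrow> 'b::real_normed_vector \<Rightarrow> 'c::real_normed_vector"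
  assumes F: "\<And>f g a b. (f \<longlongrightarrow> a) sequentially \<Longrightarrow> (g \<longlongrightarrow> b) sequentially \<Longrightarrow>
      ((\<lambda>n. F (f n) (g n)) \<longlongrightarrow> F a b) sequentially"
    and f: "strongly_measurable f" and g: "strongly_measurable g"
  shows "strongly_measurable (\<lambda>t. F (f t) (g t))"
proof -
  obtain s where s: "\<And>n::nat. simple_function lebesgue (s n)"
    "AE t in lebesgue. (\<lambda>n. s n t) \<longlonglongrightarrow> f t"
    using f by (auto simp: strongly_measurable_iff_simple)
  obtain r where r: "\<And>n::nat. simple_function lebesgue (r n)"
    "AE t in lebesgue. (\<lambda>n. r n t) \<longlonglongrightarrow> g t"
    using g by (auto simp: strongly_measurable_iff_simple)
  have "AE t in lebesgue. (\<lambda>n. F (s n t) (r n t)) \<longlonglongrightarrow> F (f t) (g t)"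
    using s(2) r(2) by eventually_elim (rule F)
  moreover have "simple_function lebesgue (\<lambda>t. F (s n t) (r n t))" for n
    using simple_function_compose2[OF s(1) r(1), of F n n] by simp
  ultimately show ?thesis
    unfolding strongly_measurable_iff_simple by (intro exI[of _ "\<lambda>n t. F (s n t) (r n t)"]) auto
qed

lemma strongly_measurable_compose:
  fixes F :: "'a::real_normed_vector \<Rightarrow> 'b::real_normed_vector"
  assumes "\<And>x. isCont F x" and "strongly_measurable f"
  shows "strongly_measurable (\<lambda>t. F (f t))"
  by (rule strongly_measurable_compose2[of "\<lambda>x y. F x", OF _ assms(2) assms(2)])
    (use assms(1) isCont_tendsto_compose in blast)

lemma measurable_cong_AE_lebesgue:
  fixes f g :: "real \<Rightarrow> 'a::topological_space"
  assumes "f \<in> borel_measurable lebesgue" "AE t in lebesgue. f t = g t"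
  shows "g \<in> borel_measurable lebesgue"
proof (rule measurableI)
  fix A :: "'a set" assume A: "A \<in> sets borel"
  have "f -` A \<inter> space lebesgue \<in> sets lebesgue" using assms(1) A by (rule measurable_sets)
  moreover have "AE t in lebesgue. t \<in> f -` A \<inter> space lebesgue \<longleftrightarrow> t \<in> g -` A \<inter> space lebesgue"
    using assms(2) by eventually_elim auto
  ultimately show "g -` A \<inter> space lebesgue \<in> sets lebesgue"
    using completion.in_sets_AE[of "f -` A \<inter> space lebesgue" "g -` A \<inter> space lebesgue"] by auto
qed auto

text \<open>Measurability of a limit wants convergence everywhere, so the exceptional null set is
  first overwritten by 0; completeness of Lebesgue measure then carries measurability back to
  \<open>g\<close>.\<close>

lemma strongly_measurable_imp_measurable:
  assumes "strongly_measurable g"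
  shows "g \<in> borel_measurable lebesgue"
proof -
  obtain s where s: "\<And>n::nat. simple_function lebesgue (s n)"
    "AE t in lebesgue. (\<lambda>n. s n t) \<longlonglongrightarrow> g t"
    using assms by (auto simp: strongly_measurable_iff_simple)
  define P where "P = {t \<in> space lebesgue. \<not> (\<lambda>n. s n t) \<longlonglongrightarrow> g t}"
  have P: "P \<in> null_sets lebesgue"
    unfolding P_def using s(2) by (subst completion.AE_iff_null_sets[symmetric]) auto
  define g' where "g' t = (if t \<in> P then 0 else g t)" for t
  have "(\<lambda>t. if t \<in> P then 0 else s n t) \<in> borel_measurable lebesgue" for n
    using borel_measurable_simple_function[OF s(1), of n] P by (intro measurable_If_set) auto
  then have "g' \<in> borel_measurable lebesgue"
    by (rule borel_measurable_LIMSEQ_metric) (auto simp: g'_def P_def)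
  moreover have "AE t in lebesgue. g' t = g t"
    using AE_not_in[OF P] by eventually_elim (auto simp: g'_def)
  ultimately show ?thesis by (rule measurable_cong_AE_lebesgue)
qed

lemma strongly_measurable_imp_separable:
  fixes g :: "real \<Rightarrow> 'h::real_normed_vector"
  assumes "strongly_measurable g"
  obtains D where "countable D" "D \<noteq> {}" "AE t in lebesgue. g t \<in> closure D"
proof -
  obtain s where s: "\<And>n::nat. simple_function lebesgue (s n)"
    "AE t in lebesgue. (\<lambda>n. s n t) \<longlonglongrightarrow> g t"
    using assms by (auto simp: strongly_measurable_iff_simple)
  let ?D = "insert 0 (\<Union>n. range (s n))"
  have "countable ?D"
    using simple_functionD(1)[OF s(1)] by (intro countable_insert countable_UN) (auto intro: countable_finite)
  moreover have "AE t in lebesgue. g t \<in> closure ?D"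
    using s(2)
  proof eventually_elim
    case (elim t)
    then show ?case unfolding closure_sequential by (intro exI[of _ "\<lambda>n. s n t"]) auto
  qed
  ultimately show thesis using that[of ?D] by blast
qed

text \<open>One direction of Pettis' theorem, with distances to points in place of functionals: the
  approximant number \<open>n\<close> takes the nearest among the first n + 1 points of an
  enumeration of \<open>D\<close>.\<close>

lemma strongly_measurableI_separable:
  fixes g :: "real \<Rightarrow> 'h::real_normed_vector"
  assumes D: "countable D" "D \<noteq> {}" "AE t in lebesgue. g t \<in> closure D"
    and meas: "\<And>d. (\<lambda>t. dist (g t) d) \<in> borel_measurable lebesgue"
  shows "strongly_measurable g"
proof -
  define d where "d = from_nat_into D"
  have range_d: "range d = D" using D by (simp add: d_def)
  define P where "P n i t \<longleftrightarrow> i \<le> n \<and> (\<forall>j\<le>n. dist (g t) (d i) \<le> dist (g t) (d j))" for n i t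
  \<comment> \<open>Ties between nearest points are broken by the least index, which makes the
    choice measurable.\<close>
  define L where "L n t = (LEAST i. P n i t)" for n t
  have [measurable]: "(\<lambda>t. dist (g t) (d i)) \<in> borel_measurable lebesgue" for i
    by (rule meas)
  have ex: "\<exists>i. P n i t" for n t
  proof -
    have "\<exists>x\<in>{..n}. \<forall>y\<in>{..n}. dist (g t) (d x) \<le> dist (g t) (d y)"
      by (intro bexI[of _ "arg_min_on (\<lambda>j. dist (g t) (d j)) {..n}"] ballI arg_min_least arg_min_if_finite(1)) auto
    then show ?thesis by (auto simp: P_def)
  qed
  then have L: "P n (L n t) t" for n t
    unfolding L_def by (rule LeastI_ex)
  have "(\<lambda>t. P n i t) \<in> measurable lebesgue (count_space UNIV)" for n i
  proof -
    have [measurable]: "Measurable.pred lebesgue (\<lambda>t. dist (g t) (d i) \<le> dist (g t) (d j))" for j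
      using borel_measurable_le[OF meas meas, of "d i" "d j"] by (simp add: pred_def)
    have "Measurable.pred lebesgue (\<lambda>t. i \<le> n \<and> (\<forall>j\<in>{..n}. dist (g t) (d i) \<le> dist (g t) (d j)))"
      by (intro pred_intros_logic pred_intros_finite) auto
    then show ?thesis by (simp add: P_def Ball_def)
  qed
  then have Lm: "L n \<in> measurable lebesgue (count_space UNIV)" for n
    unfolding L_def by (rule measurable_Least)
  have "simple_function lebesgue (\<lambda>t. d (L n t))" for n
  proof -
    have "simple_function lebesgue (L n)"
      unfolding simple_function_def
    proof
      show "finite (L n ` space lebesgue)"
        by (rule finite_subset[of _ "{..n}"]) (use L[unfolded P_def, THEN conjunct1] in auto)
      show "\<forall>x\<in>L n ` space lebesgue. L n -` {x} \<inter> space lebesgue \<in> sets lebesgue"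
        by (intro ballI measurable_sets[OF Lm]) simp
    qed
    then show ?thesis using simple_function_compose1 by blast
  qed
  moreover have "AE t in lebesgue. (\<lambda>n. d (L n t)) \<longlonglongrightarrow> g t"
    using D(3)
  proof eventually_elim
    case (elim t)
    show ?case
    proof (rule metric_LIMSEQ_I)
      fix e :: real assume "e > 0"
      then obtain x where "x \<in> D" "dist x (g t) < e" using elim closure_approachable by metis
      then obtain i where i: "dist (g t) (d i) < e" using range_d by (metis dist_commute rangeE)
      have "dist (d (L n t)) (g t) < e" if "n \<ge> i" for n
        using L[of n t] i that unfolding P_def by (metis dist_commute le_less_trans)
      then show "\<exists>N. \<forall>n\<ge>N. dist (d (L n t)) (g t) < e" by blast
    qed
  qed
  ultimately show ?thesis unfolding strongly_measurable_iff_simple by (intro exI[of _ "\<lambda>n t. d (L n t)"]) auto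
qed

text \<open>The simple functions approximating different \<open>f n\<close> are unrelated, so no
  diagonal sequence is formed. Instead the criterion above is applied: the limit is measurable, and
  almost all its values lie in the closure of the union of the countable sets belonging to the
  \<open>f n\<close>.\<close>

lemma strongly_measurable_limit:
  fixes g :: "real \<Rightarrow> 'h::real_normed_vector"
  assumes f: "\<And>n::nat. strongly_measurable (f n)" and lim: "AE t in lebesgue. (\<lambda>n. f n t) \<longlonglongrightarrow> g t"
  shows "strongly_measurable g"
proof -
  have "\<forall>n. \<exists>D. countable D \<and> D \<noteq> {} \<and> (AE t in lebesgue. f n t \<in> closure D)"
    using strongly_measurable_imp_separable[OF f] by metis
  then obtain D where D: "\<And>n. countable (D n)" "\<And>n. D n \<noteq> {}"
    "\<And>n. AE t in lebesgue. f n t \<in> closure (D n)" by metis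
  define P where "P = {t \<in> space lebesgue. \<not> (\<lambda>n. f n t) \<longlonglongrightarrow> g t}"
  have P: "P \<in> null_sets lebesgue"
    unfolding P_def using lim by (subst completion.AE_iff_null_sets[symmetric]) auto
  define g' where "g' t = (if t \<in> P then 0 else g t)" for t
  have "(\<lambda>t. if t \<in> P then 0 else f n t) \<in> borel_measurable lebesgue" for n
    using strongly_measurable_imp_measurable[OF f, of n] P by (intro measurable_If_set) auto
  then have "g' \<in> borel_measurable lebesgue"
    by (rule borel_measurable_LIMSEQ_metric) (auto simp: g'_def P_def)
  moreover have "AE t in lebesgue. g' t = g t"
    using AE_not_in[OF P] by eventually_elim (auto simp: g'_def)
  ultimately have g: "g \<in> borel_measurable lebesgue" by (rule measurable_cong_AE_lebesgue)
  have "AE t in lebesgue. \<forall>n. f n t \<in> closure (D n)" using D(3) by (subst AE_all_countable) auto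
  then have "AE t in lebesgue. g t \<in> closure (\<Union>n. D n)"
    using lim
  proof eventually_elim
    case (elim t)
    have "f n t \<in> closure (\<Union>n. D n)" for n
      using elim(1) closure_mono[of "D n" "\<Union>n. D n"] by blast
    then show ?case using elim(2) closed_sequentially[OF closed_closure, of "\<lambda>n. f n t"] by blast
  qed
  then show ?thesis
    using D by (intro strongly_measurableI_separable[of "\<Union>n. D n"] measurable_compose[OF g]
        borel_measurable_continuous_onI continuous_intros) auto
qed

lemma strongly_measurable_cong_AE:
  "strongly_measurable f \<Longrightarrow> AE t in lebesgue. f t = g t \<Longrightarrow> strongly_measurable g"
  by (rule strongly_measurable_limit[of "\<lambda>n. f"]) auto

text \<open>The simple functions approximate the real argument instead of the value, so the target
  space may be nonseparable.\<close>

lemma strongly_measurable_continuous: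
  fixes f :: "real \<Rightarrow> 'h::real_normed_vector"
  assumes "\<And>x. isCont f x"
  shows "strongly_measurable f"
proof -
  have "(\<lambda>x::real. x) \<in> borel_measurable lebesgue"
    by (intro borel_measurable_continuous_onI measurable_completion) auto
  from borel_measurable_implies_sequence_metric[OF this, of 0] obtain s :: "nat \<Rightarrow> real \<Rightarrow> real"
    where s: "\<forall>i. simple_function lebesgue (s i)" "\<forall>x\<in>space lebesgue. (\<lambda>i. s i x) \<longlonglongrightarrow> x"
    by blast
  have "strongly_measurable (\<lambda>x::real. x)"
    unfolding strongly_measurable_iff_simple using s by (intro exI[of _ s]) auto
  from strongly_measurable_compose[OF assms this] show ?thesis by simp
qed

lemma strongly_measurable_diff:
  "strongly_measurable f \<Longrightarrow> strongly_measurable g \<Longrightarrow> strongly_measurable (\<lambda>t. f t - g t)"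
  by (rule strongly_measurable_compose2) (rule tendsto_diff)

lemma strongly_measurable_add:
  "strongly_measurable f \<Longrightarrow> strongly_measurable g \<Longrightarrow> strongly_measurable (\<lambda>t. f t + g t)"
  by (rule strongly_measurable_compose2) (rule tendsto_add)

lemma strongly_measurable_scaleR:
  "strongly_measurable f \<Longrightarrow> strongly_measurable (\<lambda>t. c *\<^sub>R f t)"
  by (rule strongly_measurable_compose) auto

lemma borel_measurable_inner_strong:
  fixes f g :: "real \<Rightarrow> 'h::real_inner"
  assumes "strongly_measurable f" "strongly_measurable g"
  shows "(\<lambda>t. inner (f t) (g t)) \<in> borel_measurable lebesgue"
  by (rule strongly_measurable_imp_measurable, rule strongly_measurable_compose2[OF _ assms])
    (rule tendsto_inner)

lemma borel_measurable_norm_strong: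
  fixes f :: "real \<Rightarrow> 'h::real_normed_vector"
  assumes "strongly_measurable f"
  shows "(\<lambda>t. norm (f t)) \<in> borel_measurable lebesgue"
  using strongly_measurable_imp_measurable[OF assms] by simp

section \<open>Square-integrable functions\<close>

text \<open>Functions, not classes modulo null sets. Equality almost everywhere is carried along
  explicitly and becomes equality only after \<open>realize\<close> has mapped the functions to
  distributions.\<close>

definition L2 :: "(real \<Rightarrow> 'h::real_inner) set" where
  "L2 = {h. strongly_measurable h \<and> integrable lebesgue (\<lambda>t. (norm (h t))\<^sup>2)}"

definition L2norm :: "(real \<Rightarrow> 'h::real_inner) \<Rightarrow> real" where
  "L2norm h = sqrt (\<integral>t. (norm (h t))\<^sup>2 \<partial>lebesgue)"

text \<open>This is the real part of the complex inner product. It suffices for projections; complex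
  orthogonality is recovered in \<open>test_dist_dense\<close>.\<close>

definition L2inner :: "(real \<Rightarrow> 'h::real_inner) \<Rightarrow> (real \<Rightarrow> 'h) \<Rightarrow> real" where
  "L2inner h k = (\<integral>t. inner (h t) (k t) \<partial>lebesgue)"

lemma L2norm_nonneg [simp]: "0 \<le> L2norm h"
  by (simp add: L2norm_def)

lemma L2norm_square: "(L2norm h)\<^sup>2 = (\<integral>t. (norm (h t))\<^sup>2 \<partial>lebesgue)"
  by (simp add: L2norm_def)

lemma L2_iff_nn_integral:
  "h \<in> L2 \<longleftrightarrow> strongly_measurable h \<and> (\<integral>\<^sup>+t. ennreal ((norm (h t))\<^sup>2) \<partial>lebesgue) < \<infinity>"
  using borel_measurable_norm_strong[of h] by (auto simp: L2_def integrable_iff_bounded)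

lemma nn_integral_L2:
  "h \<in> L2 \<Longrightarrow> (\<integral>\<^sup>+t. ennreal ((norm (h t))\<^sup>2) \<partial>lebesgue) = ennreal ((L2norm h)\<^sup>2)"
  by (simp add: L2norm_square L2_def nn_integral_eq_integral)

lemma integrable_inner_L2:
  assumes "h \<in> L2" "k \<in> L2"
  shows "integrable lebesgue (\<lambda>t. inner (h t) (k t))"
proof (rule Bochner_Integration.integrable_bound)
  show "integrable lebesgue (\<lambda>t. (norm (h t))\<^sup>2 + (norm (k t))\<^sup>2)"
    using assms by (simp add: L2_def)
  show "(\<lambda>t. inner (h t) (k t)) \<in> borel_measurable lebesgue"
    using assms by (simp add: L2_def borel_measurable_inner_strong)
  have "\<bar>inner (h t) (k t)\<bar> \<le> (norm (h t))\<^sup>2 + (norm (k t))\<^sup>2" for t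
  proof -
    have "2 * (norm (h t) * norm (k t)) \<le> (norm (h t))\<^sup>2 + (norm (k t))\<^sup>2"
      using sum_squares_bound[of "norm (h t)" "norm (k t)"] by (simp add: algebra_simps)
    moreover have "0 \<le> norm (h t) * norm (k t)" by simp
    ultimately show ?thesis using Cauchy_Schwarz_ineq2[of "h t" "k t"] by linarith
  qed
  then show "AE t in lebesgue. norm (inner (h t) (k t)) \<le> norm ((norm (h t))\<^sup>2 + (norm (k t))\<^sup>2)"
    by simp
qed

lemma L2_scaleR: "h \<in> L2 \<Longrightarrow> (\<lambda>t. c *\<^sub>R h t) \<in> L2"
  by (auto simp: L2_def strongly_measurable_scaleR power_mult_distrib)

lemma L2_add:
  assumes "h \<in> L2" "k \<in> L2"
  shows "(\<lambda>t. h t + k t) \<in> L2"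
proof -
  have "(norm (h t + k t))\<^sup>2 = (norm (h t))\<^sup>2 + (norm (k t))\<^sup>2 + 2 * inner (h t) (k t)" for t
    by (simp add: power2_norm_eq_inner inner_add inner_commute)
  then show ?thesis
    using assms integrable_inner_L2[OF assms] by (simp add: L2_def strongly_measurable_add)
qed

lemma L2_diff: "h \<in> L2 \<Longrightarrow> k \<in> L2 \<Longrightarrow> (\<lambda>t. h t - k t) \<in> L2"
  using L2_add[OF _ L2_scaleR[of k "-1"], of h] by simp

lemma L2norm_add_square:
  assumes "h \<in> L2" "k \<in> L2"
  shows "(L2norm (\<lambda>t. h t + k t))\<^sup>2 = (L2norm h)\<^sup>2 + (L2norm k)\<^sup>2 + 2 * L2inner h k"
proof -
  have "(norm (h t + k t))\<^sup>2 = (norm (h t))\<^sup>2 + (norm (k t))\<^sup>2 + 2 * inner (h t) (k t)" for t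
    by (simp add: power2_norm_eq_inner inner_add inner_commute)
  then show ?thesis
    using assms integrable_inner_L2[OF assms] by (simp add: L2norm_square L2inner_def L2_def)
qed

lemma L2norm_scaleR: "L2norm (\<lambda>t. c *\<^sub>R h t) = \<bar>c\<bar> * L2norm h"
  by (simp add: L2norm_def power_mult_distrib real_sqrt_mult)

lemma L2inner_scaleR_right: "L2inner h (\<lambda>t. c *\<^sub>R k t) = c * L2inner h k"
  by (simp add: L2inner_def)

lemma L2norm_commute: "L2norm (\<lambda>t. h t - k t) = L2norm (\<lambda>t. k t - h t)"
  by (simp add: L2norm_def norm_minus_commute)

lemma L2norm_eq_0:
  assumes "h \<in> L2"
  shows "L2norm h = 0 \<longleftrightarrow> (AE t in lebesgue. h t = 0)"
  using assms by (simp add: L2norm_def L2_def integral_nonneg_eq_0_iff_AE)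

lemma L2inner_Cauchy_Schwarz:
  assumes "h \<in> L2" "k \<in> L2"
  shows "L2inner h k \<le> L2norm h * L2norm k"
proof -
  have *: "- 2 * c * L2inner h k \<le> (L2norm h)\<^sup>2 + c\<^sup>2 * (L2norm k)\<^sup>2" for c
  proof -
    have "0 \<le> (L2norm (\<lambda>t. h t + c *\<^sub>R k t))\<^sup>2" by simp
    then show ?thesis
      using L2norm_add_square[OF assms(1) L2_scaleR[OF assms(2)], of c]
      by (simp add: L2norm_scaleR L2inner_scaleR_right power_mult_distrib)
  qed
  have "L2inner h k \<le> (L2norm h + e) * (L2norm k + e)" if "e > 0" for e
  proof -
    \<comment> \<open>The quadratic in \<open>c\<close> is evaluated at minus the quotient of the
      two norms. Enlarging both norms by \<open>e\<close> keeps the denominator positive even if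
      \<open>k\<close> vanishes almost everywhere.\<close>
    let ?a = "L2norm h + e" and ?b = "L2norm k + e"
    have pos: "?a > 0" "?b > 0" using that by (auto intro: add_nonneg_pos)
    have "2 * (?a / ?b) * L2inner h k \<le> (L2norm h)\<^sup>2 + (?a / ?b)\<^sup>2 * (L2norm k)\<^sup>2"
      using *[of "- (?a / ?b)"] by (simp only: mult_minus_left mult_minus_right minus_minus power2_minus)
    also have "\<dots> \<le> ?a\<^sup>2 + (?a / ?b)\<^sup>2 * ?b\<^sup>2"
      using that by (intro add_mono mult_left_mono power_mono) auto
    also have "\<dots> = 2 * ?a\<^sup>2" using pos by (simp add: power_divide)
    finally have "(2 * ?a) * (L2inner h k / ?b) \<le> (2 * ?a) * ?a"
      by (simp only: power2_eq_square mult.assoc times_divide_eq_left times_divide_eq_right)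
    moreover have "0 < 2 * ?a" by (rule mult_pos_pos[OF zero_less_numeral pos(1)])
    ultimately have "L2inner h k / ?b \<le> ?a" by (rule mult_left_le_imp_le)
    then show ?thesis by (simp only: pos_divide_le_eq[OF pos(2)])
  qed
  moreover have "((\<lambda>e. (L2norm h + e) * (L2norm k + e)) \<longlongrightarrow> (L2norm h + 0) * (L2norm k + 0)) (at_right 0)"
    by (intro tendsto_intros)
  ultimately show ?thesis
    by (intro tendsto_lowerbound[of "\<lambda>e. (L2norm h + e) * (L2norm k + e)" _ "at_right 0"])
      (auto simp: eventually_at_right_less intro!: eventually_mono[OF eventually_at_right_less[of 0]])
qed

lemma L2norm_triangle:
  assumes "h \<in> L2" "k \<in> L2"
  shows "L2norm (\<lambda>t. h t + k t) \<le> L2norm h + L2norm k"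
proof (rule power2_le_imp_le)
  show "(L2norm (\<lambda>t. h t + k t))\<^sup>2 \<le> (L2norm h + L2norm k)\<^sup>2"
    using L2norm_add_square[OF assms] L2inner_Cauchy_Schwarz[OF assms] by (simp add: power2_sum)
qed simp

lemma L2norm_triangle_diff:
  assumes "f \<in> L2" "g \<in> L2" "h \<in> L2"
  shows "L2norm (\<lambda>t. f t - h t) \<le> L2norm (\<lambda>t. f t - g t) + L2norm (\<lambda>t. g t - h t)"
  using L2norm_triangle[OF L2_diff[OF assms(1,2)] L2_diff[OF assms(2,3)]] by simp

section \<open>Completeness of the square-integrable functions\<close>

lemma Cauchy_summable_increments:
  fixes u :: "nat \<Rightarrow> 'a::real_normed_vector"
  assumes "summable (\<lambda>k. norm (u (Suc k) - u k))"
  shows "Cauchy u"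
proof (rule CauchyI')
  fix e :: real assume "e > 0"
  then obtain N where N: "\<And>m n. m \<ge> N \<Longrightarrow> norm (\<Sum>k=m..<n. norm (u (Suc k) - u k)) < e"
    using assms unfolding summable_Cauchy by metis
  have "dist (u m) (u n) < e" if "m \<ge> N" "m < n" for m n
  proof -
    have "norm (u n - u m) = norm (\<Sum>k=m..<n. u (Suc k) - u k)"
      using that by (subst sum_Suc_diff') auto
    also have "\<dots> \<le> (\<Sum>k=m..<n. norm (u (Suc k) - u k))" by (rule norm_sum)
    also have "\<dots> < e" using N[OF that(1), of n] by simp
    finally show ?thesis by (simp add: dist_norm norm_minus_commute)
  qed
  then show "\<exists>M. \<forall>m\<ge>M. \<forall>n>m. dist (u m) (u n) < e" by blast
qed

text \<open>Riesz-Fischer: a subsequence with geometrically small increments converges almost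
  everywhere, and Fatou's lemma upgrades its pointwise limit to a limit in norm of the whole
  sequence.\<close>

lemma L2_complete:
  fixes f :: "nat \<Rightarrow> real \<Rightarrow> 'h::{real_inner, complete_space}"
  assumes f: "\<And>n. f n \<in> L2"
    and Cauchy: "\<And>e. e > 0 \<Longrightarrow> \<exists>N. \<forall>m\<ge>N. \<forall>n\<ge>N. L2norm (\<lambda>t. f m t - f n t) < e"
  obtains g where "g \<in> L2" "(\<lambda>n. L2norm (\<lambda>t. f n t - g t)) \<longlonglongrightarrow> 0"
proof -
  have "\<forall>k. \<exists>N. \<forall>m\<ge>N. \<forall>n\<ge>N. L2norm (\<lambda>t. f m t - f n t) < (1/2) ^ k"
    using Cauchy by simp
  then obtain N where N: "\<And>k m n. m \<ge> N k \<Longrightarrow> n \<ge> N k \<Longrightarrow> L2norm (\<lambda>t. f m t - f n t) < (1/2) ^ k"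
    by metis
  \<comment> \<open>The maximum puts \<open>r k\<close> beyond every \<open>N j\<close> with j \<le>
    k. The increments need this for j = k, the Fatou estimate for a fixed \<open>j\<close> and all
    later \<open>k\<close>.\<close>
  define r where "r k = Max (N ` {..k})" for k
  have r: "N j \<le> r k" if "j \<le> k" for j k
    using that by (auto simp: r_def)
  define D where "D k t = f (r (Suc k)) t - f (r k) t" for k t
  have D: "D k \<in> L2" for k
    unfolding D_def by (intro L2_diff f)
  have normD: "L2norm (D k) < (1/2) ^ k" for k
    unfolding D_def by (intro N r) auto
  \<comment> \<open>The squared increments integrate to at most 4^-k, so the weight 2^k keeps the
    series finite. The weight pays for the missing square later: x \<le> 2^-k + 2^k x^2 turns
    summable weighted squares into summable norms.\<close>
  have "(\<integral>\<^sup>+t. (\<Sum>k. ennreal (2 ^ k * (norm (D k t))\<^sup>2)) \<partial>lebesgue)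
      = (\<Sum>k. \<integral>\<^sup>+t. ennreal (2 ^ k * (norm (D k t))\<^sup>2) \<partial>lebesgue)"
    using D borel_measurable_norm_strong[of "D _"] by (intro nn_integral_suminf) (simp add: L2_def)
  also have "\<dots> \<le> (\<Sum>k. ennreal ((1/2) ^ k))"
  proof (intro suminf_le summableI)
    fix k
    have "(\<integral>\<^sup>+t. ennreal (2 ^ k * (norm (D k t))\<^sup>2) \<partial>lebesgue) = ennreal (2 ^ k * (L2norm (D k))\<^sup>2)"
      using D[of k] borel_measurable_norm_strong[of "D k"]
      by (simp add: ennreal_mult nn_integral_cmult nn_integral_L2 L2_def)
    also have "\<dots> \<le> ennreal (2 ^ k * ((1/2) ^ k)\<^sup>2)"
      using normD[of k] by (intro ennreal_leI mult_left_mono power_mono) auto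
    also have "2 ^ k * ((1/2) ^ k)\<^sup>2 = (1/2::real) ^ k"
      by (simp add: power2_eq_square power_divide)
    finally show "(\<integral>\<^sup>+t. ennreal (2 ^ k * (norm (D k t))\<^sup>2) \<partial>lebesgue) \<le> ennreal ((1/2) ^ k)" .
  qed
  also have "\<dots> = ennreal (\<Sum>k. (1/2) ^ k)"
    by (intro suminf_ennreal2 summable_geometric) auto
  finally have "(\<integral>\<^sup>+t. (\<Sum>k. ennreal (2 ^ k * (norm (D k t))\<^sup>2)) \<partial>lebesgue) \<noteq> \<infinity>"
    by (auto simp: top_unique)
  moreover have "(\<lambda>t. \<Sum>k. ennreal (2 ^ k * (norm (D k t))\<^sup>2)) \<in> borel_measurable lebesgue"
    using D borel_measurable_norm_strong[of "D _"] by (intro borel_measurable_suminf_order) (simp add: L2_def)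
  ultimately have "AE t in lebesgue. (\<Sum>k. ennreal (2 ^ k * (norm (D k t))\<^sup>2)) \<noteq> \<infinity>"
    by (intro nn_integral_PInf_AE)
  then have lim: "AE t in lebesgue. (\<lambda>k. f (r k) t) \<longlonglongrightarrow> lim (\<lambda>k. f (r k) t)"
  proof eventually_elim
    case (elim t)
    have sq: "summable (\<lambda>k. 2 ^ k * (norm (D k t))\<^sup>2)"
      using elim by (intro summable_suminf_not_top) auto
    have "summable (\<lambda>k. norm (D k t))"
    proof (rule summable_comparison_test'[where N = 0])
      show "summable (\<lambda>k. (1/2) ^ k + 2 ^ k * (norm (D k t))\<^sup>2)"
        using sq by (intro summable_add summable_geometric) auto
      fix k :: nat
      let ?x = "norm (D k t)" and ?a = "(2::real) ^ k"
      have "0 \<le> (1 - ?a * ?x)\<^sup>2 + ?a * ?x" by simp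
      then have "?a * ?x \<le> ?a * (1 / ?a + ?a * ?x\<^sup>2)"
        by (simp add: power2_eq_square algebra_simps)
      then have "?x \<le> 1 / ?a + ?a * ?x\<^sup>2" by (simp only: mult_le_cancel_left_pos zero_less_power zero_less_numeral)
      then show "norm ?x \<le> (1/2) ^ k + ?a * ?x\<^sup>2" by (simp add: power_divide)
    qed
    then have "Cauchy (\<lambda>k. f (r k) t)"
      by (intro Cauchy_summable_increments) (simp add: D_def)
    then show ?case using Cauchy_convergent convergent_LIMSEQ_iff by blast
  qed
  define g where "g t = lim (\<lambda>k. f (r k) t)" for t
  have lim: "AE t in lebesgue. (\<lambda>k. f (r k) t) \<longlonglongrightarrow> g t" using lim by (simp add: g_def)
  have sm: "strongly_measurable (f n)" for n using f by (simp add: L2_def)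
  have g: "strongly_measurable g"
    using lim by (rule strongly_measurable_limit[rotated]) (rule sm)
  have bound: "(\<integral>\<^sup>+t. ennreal ((norm (f n t - g t))\<^sup>2) \<partial>lebesgue) \<le> ennreal (((1/2) ^ j)\<^sup>2)"
    if "n \<ge> N j" for n j
  proof -
    have "(\<integral>\<^sup>+t. ennreal ((norm (f n t - g t))\<^sup>2) \<partial>lebesgue)
        = (\<integral>\<^sup>+t. liminf (\<lambda>k. ennreal ((norm (f n t - f (r k) t))\<^sup>2)) \<partial>lebesgue)"
    proof (rule nn_integral_cong_AE)
      show "AE t in lebesgue. ennreal ((norm (f n t - g t))\<^sup>2)
          = liminf (\<lambda>k. ennreal ((norm (f n t - f (r k) t))\<^sup>2))"
        using lim
      proof eventually_elim
        case (elim t)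
        have "(\<lambda>k. ennreal ((norm (f n t - f (r k) t))\<^sup>2)) \<longlonglongrightarrow> ennreal ((norm (f n t - g t))\<^sup>2)"
          by (intro tendsto_intros elim)
        from lim_imp_Liminf[OF _ this] show ?case by simp
      qed
    qed
    also have "\<dots> \<le> liminf (\<lambda>k. \<integral>\<^sup>+t. ennreal ((norm (f n t - f (r k) t))\<^sup>2) \<partial>lebesgue)"
      by (intro nn_integral_liminf measurable_compose[OF _ measurable_ennreal] borel_measurable_power
          borel_measurable_norm_strong strongly_measurable_diff sm)
    also have "\<dots> \<le> limsup (\<lambda>k. \<integral>\<^sup>+t. ennreal ((norm (f n t - f (r k) t))\<^sup>2) \<partial>lebesgue)"
      by (rule Liminf_le_Limsup) simp
    also have "\<dots> \<le> ennreal (((1/2) ^ j)\<^sup>2)"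
    proof (rule Limsup_bounded)
      show "\<forall>\<^sub>F k in sequentially. (\<integral>\<^sup>+t. ennreal ((norm (f n t - f (r k) t))\<^sup>2) \<partial>lebesgue)
          \<le> ennreal (((1/2) ^ j)\<^sup>2)"
      proof (rule eventually_sequentiallyI[of j])
        fix k assume "j \<le> k"
        then have "L2norm (\<lambda>t. f n t - f (r k) t) < (1/2) ^ j"
          using that r by (intro N) auto
        then show "(\<integral>\<^sup>+t. ennreal ((norm (f n t - f (r k) t))\<^sup>2) \<partial>lebesgue) \<le> ennreal (((1/2) ^ j)\<^sup>2)"
          by (subst nn_integral_L2[OF L2_diff[OF f f]]) (intro ennreal_leI power_mono, auto)
      qed
    qed
    finally show ?thesis .
  qed
  have diff: "(\<lambda>t. f n t - g t) \<in> L2" if "n \<ge> N j" for n j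
    unfolding L2_iff_nn_integral using bound[OF that] g sm[of n]
    by (auto intro: strongly_measurable_diff le_less_trans)
  have "g \<in> L2"
    using L2_diff[OF f[of "N 0"] diff[of 0 "N 0"]] by simp
  moreover have "(\<lambda>n. L2norm (\<lambda>t. f n t - g t)) \<longlonglongrightarrow> 0"
  proof (rule LIMSEQ_I)
    fix e :: real assume "e > 0"
    then obtain j where j: "(1/2) ^ j < e" using real_arch_pow_inv[of e "1/2"] by auto
    have "norm (L2norm (\<lambda>t. f n t - g t) - 0) < e" if "n \<ge> N j" for n
    proof -
      have "ennreal ((L2norm (\<lambda>t. f n t - g t))\<^sup>2) \<le> ennreal (((1/2) ^ j)\<^sup>2)"
        using bound[OF that] nn_integral_L2[OF diff[OF that]] by simp
      then have "(L2norm (\<lambda>t. f n t - g t))\<^sup>2 \<le> ((1/2) ^ j)\<^sup>2" by (subst (asm) ennreal_le_iff) auto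
      then have "L2norm (\<lambda>t. f n t - g t) \<le> (1/2) ^ j" by (rule power2_le_imp_le) simp
      then show ?thesis using j by simp
    qed
    then show "\<exists>no. \<forall>n\<ge>no. norm (L2norm (\<lambda>t. f n t - g t) - 0) < e" by blast
  qed
  ultimately show thesis by (rule that)
qed

section \<open>Density through orthogonal projection\<close>

lemma quadratic_nonneg_imp_linear_zero:
  fixes a b :: real
  assumes "\<And>c. 0 \<le> c\<^sup>2 * b - 2 * c * a"
  shows "a = 0"
proof (rule ccontr)
  assume a: "a \<noteq> 0"
  have b: "b \<ge> 0"
    using assms[of 1] assms[of "-1"] by simp
  \<comment> \<open>The quadratic is least at a / b; the denominator b + 1 avoids the case b = 0 and
    still gives a contradiction.\<close>
  have "2 * (a / (b + 1)) * a \<le> (a / (b + 1))\<^sup>2 * b"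
    using assms[of "a / (b + 1)"] by simp
  also have "\<dots> \<le> (a / (b + 1))\<^sup>2 * (b + 1)" by (intro mult_left_mono) auto
  also have "\<dots> = (a / (b + 1)) * (a / (b + 1) * (b + 1))" by (simp only: power2_eq_square mult.assoc)
  also have "a / (b + 1) * (b + 1) = a" using b by simp
  finally have "a * a / (b + 1) \<le> 0" by simp
  moreover have "a * a / (b + 1) > 0" using a b by (auto simp: zero_less_mult_iff intro!: divide_pos_pos)
  ultimately show False by linarith
qed

text \<open>The orthogonal projection onto the closure of \<open>V\<close>, obtained from a minimizing sequence.\<close>

lemma L2_dense_if_orthogonal_trivial:
  fixes V :: "(real \<Rightarrow> 'h::{real_inner, complete_space}) set"
  assumes V: "V \<subseteq> L2" "V \<noteq> {}"
    and add: "\<And>v w. v \<in> V \<Longrightarrow> w \<in> V \<Longrightarrow> (\<lambda>t. v t + w t) \<in> V"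
    and scale: "\<And>c v. v \<in> V \<Longrightarrow> (\<lambda>t. c *\<^sub>R v t) \<in> V"
    and orth: "\<And>k. k \<in> L2 \<Longrightarrow> (\<And>v. v \<in> V \<Longrightarrow> L2inner k v = 0) \<Longrightarrow> L2norm k = 0"
    and h: "h \<in> L2" and "e > 0"
  shows "\<exists>v\<in>V. L2norm (\<lambda>t. h t - v t) < e"
proof -
  define d where "d = (INF v\<in>V. (L2norm (\<lambda>t. h t - v t))\<^sup>2)"
  have bdd: "bdd_below ((\<lambda>v. (L2norm (\<lambda>t. h t - v t))\<^sup>2) ` V)" by (intro bdd_belowI2[of _ 0]) simp
  have d_le: "d \<le> (L2norm (\<lambda>t. h t - v t))\<^sup>2" if "v \<in> V" for v
    unfolding d_def using that bdd by (rule cINF_lower[rotated])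
  have "d \<ge> 0" unfolding d_def using V(2) by (intro cINF_greatest) auto
  have "\<exists>v\<in>V. (L2norm (\<lambda>t. h t - v t))\<^sup>2 < d + 1 / (real n + 1)" for n
    using cINF_less_iff[OF V(2) bdd, of "d + 1 / (real n + 1)"] by (simp add: d_def)
  then obtain v where v: "\<And>n. v n \<in> V" "\<And>n. (L2norm (\<lambda>t. h t - v n t))\<^sup>2 < d + 1 / (real n + 1)"
    by metis
  have vL: "v n \<in> L2" for n using v(1) V(1) by auto
  have parallelogram: "(L2norm (\<lambda>t. v m t - v n t))\<^sup>2 \<le> 2 / (real m + 1) + 2 / (real n + 1)" for m n
  proof -
    let ?a = "\<lambda>t. h t - v m t" and ?b = "\<lambda>t. h t - v n t"
    have ab: "?a \<in> L2" "?b \<in> L2" by (intro L2_diff h vL)+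
    let ?w = "\<lambda>t. (1/2) *\<^sub>R (v m t + v n t)"
    \<comment> \<open>The midpoint of \<open>v m\<close> and \<open>v n\<close> is an admissible
      competitor, so its squared distance from \<open>h\<close> is at least \<open>d\<close>. The
      parallelogram law then leaves little room for the distance between \<open>v m\<close> and
      \<open>v n\<close>.\<close>
    have "?w \<in> V" by (intro scale add v)
    from d_le[OF this] have "4 * d \<le> (L2norm (\<lambda>t. 2 *\<^sub>R (h t - ?w t)))\<^sup>2"
      by (simp add: L2norm_scaleR power_mult_distrib del: scaleR_half_double)
    also have "(\<lambda>t. 2 *\<^sub>R (h t - ?w t)) = (\<lambda>t. ?a t + ?b t)"
      by (simp add: scaleR_2 algebra_simps fun_eq_iff)
    also have "(L2norm (\<lambda>t. ?a t + ?b t))\<^sup>2 = (L2norm ?a)\<^sup>2 + (L2norm ?b)\<^sup>2 + 2 * L2inner ?a ?b"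
      by (rule L2norm_add_square[OF ab])
    finally have 1: "4 * d \<le> (L2norm ?a)\<^sup>2 + (L2norm ?b)\<^sup>2 + 2 * L2inner ?a ?b" .
    have "(L2norm (\<lambda>t. ?b t + (-1) *\<^sub>R ?a t))\<^sup>2
        = (L2norm ?b)\<^sup>2 + (L2norm (\<lambda>t. (-1) *\<^sub>R ?a t))\<^sup>2 + 2 * L2inner ?b (\<lambda>t. (-1) *\<^sub>R ?a t)"
      by (rule L2norm_add_square[OF ab(2) L2_scaleR[OF ab(1)]])
    also have "\<dots> = (L2norm ?b)\<^sup>2 + (L2norm ?a)\<^sup>2 - 2 * L2inner ?a ?b"
      by (simp only: L2norm_scaleR L2inner_scaleR_right) (simp add: L2inner_def inner_commute)
    also have "(\<lambda>t. ?b t + (-1) *\<^sub>R ?a t) = (\<lambda>t. v m t - v n t)" by (simp add: fun_eq_iff)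
    finally have "(L2norm (\<lambda>t. v m t - v n t))\<^sup>2 \<le> 2 * (1 / (real m + 1)) + 2 * (1 / (real n + 1))"
      using 1 v(2)[of m] v(2)[of n] by linarith
    then show ?thesis by simp
  qed
  have "\<exists>N. \<forall>m\<ge>N. \<forall>n\<ge>N. L2norm (\<lambda>t. v m t - v n t) < e'" if e': "e' > 0" for e'
  proof -
    obtain N where "4 / e'\<^sup>2 < real N" using reals_Archimedean2 by blast
    then have "4 < real N * e'\<^sup>2" using e' by (simp add: pos_divide_less_eq)
    also have "\<dots> \<le> e'\<^sup>2 * (real N + 1)" by (simp add: algebra_simps)
    finally have N: "4 / (real N + 1) < e'\<^sup>2" by (simp add: pos_divide_less_eq)
    have "L2norm (\<lambda>t. v m t - v n t) < e'" if "m \<ge> N" "n \<ge> N" for m n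
    proof (rule power_less_imp_less_base)
      have "2 / (real m + 1) \<le> 2 / (real N + 1)" "2 / (real n + 1) \<le> 2 / (real N + 1)"
        using that by (auto intro!: divide_left_mono)
      with parallelogram[of m n] N show "(L2norm (\<lambda>t. v m t - v n t))\<^sup>2 < e'\<^sup>2" by simp
    qed (use \<open>e' > 0\<close> in simp)
    then show ?thesis by blast
  qed
  from L2_complete[OF vL this] obtain p
    where p: "p \<in> L2" "(\<lambda>n. L2norm (\<lambda>t. v n t - p t)) \<longlonglongrightarrow> 0" by blast
  let ?k = "\<lambda>t. h t - p t"
  have k: "?k \<in> L2" by (intro L2_diff h p)
  have "(L2norm ?k)\<^sup>2 \<le> d"
  proof -
    have "L2norm ?k \<le> sqrt (d + 1 / (real n + 1)) + L2norm (\<lambda>t. v n t - p t)" for n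
    proof -
      have "L2norm (\<lambda>t. h t - v n t) \<le> sqrt (d + 1 / (real n + 1))"
        using v(2)[of n] by (intro real_le_rsqrt) simp
      then show ?thesis using L2norm_triangle_diff[OF h vL[of n] p(1)] by linarith
    qed
    moreover have "(\<lambda>n. sqrt (d + 1 / (real n + 1)) + L2norm (\<lambda>t. v n t - p t)) \<longlonglongrightarrow> sqrt (d + 0) + 0"
      using LIMSEQ_inverse_real_of_nat by (intro tendsto_intros p(2)) (simp add: inverse_eq_divide add.commute)
    ultimately have "L2norm ?k \<le> sqrt d" by (intro LIMSEQ_le_const) auto
    then show ?thesis using \<open>d \<ge> 0\<close> power_mono[of "L2norm ?k" "sqrt d" 2] by simp
  qed
  have "L2inner ?k w = 0" if w: "w \<in> V" for w
  proof (rule quadratic_nonneg_imp_linear_zero)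
    fix c
    have wL: "w \<in> L2" using w V(1) by auto
    let ?kc = "\<lambda>t. ?k t + (- c) *\<^sub>R w t"
    have kc: "?kc \<in> L2" by (intro L2_add L2_scaleR k wL)
    \<comment> \<open>The limit \<open>p\<close> need not belong to \<open>V\<close>, so the
      competitor is \<open>v n\<close> plus a multiple of \<open>w\<close>, and the error between
      \<open>v n\<close> and \<open>p\<close> is sent to 0 afterwards.\<close>
    have "sqrt d \<le> L2norm ?kc"
    proof -
      have "sqrt d \<le> L2norm ?kc + L2norm (\<lambda>t. v n t - p t)" for n
      proof -
        have "(\<lambda>t. v n t + c *\<^sub>R w t) \<in> V" by (intro add scale v w)
        from d_le[OF this] have "sqrt d \<le> L2norm (\<lambda>t. h t - (v n t + c *\<^sub>R w t))"
          by (simp add: real_le_lsqrt)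
        also have "(\<lambda>t. h t - (v n t + c *\<^sub>R w t)) = (\<lambda>t. ?kc t + (-1) *\<^sub>R (v n t - p t))"
          by (simp add: fun_eq_iff)
        also have "L2norm \<dots> \<le> L2norm ?kc + L2norm (\<lambda>t. (-1) *\<^sub>R (v n t - p t))"
          by (intro L2norm_triangle kc L2_scaleR L2_diff vL p)
        finally show ?thesis by (simp only: L2norm_scaleR[of "-1"] abs_minus abs_one mult_1)
      qed
      moreover have "(\<lambda>n. L2norm ?kc + L2norm (\<lambda>t. v n t - p t)) \<longlonglongrightarrow> L2norm ?kc + 0"
        by (intro tendsto_intros p(2))
      ultimately show ?thesis using LIMSEQ_le_const by fastforce
    qed
    then have "d \<le> (L2norm ?kc)\<^sup>2"
      using \<open>d \<ge> 0\<close> power_mono[of "sqrt d" "L2norm ?kc" 2] by simp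
    also have "\<dots> = (L2norm ?k)\<^sup>2 + c\<^sup>2 * (L2norm w)\<^sup>2 - 2 * c * L2inner ?k w"
      using L2norm_add_square[OF k L2_scaleR[OF wL, of "- c"]]
      by (simp only: L2norm_scaleR L2inner_scaleR_right power_mult_distrib) simp
    finally show "0 \<le> c\<^sup>2 * (L2norm w)\<^sup>2 - 2 * c * L2inner ?k w"
      using \<open>(L2norm ?k)\<^sup>2 \<le> d\<close> by linarith
  qed
  then have k0: "L2norm ?k = 0" by (rule orth[OF k])
  obtain n where n: "L2norm (\<lambda>t. v n t - p t) < e"
    using LIMSEQ_D[OF p(2) \<open>e > 0\<close>] by auto
  have "L2norm (\<lambda>t. h t - v n t) \<le> L2norm ?k + L2norm (\<lambda>t. p t - v n t)"
    by (rule L2norm_triangle_diff[OF h p(1) vL])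
  then have "L2norm (\<lambda>t. h t - v n t) < e"
    using k0 n L2norm_commute[of p "v n"] by simp
  then show ?thesis using v(1) by blast
qed

section \<open>Test functions\<close>

definition smooth_fun :: "(real \<Rightarrow> 'a::real_normed_vector) \<Rightarrow> bool" where
  "smooth_fun f \<longleftrightarrow> (\<exists>D. D 0 = f \<and> (\<forall>n::nat. \<forall>t. (D n has_vector_derivative D (Suc n) t) (at t)))"

lemma test_fun_iff: "test_fun \<phi> \<longleftrightarrow> (\<exists>R. \<forall>t. \<bar>t\<bar> > R \<longrightarrow> \<phi> t = 0) \<and> smooth_fun \<phi>"
proof -
  have "bounded {t. \<phi> t \<noteq> 0} \<longleftrightarrow> (\<exists>R. \<forall>t. \<bar>t\<bar> > R \<longrightarrow> \<phi> t = 0)"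
    unfolding bounded_iff by (auto simp: not_le[symmetric])
  then show ?thesis by (simp add: test_fun_def smooth_fun_def compact_closure)
qed

text \<open>Intended for the bump function, whose higher derivatives are easier to enclose in a
  family stable under differentiation than to compute.\<close>

lemma smooth_fun_coinduct:
  assumes "\<And>f. f \<in> A \<Longrightarrow> \<exists>f'\<in>A. \<forall>t. (f has_vector_derivative f' t) (at t)" and "f \<in> A"
  shows "smooth_fun f"
proof -
  from assms(1) obtain d where d: "\<And>f. f \<in> A \<Longrightarrow> d f \<in> A"
    "\<And>f t. f \<in> A \<Longrightarrow> (f has_vector_derivative d f t) (at t)"
    by metis
  have "(d ^^ n) f \<in> A" for n by (induction n) (auto intro: d assms(2))
  then show ?thesis
    unfolding smooth_fun_def using d(2) by (intro exI[of _ "\<lambda>n. (d ^^ n) f"]) auto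
qed

lemma smooth_fun_derivative:
  assumes "smooth_fun f"
  obtains f' where "smooth_fun f'" "\<And>t. (f has_vector_derivative f' t) (at t)"
proof -
  obtain D where D: "D 0 = f" "\<And>n t. (D n has_vector_derivative D (Suc n) t) (at t)"
    using assms unfolding smooth_fun_def by metis
  have "smooth_fun (D (Suc 0))"
    unfolding smooth_fun_def using D(2) by (intro exI[of _ "\<lambda>n. D (Suc n)"]) auto
  then show thesis using that D by metis
qed

lemma smooth_fun_isCont:
  assumes "smooth_fun f"
  shows "isCont f t"
proof -
  obtain f' where "(f has_vector_derivative f' t) (at t)" using assms smooth_fun_derivative by metis
  then show ?thesis by (rule has_vector_derivative_continuous)
qed

lemma test_fun_continuous: "test_fun \<phi> \<Longrightarrow> continuous_on S \<phi>"
  using smooth_fun_isCont by (auto simp: test_fun_iff intro!: continuous_at_imp_continuous_on)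

lemma test_fun_derivative:
  assumes "test_fun f"
  obtains f' where "test_fun f'" "\<And>t. (f has_vector_derivative f' t) (at t)"
proof -
  obtain f' where f': "smooth_fun f'" "\<And>t. (f has_vector_derivative f' t) (at t)"
    using assms smooth_fun_derivative unfolding test_fun_iff by metis
  obtain R where R: "\<And>t. \<bar>t\<bar> > R \<Longrightarrow> f t = 0" using assms unfolding test_fun_iff by metis
  have "f' t = 0" if "\<bar>t\<bar> > R" for t
  proof -
    have op: "open {s. \<bar>s\<bar> > R}" by (intro open_Collect_less continuous_intros)
    have "((\<lambda>_. 0) has_vector_derivative f' t) (at t)"
      by (rule has_vector_derivative_transform_within_open[OF f'(2) op]) (use that R in auto)
    then show ?thesis using vector_derivative_unique_at has_vector_derivative_const by metis
  qed
  then show thesis using that[of f'] f' by (auto simp: test_fun_iff)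
qed

lemma smooth_fun_linear:
  assumes "bounded_linear L" "smooth_fun f"
  shows "smooth_fun (\<lambda>t. L (f t))"
proof -
  obtain D where "D 0 = f" "\<And>n t. (D n has_vector_derivative D (Suc n) t) (at t)"
    using assms(2) unfolding smooth_fun_def by metis
  then show ?thesis unfolding smooth_fun_def
    by (intro exI[of _ "\<lambda>n t. L (D n t)"]) (auto intro: bounded_linear.has_vector_derivative[OF assms(1)])
qed

lemma smooth_fun_add:
  assumes "smooth_fun f" "smooth_fun g"
  shows "smooth_fun (\<lambda>t. f t + g t)"
proof -
  obtain D where "D 0 = f" "\<And>n t. (D n has_vector_derivative D (Suc n) t) (at t)"
    using assms(1) unfolding smooth_fun_def by metis
  moreover obtain E where "E 0 = g" "\<And>n t. (E n has_vector_derivative E (Suc n) t) (at t)"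
    using assms(2) unfolding smooth_fun_def by metis
  ultimately show ?thesis unfolding smooth_fun_def
    by (intro exI[of _ "\<lambda>n t. D n t + E n t"]) (auto intro!: derivative_intros)
qed

lemma smooth_fun_affine:
  assumes "smooth_fun f"
  shows "smooth_fun (\<lambda>t. f (a * t + b))"
proof -
  obtain D where D: "D 0 = f" "\<And>n t. (D n has_vector_derivative D (Suc n) t) (at t)"
    using assms unfolding smooth_fun_def by metis
  have "((\<lambda>t. a ^ n *\<^sub>R D n (a * t + b)) has_vector_derivative a ^ Suc n *\<^sub>R D (Suc n) (a * t + b)) (at t)" for n t
  proof -
    have "((\<lambda>t. a * t + b) has_vector_derivative a) (at t)"
      by (auto intro!: derivative_eq_intros simp flip: has_real_derivative_iff_has_vector_derivative)
    from vector_diff_chain_at[OF this D(2)]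
    have "((\<lambda>t. D n (a * t + b)) has_vector_derivative a *\<^sub>R D (Suc n) (a * t + b)) (at t)"
      by (simp add: o_def)
    from bounded_linear.has_vector_derivative[OF bounded_linear_scaleR_right this, of "a ^ n"]
    show ?thesis by (simp add: mult.commute)
  qed
  then show ?thesis unfolding smooth_fun_def
    by (intro exI[of _ "\<lambda>n t. a ^ n *\<^sub>R D n (a * t + b)"]) (auto simp: D(1))
qed

lemma test_fun_linear:
  assumes "bounded_linear L" "test_fun f"
  shows "test_fun (\<lambda>t. L (f t))"
proof -
  obtain R where "\<And>t. \<bar>t\<bar> > R \<Longrightarrow> f t = 0" using assms(2) by (auto simp: test_fun_iff)
  then have "\<forall>t. \<bar>t\<bar> > R \<longrightarrow> L (f t) = 0" using linear_0[OF bounded_linear.linear[OF assms(1)]] by simp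
  then show ?thesis
    using assms by (auto simp: test_fun_iff intro: smooth_fun_linear)
qed

lemma test_fun_add: "test_fun f \<Longrightarrow> test_fun g \<Longrightarrow> test_fun (\<lambda>t. f t + g t)"
proof -
  assume f: "test_fun f" and g: "test_fun g"
  obtain R S where "\<And>t. \<bar>t\<bar> > R \<Longrightarrow> f t = 0" "\<And>t. \<bar>t\<bar> > S \<Longrightarrow> g t = 0"
    using f g by (auto simp: test_fun_iff)
  then have "\<forall>t. \<bar>t\<bar> > max R S \<longrightarrow> f t + g t = 0" by simp
  then show ?thesis using f g unfolding test_fun_iff by (intro conjI exI[of _ "max R S"] smooth_fun_add) auto
qed

lemma test_fun_zero: "test_fun (\<lambda>t. 0)"
  unfolding test_fun_iff smooth_fun_def by (auto intro!: exI[of _ "\<lambda>n t. 0"])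

section \<open>A bump function\<close>

text \<open>With q = t (1 - t), the standard bump exp (- 1 / q) on the unit interval has derivatives
  of the form p / q^k * exp (- 1 / q). The family of all such functions is stable under
  differentiation.\<close>

definition flat_fun :: "real poly \<Rightarrow> nat \<Rightarrow> real \<Rightarrow> real" where
  "flat_fun p k t = (if 0 < t \<and> t < 1 then poly p t / (t * (1 - t)) ^ k * exp (- 1 / (t * (1 - t))) else 0)"

text \<open>A single term of the exponential series bounds exp (1 / q) from below. With exponent k +
  2 the estimate beats a pole of order \<open>k\<close> and leaves q^2, enough to make the
  derivative vanish at the endpoints.\<close>

lemma power_times_exp_inverse_le:
  fixes q :: real
  assumes "q > 0"
  shows "exp (- 1 / q) \<le> fact n * q ^ n"
proof -
  have "(1 / q) ^ n / fact n \<le> exp (1 / q)"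
  proof -
    have "(\<lambda>i. (1 / q) ^ i / fact i) sums exp (1 / q)"
      using exp_converges[of "1 / q"] by (simp add: divide_inverse mult.commute)
    then have "(\<Sum>i\<in>{n}. (1 / q) ^ i / fact i) \<le> exp (1 / q)"
      using assms by (metis (no_types, lifting) sum_le_suminf finite.emptyI finite_insert sums_iff
          divide_nonneg_nonneg fact_ge_zero zero_le_divide_1_iff zero_le_power less_imp_le)
    then show ?thesis by simp
  qed
  then have "inverse (exp (1 / q)) \<le> inverse ((1 / q) ^ n / fact n)"
    using assms by (intro le_imp_inverse_le) auto
  then show ?thesis using assms by (simp add: exp_minus power_divide mult.commute)
qed

text \<open>Inside the interval, differentiating exp (- 1 / q) contributes q' / q^2, which raises
  the power in the denominator by two and explains the polynomial. Elsewhere, endpoints included,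
  the function is bounded by a multiple of (t - t0)^2, so the derivative is 0.\<close>

lemma flat_fun_has_derivative:
  defines "Q \<equiv> [:0, 1, - 1:] :: real poly"
  shows "(flat_fun p k has_real_derivative
     flat_fun (pderiv p * Q\<^sup>2 - of_nat k * p * pderiv Q * Q + p * pderiv Q) (k + 2) t0) (at t0)"
proof (cases "0 < t0 \<and> t0 < 1")
  case True
  have Q: "poly Q t = t * (1 - t)" for t by (simp add: Q_def algebra_simps)
  have Q0: "poly Q t0 > 0" using True by (simp add: Q)
  have "((\<lambda>t. poly p t / poly Q t ^ k * exp (- 1 / poly Q t)) has_real_derivative
      (poly (pderiv p) t0 * poly Q t0 ^ k - poly p t0 * (of_nat k * poly Q t0 ^ (k - 1) * poly (pderiv Q) t0))
        / (poly Q t0 ^ k * poly Q t0 ^ k) * exp (- 1 / poly Q t0)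
      + poly p t0 / poly Q t0 ^ k * (exp (- 1 / poly Q t0) * (poly (pderiv Q) t0 / (poly Q t0)\<^sup>2))) (at t0)"
    using Q0 by (auto intro!: derivative_eq_intros simp: power2_eq_square field_simps)
  also have "(poly (pderiv p) t0 * poly Q t0 ^ k - poly p t0 * (of_nat k * poly Q t0 ^ (k - 1) * poly (pderiv Q) t0))
        / (poly Q t0 ^ k * poly Q t0 ^ k) * exp (- 1 / poly Q t0)
      + poly p t0 / poly Q t0 ^ k * (exp (- 1 / poly Q t0) * (poly (pderiv Q) t0 / (poly Q t0)\<^sup>2))
    = poly (pderiv p * Q\<^sup>2 - of_nat k * p * pderiv Q * Q + p * pderiv Q) t0 / poly Q t0 ^ (k + 2) * exp (- 1 / poly Q t0)"
    using Q0 by (cases k) (auto simp: field_simps power2_eq_square)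
  finally have "((\<lambda>t. poly p t / (t * (1 - t)) ^ k * exp (- 1 / (t * (1 - t)))) has_real_derivative
      flat_fun (pderiv p * Q\<^sup>2 - of_nat k * p * pderiv Q * Q + p * pderiv Q) (k + 2) t0) (at t0)"
    using True by (simp add: flat_fun_def Q del: poly_add poly_diff poly_mult)
  then show ?thesis
    by (rule has_field_derivative_transform_within_open[where S = "{0<..<1}"])
      (use True in \<open>auto simp: flat_fun_def\<close>)
next
  case False
  have "compact (poly p ` {0..1})" by (intro compact_continuous_image continuous_intros) auto
  then have "bounded (poly p ` {0..1})" by (rule compact_imp_bounded)
  then obtain M where M: "M > 0" "\<forall>t\<in>{0..1}. \<bar>poly p t\<bar> \<le> M" unfolding bounded_pos by auto
  define C where "C = M * fact (k + 2)"
  have C: "C \<ge> 0" using M by (simp add: C_def)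
  have t0: "flat_fun p k t0 = 0" using False by (auto simp: flat_fun_def)
  have bound: "\<bar>flat_fun p k t\<bar> \<le> C * (t - t0)\<^sup>2" for t
  proof (cases "0 < t \<and> t < 1")
    case True
    let ?q = "t * (1 - t)"
    have q: "?q > 0" using True by simp
    \<comment> \<open>As \<open>t0\<close> lies outside the open interval, its distance from
      \<open>t\<close> is at least \<open>t\<close> or at least 1 - t, and \<open>?q\<close> is
      below both.\<close>
    have "?q \<le> t" "?q \<le> 1 - t" using True by (auto simp: mult_left_le mult_le_cancel_right2)
    then have qt: "?q \<le> \<bar>t - t0\<bar>" using False True by linarith
    have "\<bar>flat_fun p k t\<bar> = \<bar>poly p t\<bar> * (exp (- 1 / ?q) / ?q ^ k)"
      using True q by (simp add: flat_fun_def abs_mult)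
    also have "\<dots> \<le> M * (fact (k + 2) * ?q ^ (k + 2) / ?q ^ k)"
      using M True q power_times_exp_inverse_le[OF q, of "k + 2"]
      by (intro mult_mono divide_right_mono) auto
    also have "\<dots> = C * ?q\<^sup>2" using True by (simp add: C_def power_add power2_eq_square)
    also have "\<dots> \<le> C * \<bar>t - t0\<bar>\<^sup>2" using C q qt by (intro mult_left_mono power_mono) auto
    finally show ?thesis by simp
  next
    case False
    then have "flat_fun p k t = 0" by (auto simp: flat_fun_def)
    then show ?thesis using C by simp
  qed
  have "((\<lambda>t. (flat_fun p k t - flat_fun p k t0) / (t - t0)) \<longlongrightarrow> 0) (at t0)"
  proof (rule Lim_null_comparison)
    show "\<forall>\<^sub>F t in at t0. norm ((flat_fun p k t - flat_fun p k t0) / (t - t0)) \<le> C * \<bar>t - t0\<bar>"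
    proof (rule eventually_at_filter[THEN iffD2], rule always_eventually, intro allI impI)
      fix t assume "t \<noteq> t0"
      then have "\<bar>flat_fun p k t\<bar> / \<bar>t - t0\<bar> \<le> C * \<bar>t - t0\<bar>"
        using bound[of t] by (simp add: divide_le_eq power2_eq_square abs_mult_self_eq mult.assoc)
      then show "norm ((flat_fun p k t - flat_fun p k t0) / (t - t0)) \<le> C * \<bar>t - t0\<bar>" by (simp add: t0)
    qed
    have "((\<lambda>t. C * \<bar>t - t0\<bar>) \<longlongrightarrow> C * \<bar>t0 - t0\<bar>) (at t0)" by (intro tendsto_intros)
    then show "((\<lambda>t. C * \<bar>t - t0\<bar>) \<longlongrightarrow> 0) (at t0)" by simp
  qed
  moreover have "flat_fun (pderiv p * Q\<^sup>2 - of_nat k * p * pderiv Q * Q + p * pderiv Q) (k + 2) t0 = 0"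
    using False by (auto simp: flat_fun_def)
  ultimately show ?thesis by (simp add: has_field_derivative_iff)
qed

definition bump :: "real \<Rightarrow> real" where
  "bump = flat_fun 1 0"

lemma smooth_bump: "smooth_fun bump"
proof (rule smooth_fun_coinduct[of "{flat_fun p k |p k. True}"])
  show "bump \<in> {flat_fun p k |p k. True}" by (auto simp: bump_def)
next
  fix f :: "real \<Rightarrow> real" assume "f \<in> {flat_fun p k |p k. True}"
  then obtain p k where "f = flat_fun p k" by auto
  then show "\<exists>f'\<in>{flat_fun p k |p k. True}. \<forall>t. (f has_vector_derivative f' t) (at t)"
    using flat_fun_has_derivative[of p k] unfolding has_real_derivative_iff_has_vector_derivative by auto
qed

lemma bump_pos: "0 < t \<Longrightarrow> t < 1 \<Longrightarrow> 0 < bump t"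
  and bump_zero: "\<not> (0 < t \<and> t < 1) \<Longrightarrow> bump t = 0"
  by (auto simp: bump_def flat_fun_def)

section \<open>The scalar Fourier transform\<close>

text \<open>The positive and the negative part of \<open>k\<close> have the same transform, and by
  frequency 0 the same mass \<open>m\<close>. If \<open>m\<close> is 0 both vanish; otherwise,
  divided by \<open>m\<close>, they are densities of two probability distributions with equal
  characteristic functions.\<close>

lemma fourier_zero_imp_zero_real:
  fixes k :: "real \<Rightarrow> real"
  assumes k: "integrable lborel k"
    and zero: "\<And>a. (CLINT x|lborel. complex_of_real (k x) * iexp (a * x)) = 0"
  shows "AE x in lborel. k x = 0"
proof -
  define p where "p x = max (k x) 0" for x
  define q where "q x = max (- k x) 0" for x
  have kpq: "k x = p x - q x" for x by (auto simp: p_def q_def)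
  have pos: "0 \<le> p x" "0 \<le> q x" for x by (auto simp: p_def q_def)
  have [measurable]: "k \<in> borel_measurable borel" using k by auto
  have p: "integrable lborel p" and q: "integrable lborel q"
    unfolding p_def q_def using k by auto
  then have [measurable]: "p \<in> borel_measurable borel" "q \<in> borel_measurable borel" by auto
  have expint: "integrable lborel (\<lambda>x. complex_of_real (g x) * iexp (a * x))"
    if "integrable lborel g" for g :: "real \<Rightarrow> real" and a
  proof (rule Bochner_Integration.integrable_bound[OF that])
    show "(\<lambda>x. complex_of_real (g x) * iexp (a * x)) \<in> borel_measurable lborel"
      using that by measurable
  qed (simp add: norm_mult)
  have eq: "(CLINT x|lborel. complex_of_real (p x) * iexp (a * x))
      = (CLINT x|lborel. complex_of_real (q x) * iexp (a * x))" for a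
    using zero[of a] Bochner_Integration.integral_diff[OF expint[OF p] expint[OF q], of a a]
    by (simp add: kpq left_diff_distrib)
  define m where "m = (\<integral>x. p x \<partial>lborel)"
  have mq: "m = (\<integral>x. q x \<partial>lborel)"
    using eq[of 0] by (simp add: m_def)
  have "m \<ge> 0" unfolding m_def using pos by (intro integral_nonneg_AE) auto
  show ?thesis
  proof (cases "m = 0")
    case True
    then have "AE x in lborel. p x = 0" "AE x in lborel. q x = 0"
      using p q pos integral_nonneg_eq_0_iff_AE[of lborel p] integral_nonneg_eq_0_iff_AE[of lborel q]
      by (auto simp: mq[symmetric] m_def[symmetric])
    then show ?thesis by eventually_elim (simp add: kpq)
  next
    case False
    with \<open>m \<ge> 0\<close> have m: "m > 0" by simp
    let ?M = "\<lambda>g. density lborel (\<lambda>x. ennreal (g x / m))"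
    have rd: "real_distribution (?M g)"
      if [measurable]: "g \<in> borel_measurable borel" and "integrable lborel g" "\<And>x. 0 \<le> g x" "(\<integral>x. g x \<partial>lborel) = m" for g
    proof -
      have "(\<integral>\<^sup>+x. ennreal (g x / m) \<partial>lborel) = ennreal (\<integral>x. g x / m \<partial>lborel)"
        using that m by (intro nn_integral_eq_integral) auto
      also have "\<dots> = 1" using that m by simp
      finally have "emeasure (?M g) (space (?M g)) = 1"
        by (simp add: emeasure_density)
      then have "prob_space (?M g)" by (rule prob_spaceI)
      then show ?thesis
        by (simp add: real_distribution_def real_distribution_axioms_def)
    qed
    have ch: "char (?M g) a = (CLINT x|lborel. complex_of_real (g x) * iexp (a * x)) / m"
      if [measurable]: "g \<in> borel_measurable borel" and "\<And>x. 0 \<le> g x" for g a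
    proof -
      have "char (?M g) a = (CLINT x|lborel. (g x / m) *\<^sub>R iexp (a * x))"
        unfolding char_def using m that by (subst integral_density) auto
      also have "\<dots> = (CLINT x|lborel. (complex_of_real (g x) * iexp (a * x)) / m)"
        by (intro Bochner_Integration.integral_cong refl) (simp add: scaleR_conv_of_real)
      finally show ?thesis by simp
    qed
    have "char (?M p) = char (?M q)"
      by (rule ext) (simp only: ch[of p, OF _ pos(1)] ch[of q, OF _ pos(2)] eq measurable_lborel1 \<open>p \<in> borel_measurable borel\<close> \<open>q \<in> borel_measurable borel\<close>)
    then have "?M p = ?M q"
      using Levy_uniqueness[OF rd rd] p q pos m_def mq by simp
    then have "AE x in lborel. ennreal (p x / m) = ennreal (q x / m)"
      by (subst (asm) sigma_finite_measure.density_unique_iff[OF sigma_finite_lborel]) auto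
    then show ?thesis
      by eventually_elim (use m pos in \<open>auto simp: kpq divide_simps\<close>)
  qed
qed

lemma integrable_mult_iexp:
  fixes k :: "real \<Rightarrow> complex"
  assumes "integrable M k" "(\<lambda>x. x) \<in> borel_measurable M"
  shows "integrable M (\<lambda>x. k x * iexp (a * x))"
proof (rule Bochner_Integration.integrable_bound[OF assms(1)])
  note [measurable] = assms(2) borel_measurable_integrable[OF assms(1)]
  show "(\<lambda>x. k x * iexp (a * x)) \<in> borel_measurable M" by measurable
qed (simp add: norm_mult)

text \<open>Let X and Y be the transforms of the real and the imaginary part. Conjugation sends each
  transform to the opposite frequency, so besides X + i Y also X - i Y vanishes. The passage to the
  Borel functions \<open>k1\<close> and \<open>k2\<close> prepares for densities over
  \<open>lborel\<close>.\<close>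

lemma fourier_zero_imp_zero:
  fixes k :: "real \<Rightarrow> complex"
  assumes k: "integrable lebesgue k"
    and zero: "\<And>a. (CLINT x|lebesgue. k x * iexp (a * x)) = 0"
  shows "AE x in lebesgue. k x = 0"
proof -
  have Re: "(\<lambda>x. Re (k x)) \<in> borel_measurable lebesgue" and Im: "(\<lambda>x. Im (k x)) \<in> borel_measurable lebesgue"
    using k by auto
  obtain k1 where [measurable]: "k1 \<in> borel_measurable lborel" and k1: "AE x in lborel. Re (k x) = k1 x"
    using completion_ex_borel_measurable_real[OF Re] by blast
  obtain k2 where [measurable]: "k2 \<in> borel_measurable lborel" and k2: "AE x in lborel. Im (k x) = k2 x"
    using completion_ex_borel_measurable_real[OF Im] by blast
  define k' where "k' x = complex_of_real (k1 x) + \<i> * complex_of_real (k2 x)" for x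
  have kk': "AE x in lebesgue. k x = k' x"
    using k1[THEN AE_completion] k2[THEN AE_completion]
    by eventually_elim (simp add: k'_def complex_eq_iff)
  have [measurable]: "k' \<in> borel_measurable lborel" unfolding k'_def by measurable
  have k'm: "k' \<in> borel_measurable lebesgue" by (intro measurable_completion) simp
  have "integrable lebesgue k'"
    using k kk' k'm integrable_cong_AE[OF borel_measurable_integrable[OF k] k'm] by simp
  then have k': "integrable lborel k'" by (subst (asm) integrable_completion) auto
  then have i1: "integrable lborel k1" and i2: "integrable lborel k2"
    using integrable_Re[OF k'] integrable_Im[OF k'] by (simp_all add: k'_def)
  have idm: "(\<lambda>x::real. x) \<in> borel_measurable lebesgue" by (intro measurable_completion) simp
  define X where "X a = (CLINT x|lborel. complex_of_real (k1 x) * iexp (a * x))" for a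
  define Y where "Y a = (CLINT x|lborel. complex_of_real (k2 x) * iexp (a * x))" for a
  have XY: "X a + \<i> * Y a = 0" for a
  proof -
    have m: "(\<lambda>x. k' x * iexp (a * x)) \<in> borel_measurable lborel" by measurable
    have "0 = (CLINT x|lebesgue. k x * iexp (a * x))" using zero by simp
    also have "\<dots> = (CLINT x|lebesgue. k' x * iexp (a * x))"
    proof (rule integral_cong_AE)
      show "(\<lambda>x. k x * iexp (a * x)) \<in> borel_measurable lebesgue"
        using integrable_mult_iexp[OF k idm] by auto
      show "(\<lambda>x. k' x * iexp (a * x)) \<in> borel_measurable lebesgue"
        using m by (rule measurable_completion)
      show "AE x in lebesgue. k x * iexp (a * x) = k' x * iexp (a * x)"
        using kk' by eventually_elim simp
    qed
    also have "\<dots> = (CLINT x|lborel. k' x * iexp (a * x))"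
      using m by (rule integral_completion)
    also have "\<dots> = (CLINT x|lborel. complex_of_real (k1 x) * iexp (a * x)
          + \<i> * (complex_of_real (k2 x) * iexp (a * x)))"
      by (simp add: k'_def algebra_simps)
    also have "\<dots> = X a + \<i> * Y a"
      unfolding X_def Y_def
      using integrable_mult_iexp[of lborel "\<lambda>x. complex_of_real (k1 x)" a]
        integrable_mult_iexp[of lborel "\<lambda>x. complex_of_real (k2 x)" a] i1 i2
      by (subst Bochner_Integration.integral_add) auto
    finally show ?thesis by simp
  qed
  have cnj: "cnj (CLINT x|lborel. complex_of_real (g x) * iexp (a * x))
      = (CLINT x|lborel. complex_of_real (g x) * iexp (- a * x))" for g a
    using Bochner_Integration.integral_cnj[of lborel "\<lambda>x. complex_of_real (g x) * iexp (a * x)"] by (simp add: exp_cnj)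
  have "cnj (X a) = X (- a)" "cnj (Y a) = Y (- a)" for a
    unfolding X_def Y_def by (rule cnj)+
  then have "X a - \<i> * Y a = 0" for a
    using arg_cong[OF XY[of "- a"], of cnj] by simp
  then have "2 * X a = 0" "2 * \<i> * Y a = 0" for a
    using XY[of a] by (simp_all add: algebra_simps eq_neg_iff_add_eq_0)
  then have "AE x in lborel. k1 x = 0" "AE x in lborel. k2 x = 0"
    using fourier_zero_imp_zero_real[OF i1] fourier_zero_imp_zero_real[OF i2]
    unfolding X_def Y_def by auto
  from this[THEN AE_completion] kk' show ?thesis
    by eventually_elim (simp add: k'_def)
qed

lemma integrable_continuous_compact_support:
  fixes f :: "real \<Rightarrow> 'a::{banach, second_countable_topology}"
  assumes "continuous_on UNIV f" "\<And>t. \<bar>t\<bar> > R \<Longrightarrow> f t = 0"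
  shows "integrable lborel f"
proof -
  have "set_integrable lborel {- R..R} f"
    using assms(1) by (intro borel_integrable_atLeastAtMost') (rule continuous_on_subset, auto)
  moreover have "indicator {- R..R} t *\<^sub>R f t = f t" for t
    using assms(2)[of t] by (auto simp: indicator_def abs_if split: if_splits)
  ultimately show ?thesis by (simp add: set_integrable_def)
qed

lemma gaussian_fourier:
  assumes "e > 0"
  shows "integrable lborel (\<lambda>x::real. exp (- (e * x)\<^sup>2 / 2))"
    and "(CLINT x|lborel. iexp (- x * s) * complex_of_real (exp (- (e * x)\<^sup>2 / 2)))
      = complex_of_real (sqrt (2 * pi) / e * exp (- (s / e)\<^sup>2 / 2))"
proof -
  have snd: "exp (- x\<^sup>2 / 2) = sqrt (2 * pi) * std_normal_density x" for x
    by (simp add: std_normal_density_def)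
  have "integrable lborel (\<lambda>x. exp (- x\<^sup>2 / 2) :: real)"
    unfolding snd by simp
  from lborel_integrable_real_affine[OF this, of e 0] assms
  show "integrable lborel (\<lambda>x::real. exp (- (e * x)\<^sup>2 / 2))" by simp
  have "(CLINT x|lborel. iexp (- x * s) * complex_of_real (exp (- (e * x)\<^sup>2 / 2)))
      = (1 / e) *\<^sub>R (CLINT y|lborel. iexp ((- s / e) * y) * complex_of_real (exp (- y\<^sup>2 / 2)))"
    using assms by (subst lborel_integral_real_affine[of "1 / e" _ 0]) (auto simp: mult.commute)
  also have "(CLINT y|lborel. iexp ((- s / e) * y) * complex_of_real (exp (- y\<^sup>2 / 2)))
     = (CLINT y|lborel. complex_of_real (sqrt (2 * pi)) * (std_normal_density y *\<^sub>R iexp ((- s / e) * y)))"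
    unfolding snd by (intro Bochner_Integration.integral_cong refl) (simp add: scaleR_conv_of_real)
  also have "\<dots> = complex_of_real (sqrt (2 * pi)) * char std_normal_distribution (- s / e)"
    unfolding char_def integral_mult_right_zero by (subst integral_density) auto
  finally show "(CLINT x|lborel. iexp (- x * s) * complex_of_real (exp (- (e * x)\<^sup>2 / 2)))
      = complex_of_real (sqrt (2 * pi) / e * exp (- (s / e)\<^sup>2 / 2))"
    by (simp add: char_std_normal_distribution scaleR_conv_of_real power_divide)
qed

text \<open>Summation by Gaussian means: the transform of a Gaussian is an approximate identity.\<close>

lemma fourier_inversion_at_0:
  fixes f :: "real \<Rightarrow> complex"
  assumes cont: "continuous_on UNIV f" and supp: "\<And>t. \<bar>t\<bar> > R \<Longrightarrow> f t = 0"
  defines "K \<equiv> \<lambda>\<xi>. CLINT s|lborel. f s * iexp (- \<xi> * s)"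
  assumes K: "integrable lborel K"
  shows "(CLINT \<xi>|lborel. K \<xi>) = 2 * pi * f 0"
proof -
  have f: "integrable lborel f" using cont supp by (rule integrable_continuous_compact_support)
  have [measurable]: "f \<in> borel_measurable borel" "K \<in> borel_measurable borel"
    using f K by auto
  define e where "e n = inverse (real (Suc n))" for n
  have e: "e n > 0" for n by (simp add: e_def)
  have e0: "e \<longlonglongrightarrow> 0" unfolding e_def by (rule LIMSEQ_inverse_real_of_nat)
  let ?G = "\<lambda>n \<xi>. complex_of_real (exp (- (e n * \<xi>)\<^sup>2 / 2))"
  have "(\<lambda>n. CLINT \<xi>|lborel. K \<xi> * ?G n \<xi>) \<longlonglongrightarrow> (CLINT \<xi>|lborel. K \<xi>)"
  proof (rule integral_dominated_convergence[where w = "\<lambda>\<xi>. norm (K \<xi>)"])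
    show "integrable lborel (\<lambda>\<xi>. norm (K \<xi>))" using K by simp
    have "(\<lambda>n. K \<xi> * ?G n \<xi>) \<longlonglongrightarrow> K \<xi> * complex_of_real (exp (- (0 * \<xi>)\<^sup>2 / 2))" for \<xi>
      by (intro tendsto_intros e0) auto
    then show "AE \<xi> in lborel. (\<lambda>n. K \<xi> * ?G n \<xi>) \<longlonglongrightarrow> K \<xi>" by simp
    show "AE \<xi> in lborel. norm (K \<xi> * ?G n \<xi>) \<le> norm (K \<xi>)" for n
      by (simp add: norm_mult mult_left_le)
  qed auto
  moreover have "(CLINT \<xi>|lborel. K \<xi> * ?G n \<xi>)
      = 2 * pi * (CLINT y|lborel. std_normal_density y *\<^sub>R f (e n * y))" for n
  proof -
    note G = gaussian_fourier[OF e[of n]]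
    have "(CLINT \<xi>|lborel. K \<xi> * ?G n \<xi>)
        = (CLINT \<xi>|lborel. CLINT s|lborel. f s * iexp (- \<xi> * s) * ?G n \<xi>)"
      unfolding K_def by simp
    \<comment> \<open>The Gaussian factor makes the integrand absolutely integrable in both
      variables; without it the modulus would not depend on \<xi> and Fubini's theorem could not be
      applied.\<close>
    also have "\<dots> = (CLINT s|lborel. CLINT \<xi>|lborel. f s * iexp (- \<xi> * s) * ?G n \<xi>)"
    proof (rule lborel_pair.Fubini_integral)
      have i: "integrable lborel (\<lambda>s. f s * iexp (- \<xi> * s))" for \<xi>
        using integrable_mult_iexp[OF f, of "- \<xi>"] by simp
      show "integrable (lborel \<Otimes>\<^sub>M lborel) (\<lambda>(s, \<xi>). f s * iexp (- \<xi> * s) * ?G n \<xi>)"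
      proof (rule lborel_pair.Fubini_integrable)
        show "(\<lambda>(s, \<xi>). f s * iexp (- \<xi> * s) * ?G n \<xi>) \<in> borel_measurable (lborel \<Otimes>\<^sub>M lborel)"
          by measurable
        show "integrable lborel (\<lambda>s. \<integral>\<xi>. norm (case (s, \<xi>) of (s, \<xi>) \<Rightarrow> f s * iexp (- \<xi> * s) * ?G n \<xi>) \<partial>lborel)"
          using f by (simp add: norm_mult)
        show "AE s in lborel. integrable lborel (\<lambda>\<xi>. case (s, \<xi>) of (s, \<xi>) \<Rightarrow> f s * iexp (- \<xi> * s) * ?G n \<xi>)"
        proof (rule AE_I2, simp only: prod.case)
          fix s
          have "integrable lborel (\<lambda>\<xi>. (?G n \<xi> * iexp (- s * \<xi>)))"
            using G(1) by (intro integrable_mult_iexp) auto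
          then have "integrable lborel (\<lambda>\<xi>. f s * (?G n \<xi> * iexp (- s * \<xi>)))" by simp
          then show "integrable lborel (\<lambda>\<xi>. f s * iexp (- \<xi> * s) * ?G n \<xi>)"
            by (simp add: ac_simps)
        qed
      qed
    qed
    also have "\<dots> = (CLINT s|lborel. f s * complex_of_real (sqrt (2 * pi) / e n * exp (- (s / e n)\<^sup>2 / 2)))"
      unfolding mult.assoc using G(2) by (simp add: mult.assoc)
    \<comment> \<open>The substitution s = e n * y cancels the factor 1 / e n, and sqrt (2 pi) times
      the remaining Gaussian is 2 pi times the normal density.\<close>
    also have "\<dots> = \<bar>e n\<bar> *\<^sub>R (CLINT y|lborel. f (e n * y)
        * complex_of_real (sqrt (2 * pi) / e n * exp (- y\<^sup>2 / 2)))"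
      using e[of n] by (subst lborel_integral_real_affine[of "e n" _ 0]) auto
    also have "\<dots> = (CLINT y|lborel. \<bar>e n\<bar> *\<^sub>R (f (e n * y)
        * complex_of_real (sqrt (2 * pi) / e n * exp (- y\<^sup>2 / 2))))"
      by (rule integral_scaleR_right[symmetric])
    also have "\<dots> = (CLINT y|lborel. 2 * pi * (std_normal_density y *\<^sub>R f (e n * y)))"
    proof (rule Bochner_Integration.integral_cong[OF refl])
      fix y
      have "\<bar>e n\<bar> * (sqrt (2 * pi) / e n * exp (- y\<^sup>2 / 2)) = sqrt (2 * pi) * exp (- y\<^sup>2 / 2)"
        using e[of n] by simp
      also have "\<dots> = 2 * pi / sqrt (2 * pi) * exp (- y\<^sup>2 / 2)"
        by (subst real_div_sqrt) auto
      also have "\<dots> = 2 * pi * std_normal_density y" by (simp add: std_normal_density_def)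
      finally have *: "\<bar>e n\<bar> * (sqrt (2 * pi) / e n * exp (- y\<^sup>2 / 2)) = 2 * pi * std_normal_density y" .
      have "a *\<^sub>R (z * complex_of_real b) = complex_of_real (a * b) * z" for a b z
        by (simp add: scaleR_conv_of_real)
      then have "\<bar>e n\<bar> *\<^sub>R (f (e n * y) * complex_of_real (sqrt (2 * pi) / e n * exp (- y\<^sup>2 / 2)))
          = complex_of_real (2 * pi * std_normal_density y) * f (e n * y)"
        by (simp only: *)
      then show "\<bar>e n\<bar> *\<^sub>R (f (e n * y) * complex_of_real (sqrt (2 * pi) / e n * exp (- y\<^sup>2 / 2)))
          = 2 * pi * (std_normal_density y *\<^sub>R f (e n * y))"
        by (simp only: scaleR_conv_of_real of_real_mult mult.assoc of_real_numeral)
    qed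
    also have "\<dots> = 2 * pi * (CLINT y|lborel. std_normal_density y *\<^sub>R f (e n * y))"
      by (rule integral_mult_right_zero)
    finally show ?thesis .
  qed
  moreover have "(\<lambda>n. CLINT y|lborel. std_normal_density y *\<^sub>R f (e n * y))
      \<longlonglongrightarrow> (CLINT y|lborel. std_normal_density y *\<^sub>R f 0)"
  proof -
    have "compact (f ` {- R..R})"
      using cont by (intro compact_continuous_image) (auto intro: continuous_on_subset)
    then have "bounded (f ` {- R..R})" by (rule compact_imp_bounded)
    then obtain B where B: "\<forall>t\<in>{- R..R}. norm (f t) \<le> B" "B > 0"
      unfolding bounded_pos by blast
    have B': "norm (f t) \<le> B" for t
      using B supp[of t] by (cases "t \<in> {- R..R}") auto
    show ?thesis
    proof (rule integral_dominated_convergence[where w = "\<lambda>y. std_normal_density y * B"])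
      show "integrable lborel (\<lambda>y. std_normal_density y * B)" by simp
      have "(\<lambda>n. std_normal_density y *\<^sub>R f (e n * y)) \<longlonglongrightarrow> std_normal_density y *\<^sub>R f (0 * y)" for y
        using cont by (intro tendsto_intros e0 isCont_tendsto_compose[of _ f])
          (auto simp: continuous_on_eq_continuous_at)
      then show "AE y in lborel. (\<lambda>n. std_normal_density y *\<^sub>R f (e n * y)) \<longlonglongrightarrow> std_normal_density y *\<^sub>R f 0"
        by simp
      show "AE y in lborel. norm (std_normal_density y *\<^sub>R f (e n * y)) \<le> std_normal_density y * B" for n
        using B' by (auto intro!: mult_left_mono)
    qed auto
  qed
  ultimately have "(\<lambda>n. 2 * pi * (CLINT y|lborel. std_normal_density y *\<^sub>R f (e n * y)))
      \<longlonglongrightarrow> (CLINT \<xi>|lborel. K \<xi>)"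
    and "(\<lambda>n. 2 * pi * (CLINT y|lborel. std_normal_density y *\<^sub>R f (e n * y)))
      \<longlonglongrightarrow> 2 * pi * (CLINT y|lborel. std_normal_density y *\<^sub>R f 0)"
    by (simp_all only: tendsto_mult tendsto_const)
  from LIMSEQ_unique[OF this] show ?thesis by simp
qed

lemma integrable_inverse_one_plus_square: "integrable lborel (\<lambda>x::real. 1 / (1 + x\<^sup>2))"
  using integrable_inverse_1_plus_square by (simp add: set_integrable_def inverse_eq_divide)

section \<open>Integrals of continuous functions with values in the Hilbert space\<close>

text \<open>The functional is evaluated at \<open>x\<close> itself. Being bounded below, the
  embedding into the dual has complete range, and smallness in the dual is reflected back to
  H.\<close>

lemma norm_le_blinfun_inner_right: "norm x \<le> norm (blinfun_inner_right x)"
proof (cases "x = 0")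
  case False
  have "norm x * norm x \<le> norm (blinfun_inner_right x) * norm x"
    using norm_blinfun[of "blinfun_inner_right x" x] by (simp add: dot_square_norm power2_eq_square)
  then show ?thesis using False by simp
qed simp

text \<open>The sort of \<open>'h\<close> does not include \<open>banach\<close>, so existence of the integral is transported along
  the isometric embedding of \<open>'h\<close> into its dual.\<close>

lemma integrable_on_interval_complete:
  fixes f :: "real \<Rightarrow> 'h::{real_inner, complete_space}"
  assumes "continuous_on {a..b} f"
  shows "f integrable_on {a..b}"
proof -
  let ?i = "blinfun_inner_right :: 'h \<Rightarrow> _"
  have bl: "bounded_linear ?i" by (rule bounded_linear_blinfun_inner_right)
  have "continuous_on {a..b} (\<lambda>t. ?i (f t))"
    by (rule bounded_linear.continuous_on[OF bl assms])
  then obtain Y where Y: "((\<lambda>t. ?i (f t)) has_integral Y) {a..b}"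
    using integrable_continuous_real by blast
  have approx: "\<exists>\<gamma>. gauge \<gamma> \<and> (\<forall>\<D>. \<D> tagged_division_of {a..b} \<and> \<gamma> fine \<D> \<longrightarrow>
      norm (?i (\<Sum>(x, k)\<in>\<D>. measure lborel k *\<^sub>R f x) - Y) < e)" if "e > 0" for e
  proof -
    have "?i (\<Sum>(x, k)\<in>\<D>. measure lborel k *\<^sub>R f x) = (\<Sum>(x, k)\<in>\<D>. measure lborel k *\<^sub>R ?i (f x))" for \<D> :: "(real \<times> real set) set"
      using bounded_linear.linear[OF bl]
      by (simp add: linear_sum linear_scale case_prod_unfold)
    then show ?thesis using Y that unfolding has_integral_real by simp
  qed
  \<comment> \<open>The integral \<open>Y\<close> in the dual is a limit of Riemann sums, all of
    which are images of Riemann sums of \<open>f\<close>. Closedness of the range thus provides a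
    vector that \<open>Y\<close> comes from.\<close>
  have "closed (range ?i)"
    by (rule complete_imp_closed, rule complete_isometric_image[where e = 1])
      (auto simp: bl norm_le_blinfun_inner_right complete_UNIV)
  moreover have "Y \<in> closure (range ?i)"
    unfolding closure_approachable
  proof (intro allI impI)
    fix e :: real assume "e > 0"
    then obtain \<gamma> where \<gamma>: "gauge \<gamma>" "\<And>\<D>. \<D> tagged_division_of {a..b} \<Longrightarrow> \<gamma> fine \<D> \<Longrightarrow>
      norm (?i (\<Sum>(x, k)\<in>\<D>. measure lborel k *\<^sub>R f x) - Y) < e" using approx by metis
    obtain \<D> where "\<D> tagged_division_of {a..b}" "\<gamma> fine \<D>"
      using fine_division_exists_real[OF \<gamma>(1)] by blast
    from \<gamma>(2)[OF this] show "\<exists>y\<in>range ?i. dist y Y < e" by (auto simp: dist_norm)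
  qed
  ultimately obtain x where x: "Y = ?i x" by auto
  have "(f has_integral x) {a..b}"
    unfolding has_integral_real
  proof (intro allI impI)
    fix e :: real assume "e > 0"
    have "norm (z - x) \<le> norm (?i z - Y)" for z
      using norm_le_blinfun_inner_right[of "z - x"] x linear_diff[OF bounded_linear.linear[OF bl], of z x] by simp
    then show "\<exists>\<gamma>. gauge \<gamma> \<and> (\<forall>\<D>. \<D> tagged_division_of {a..b} \<and> \<gamma> fine \<D> \<longrightarrow>
        norm ((\<Sum>(x, k)\<in>\<D>. measure lborel k *\<^sub>R f x) - x) < e)"
      using approx[OF \<open>e > 0\<close>] by (meson le_less_trans)
  qed
  then show ?thesis by blast
qed

text \<open>The same transport for the whole line: compact support gives the integral in the dual,
  and comparing it with the integrals over large intervals brings it back to H.\<close>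

lemma integrable_on_UNIV_complete:
  fixes f :: "real \<Rightarrow> 'h::{real_inner, complete_space}"
  assumes cont: "continuous_on UNIV f" and supp: "\<And>t. \<bar>t\<bar> > R \<Longrightarrow> f t = 0"
  shows "f integrable_on UNIV"
proof -
  let ?i = "blinfun_inner_right :: 'h \<Rightarrow> _"
  have bl: "bounded_linear ?i" by (rule bounded_linear_blinfun_inner_right)
  have int: "f integrable_on {a..b}" for a b
    using cont by (intro integrable_on_interval_complete) (rule continuous_on_subset, auto)
  define x where "x = integral {- R..R} f"
  have i_int: "((\<lambda>t. ?i (f t)) has_integral ?i (integral {a..b} f)) {a..b}" for a b
    using has_integral_linear[OF integrable_integral[OF int] bl] by (simp add: o_def)
  have ix: "((\<lambda>t. ?i (f t)) has_integral ?i x) UNIV"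
    unfolding x_def by (rule has_integral_on_superset[OF i_int])
      (use supp linear_0[OF bounded_linear.linear[OF bl]] in \<open>auto simp: abs_if split: if_splits\<close>)
  have not_box: "\<not> (\<exists>a b::real. UNIV = cbox a b)" by simp
  have alt: "\<exists>B>0. \<forall>a b. ball 0 B \<subseteq> cbox a b \<longrightarrow>
      (\<exists>z. ((\<lambda>t. ?i (f t)) has_integral z) (cbox a b) \<and> norm (z - ?i x) < e)" if "e > 0" for e
    by (rule has_integral_altD[OF ix not_box that]) (simp, blast)
  have "(f has_integral x) UNIV"
  proof (rule iffD2[OF has_integral_alt], subst if_not_P[OF not_box], intro allI impI)
    fix e :: real assume "e > 0"
    then obtain B where B: "B > 0" "\<And>a b. ball 0 B \<subseteq> cbox a b \<Longrightarrow>
      \<exists>z. ((\<lambda>t. ?i (f t)) has_integral z) (cbox a b) \<and> norm (z - ?i x) < e" using alt by metis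
    show "\<exists>B>0. \<forall>a b. ball 0 B \<subseteq> cbox a b \<longrightarrow>
      (\<exists>z. ((\<lambda>t. if t \<in> UNIV then f t else 0) has_integral z) (cbox a b) \<and> norm (z - x) < e)"
    proof (intro exI[of _ B] conjI allI impI B(1))
      fix a b :: real assume "ball 0 B \<subseteq> cbox a b"
      then obtain z where z: "((\<lambda>t. ?i (f t)) has_integral z) {a..b}" "norm (z - ?i x) < e"
        using B(2) by (metis box_real(2))
      have "z = ?i (integral {a..b} f)" using has_integral_unique[OF z(1) i_int] .
      then have "norm (integral {a..b} f - x) < e"
        using z(2) norm_le_blinfun_inner_right[of "integral {a..b} f - x"]
          linear_diff[OF bounded_linear.linear[OF bl], of "integral {a..b} f" x] by simp
      moreover have "((\<lambda>t. if t \<in> UNIV then f t else 0) has_integral integral {a..b} f) (cbox a b)"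
        using integrable_integral[OF int] by simp
      ultimately show "\<exists>z. ((\<lambda>t. if t \<in> UNIV then f t else 0) has_integral z) (cbox a b) \<and> norm (z - x) < e"
        by blast
    qed
  qed
  then show ?thesis by blast
qed

section \<open>Complex Hilbert spaces\<close>

locale complex_hilbert =
  fixes J :: "'h::{real_inner, complete_space} \<Rightarrow> 'h"
  assumes complex_structure: "complex_structure J"
begin

lemma linear_J: "linear J" and J_J [simp]: "J (J x) = - x" and inner_J_J [simp]: "inner (J x) (J y) = inner x y"
  using complex_structure by (auto simp: complex_structure_def)

lemma J_simps [simp]:
  "J (x + y) = J x + J y" "J (x - y) = J x - J y" "J (c *\<^sub>R x) = c *\<^sub>R J x" "J 0 = 0" "J (- x) = - J x"
  using linear_add[OF linear_J] linear_diff[OF linear_J] linear_scale[OF linear_J] linear_0[OF linear_J]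
    linear_neg[OF linear_J] by auto

lemma inner_J_left: "inner (J x) y = - inner x (J y)"
  using inner_J_J[of x "J y"] by simp

lemma inner_J_self [simp]: "inner x (J x) = 0"
  using inner_J_left[of x x] by (simp add: inner_commute)

lemma norm_J [simp]: "norm (J x) = norm x"
  by (simp add: norm_eq_sqrt_inner)

lemma bounded_linear_J: "bounded_linear J"
  by (rule bounded_linear_intro[where K = 1]) auto

lemma scaleJ_simps [simp]:
  "scaleJ J c (x + y) = scaleJ J c x + scaleJ J c y"
  "scaleJ J c (x - y) = scaleJ J c x - scaleJ J c y"
  "scaleJ J c (r *\<^sub>R x) = r *\<^sub>R scaleJ J c x"
  "scaleJ J c 0 = 0" "scaleJ J 0 x = 0" "scaleJ J 1 x = x"
  "scaleJ J a (scaleJ J b x) = scaleJ J (a * b) x"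
  "scaleJ J c (J x) = J (scaleJ J c x)"
  by (simp_all add: scaleJ_def algebra_simps)

lemma norm_scaleJ [simp]: "norm (scaleJ J c x) = norm c * norm x"
proof -
  have "inner (scaleJ J c x) (scaleJ J c x) = ((Re c)\<^sup>2 + (Im c)\<^sup>2) * inner x x"
    by (simp add: scaleJ_def inner_add inner_J_left power2_eq_square algebra_simps)
  then have "(norm (scaleJ J c x))\<^sup>2 = (norm c * norm x)\<^sup>2"
    by (simp only: power2_norm_eq_inner[symmetric] cmod_power2[symmetric] power_mult_distrib)
  then show ?thesis by (simp add: power2_eq_iff_nonneg)
qed

lemma bounded_linear_scaleJ: "bounded_linear (scaleJ J c)"
  by (rule bounded_linear_intro[where K = "norm c"]) auto

lemma cinner_simps [simp]:
  "cinner J (x + y) z = cinner J x z + cinner J y z"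
  "cinner J (x - y) z = cinner J x z - cinner J y z"
  "cinner J x (y + z) = cinner J x y + cinner J x z"
  "cinner J x (y - z) = cinner J x y - cinner J x z"
  "cinner J (r *\<^sub>R x) y = r * cinner J x y"
  "cinner J x (r *\<^sub>R y) = r * cinner J x y"
  "cinner J 0 y = 0" "cinner J x 0 = 0"
  "cinner J (scaleJ J c x) y = c * cinner J x y"
  "cinner J x (scaleJ J c y) = cnj c * cinner J x y"
  by (auto simp: cinner_def complex_eq_iff inner_add inner_diff scaleJ_def inner_J_left algebra_simps)

lemma Re_cinner [simp]: "Re (cinner J x y) = inner x y"
  by (simp add: cinner_def)

lemma cinner_commute: "cinner J y x = cnj (cinner J x y)"
  by (simp add: cinner_def complex_eq_iff inner_commute[of y] inner_J_left)

text \<open>The constant 2 results from bounding the real and the imaginary part separately. It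
  enters only boundedness and integrability estimates, never an identity.\<close>

lemma norm_cinner_le: "norm (cinner J x y) \<le> 2 * (norm x * norm y)"
proof -
  have "norm (cinner J x y) \<le> \<bar>inner x y\<bar> + \<bar>inner x (J y)\<bar>"
    using cmod_le[of "cinner J x y"] by (simp add: cinner_def)
  also have "\<dots> \<le> norm x * norm y + norm x * norm (J y)"
    by (intro add_mono Cauchy_Schwarz_ineq2)
  finally show ?thesis by simp
qed

lemma bounded_linear_cinner_left: "bounded_linear (\<lambda>x. cinner J x y)"
  by (rule bounded_linear_intro[where K = "2 * norm y"])
    (use norm_cinner_le[of _ y] in \<open>auto simp: scaleR_conv_of_real ac_simps\<close>)

text \<open>The device for proving identities between values of the H-valued transform: paired with
  a vector they become identities of scalar integrals.\<close>

lemma cinner_eqI: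
  assumes "\<And>x. cinner J a x = cinner J b x"
  shows "a = b"
proof -
  have "inner (a - b) (a - b) = Re (cinner J a (a - b)) - Re (cinner J b (a - b))"
    by (simp only: Re_cinner inner_diff_left[of a b "a - b"])
  then show ?thesis by (simp only: assms) simp
qed

lemma tendsto_scaleJ:
  assumes "(f \<longlongrightarrow> a) F" "(g \<longlongrightarrow> b) F"
  shows "((\<lambda>t. scaleJ J (f t) (g t)) \<longlongrightarrow> scaleJ J a b) F"
  unfolding scaleJ_def by (intro tendsto_intros assms bounded_linear.tendsto[OF bounded_linear_J])

lemma tendsto_cinner:
  assumes "(f \<longlongrightarrow> a) F" "(g \<longlongrightarrow> b) F"
  shows "((\<lambda>t. cinner J (f t) (g t)) \<longlongrightarrow> cinner J a b) F"
  unfolding cinner_def by (intro tendsto_Complex tendsto_inner assms bounded_linear.tendsto[OF bounded_linear_J])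

lemma continuous_on_scaleJ:
  "continuous_on S f \<Longrightarrow> continuous_on S g \<Longrightarrow> continuous_on S (\<lambda>t. scaleJ J (f t) (g t))"
  unfolding continuous_on_def by (blast intro: tendsto_scaleJ)

lemma continuous_on_cinner:
  "continuous_on S f \<Longrightarrow> continuous_on S g \<Longrightarrow> continuous_on S (\<lambda>t. cinner J (f t) (g t))"
  unfolding continuous_on_def by (blast intro: tendsto_cinner)

section \<open>The Fourier--Laplace transform of test functions\<close>

lemma exp_Complex: "exp (- (Complex \<sigma> \<xi> * complex_of_real t)) = complex_of_real (exp (- \<sigma> * t)) * cis (- \<xi> * t)"
proof -
  have "- (Complex \<sigma> \<xi> * complex_of_real t) = complex_of_real (- \<sigma> * t) + \<i> * complex_of_real (- \<xi> * t)"
    by (simp add: complex_eq_iff)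
  then show ?thesis by (simp only: exp_add cis_conv_exp exp_of_real)
qed

lemma norm_exp_Complex: "norm (exp (- (Complex \<sigma> \<xi> * complex_of_real t))) = exp (- \<sigma> * t)"
  by (simp add: exp_Complex norm_mult)

lemma test_fun_integrand_integrable:
  assumes "test_fun \<phi>" "continuous_on UNIV k"
  shows "integrable lborel (\<lambda>t. k t * cinner J (\<phi> t) x)"
proof -
  obtain R where R: "\<And>t. \<bar>t\<bar> > R \<Longrightarrow> \<phi> t = 0" using assms(1) by (auto simp: test_fun_iff)
  show ?thesis
    by (rule integrable_continuous_compact_support[where R = R])
      (auto intro!: continuous_on_mult continuous_on_cinner continuous_on_const
        test_fun_continuous[OF assms(1)] assms(2) simp: R)
qed

text \<open>The bridge from the gauge integral in H to scalar Lebesgue integrals. The weight and the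
  oscillation merge into one exponential with complex frequency \<sigma> + i \<xi>.\<close>

lemma cinner_fourier_laplace:
  assumes \<phi>: "test_fun \<phi>"
  shows "cinner J (fourier_laplace J \<sigma> \<phi> \<xi>) x
    = (CLINT t|lborel. exp (- (Complex \<sigma> \<xi> * complex_of_real t)) * cinner J (\<phi> t) x) / sqrt (2 * pi)"
proof -
  obtain R where R: "\<And>t. \<bar>t\<bar> > R \<Longrightarrow> \<phi> t = 0" using \<phi> by (auto simp: test_fun_iff)
  let ?F = "\<lambda>t. (exp (- \<sigma> * t) / sqrt (2 * pi)) *\<^sub>R scaleJ J (cis (- \<xi> * t)) (\<phi> t)"
  have "?F integrable_on UNIV"
    by (rule integrable_on_UNIV_complete[where R = R])
      (auto intro!: continuous_intros continuous_on_scaleJ test_fun_continuous[OF \<phi>] simp: R)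
  then have "(?F has_integral fourier_laplace J \<sigma> \<phi> \<xi>) UNIV"
    unfolding fourier_laplace_def by (rule integrable_integral)
  from has_integral_linear[OF this bounded_linear_cinner_left[of x]]
  have "((\<lambda>t. cinner J (?F t) x) has_integral cinner J (fourier_laplace J \<sigma> \<phi> \<xi>) x) UNIV"
    by (simp add: o_def)
  also have "(\<lambda>t. cinner J (?F t) x)
      = (\<lambda>t. exp (- (Complex \<sigma> \<xi> * complex_of_real t)) * cinner J (\<phi> t) x / sqrt (2 * pi))"
    by (simp add: exp_Complex fun_eq_iff)
  finally have 1: "((\<lambda>t. exp (- (Complex \<sigma> \<xi> * complex_of_real t)) * cinner J (\<phi> t) x / sqrt (2 * pi))
      has_integral cinner J (fourier_laplace J \<sigma> \<phi> \<xi>) x) UNIV" .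
  have "integrable lborel (\<lambda>t. exp (- (Complex \<sigma> \<xi> * complex_of_real t)) * cinner J (\<phi> t) x / sqrt (2 * pi))"
    by (intro integrable_divide test_fun_integrand_integrable \<phi> continuous_intros)
  from has_integral_unique[OF 1 has_integral_integral_lborel[OF this]] show ?thesis by simp
qed

text \<open>The triangle inequality for a vector-valued integral that is known only through its
  pairings: \<open>v\<close> is paired with itself and one factor of its norm is divided out. The 2
  is that of \<open>norm_cinner_le\<close>.\<close>

lemma norm_le_weak_integral:
  assumes \<phi>: "test_fun \<phi>" and w: "continuous_on UNIV w" and k: "continuous_on UNIV k"
    and le: "\<And>t. norm (k t) \<le> w t"
    and eq: "\<And>x. cinner J v x = (CLINT t|lborel. k t * cinner J (\<phi> t) x)"
  shows "norm v \<le> 2 * (\<integral>t. w t * norm (\<phi> t) \<partial>lborel)"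
proof (cases "v = 0")
  case True
  have "0 \<le> w t" for t using le[of t] norm_ge_zero[of "k t"] by linarith
  then show ?thesis using True by (auto intro!: integral_nonneg_AE)
next
  case False
  obtain R where R: "\<And>t. \<bar>t\<bar> > R \<Longrightarrow> \<phi> t = 0" using \<phi> by (auto simp: test_fun_iff)
  have int: "integrable lborel (\<lambda>t. 2 * (w t * norm (\<phi> t)) * norm v)"
    by (rule integrable_continuous_compact_support[where R = R])
      (auto intro!: continuous_intros w test_fun_continuous[OF \<phi>] simp: R)
  have "norm v * norm v = Re (cinner J v v)" by (simp add: dot_square_norm power2_eq_square)
  also have "\<dots> \<le> norm (CLINT t|lborel. k t * cinner J (\<phi> t) v)"
    unfolding eq by (rule complex_Re_le_cmod)
  also have "\<dots> \<le> (\<integral>t. 2 * (w t * norm (\<phi> t)) * norm v \<partial>lborel)"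
  proof (rule Bochner_Integration.integral_norm_bound_integral[OF test_fun_integrand_integrable[OF \<phi> k] int])
    fix t
    have "norm (k t) * norm (cinner J (\<phi> t) v) \<le> w t * (2 * (norm (\<phi> t) * norm v))"
      using le[of t] by (intro mult_mono norm_cinner_le) (auto intro: order_trans[OF norm_ge_zero])
    then show "norm (k t * cinner J (\<phi> t) v) \<le> 2 * (w t * norm (\<phi> t)) * norm v"
      by (simp add: norm_mult ac_simps)
  qed
  also have "\<dots> = 2 * (\<integral>t. w t * norm (\<phi> t) \<partial>lborel) * norm v" by simp
  finally show ?thesis using False by simp
qed

lemma fourier_laplace_bounded:
  assumes \<phi>: "test_fun \<phi>"
  shows "\<exists>M. \<forall>\<xi>. norm (fourier_laplace J \<sigma> \<phi> \<xi>) \<le> M"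
proof (intro exI allI)
  fix \<xi>
  show "norm (fourier_laplace J \<sigma> \<phi> \<xi>) \<le> 2 * (\<integral>t. (exp (- \<sigma> * t) / sqrt (2 * pi)) * norm (\<phi> t) \<partial>lborel)"
  proof (rule norm_le_weak_integral[OF \<phi>])
    show "continuous_on UNIV (\<lambda>t. exp (- (Complex \<sigma> \<xi> * complex_of_real t)) / complex_of_real (sqrt (2 * pi)))"
      by (auto intro!: continuous_intros)
    show "continuous_on UNIV (\<lambda>t. exp (- \<sigma> * t) / sqrt (2 * pi))" by (auto intro!: continuous_intros)
  qed (auto simp: cinner_fourier_laplace[OF \<phi>] norm_divide norm_exp_Complex)
qed

lemma norm_iexp_diff_le: "norm (iexp a - iexp b) \<le> \<bar>a - b\<bar>"
proof -
  have "iexp a - iexp b = iexp b * (iexp (a - b) - 1)"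
    by (simp add: right_diff_distrib exp_add[symmetric])
  then have "norm (iexp a - iexp b) = norm (iexp (a - b) - 1)" by (simp add: norm_mult)
  also have "\<dots> \<le> \<bar>a - b\<bar>" using iexp_approx1[of "a - b" 0] by simp
  finally show ?thesis .
qed

text \<open>The transform is even Lipschitz in the frequency: the difference of two oscillations is
  at most the frequency difference times |t|, and on a compact support the factor |t| is
  harmless.\<close>

lemma fourier_laplace_continuous:
  assumes \<phi>: "test_fun \<phi>"
  shows "isCont (fourier_laplace J \<sigma> \<phi>) \<xi>"
proof -
  define M where "M = 2 * (\<integral>t. (exp (- \<sigma> * t) * \<bar>t\<bar> / sqrt (2 * pi)) * norm (\<phi> t) \<partial>lborel)"
  have lip: "norm (fourier_laplace J \<sigma> \<phi> \<eta> - fourier_laplace J \<sigma> \<phi> \<xi>) \<le> \<bar>\<eta> - \<xi>\<bar> * M" for \<eta>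
  proof -
    let ?e = "\<lambda>\<xi> t. exp (- (Complex \<sigma> \<xi> * complex_of_real t))"
    have "norm (fourier_laplace J \<sigma> \<phi> \<eta> - fourier_laplace J \<sigma> \<phi> \<xi>)
        \<le> 2 * (\<integral>t. (\<bar>\<eta> - \<xi>\<bar> * (exp (- \<sigma> * t) * \<bar>t\<bar> / sqrt (2 * pi))) * norm (\<phi> t) \<partial>lborel)"
    proof (rule norm_le_weak_integral[OF \<phi>])
      show "continuous_on UNIV (\<lambda>t. (?e \<eta> t - ?e \<xi> t) / complex_of_real (sqrt (2 * pi)))"
        by (auto intro!: continuous_intros)
      show "continuous_on UNIV (\<lambda>t. \<bar>\<eta> - \<xi>\<bar> * (exp (- \<sigma> * t) * \<bar>t\<bar> / sqrt (2 * pi)))"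
        by (auto intro!: continuous_intros)
      show "norm ((?e \<eta> t - ?e \<xi> t) / complex_of_real (sqrt (2 * pi)))
          \<le> \<bar>\<eta> - \<xi>\<bar> * (exp (- \<sigma> * t) * \<bar>t\<bar> / sqrt (2 * pi))" for t
      proof -
        have "?e \<eta> t - ?e \<xi> t = complex_of_real (exp (- \<sigma> * t)) * (iexp (- \<eta> * t) - iexp (- \<xi> * t))"
          by (simp add: exp_Complex cis_conv_exp right_diff_distrib)
        then have "norm (?e \<eta> t - ?e \<xi> t) \<le> exp (- \<sigma> * t) * \<bar>- \<eta> * t - - \<xi> * t\<bar>"
          using norm_iexp_diff_le[of "- \<eta> * t" "- \<xi> * t"] by (simp only: norm_mult norm_of_real abs_exp_cancel mult_left_mono exp_ge_zero)
        also have "\<bar>- \<eta> * t - - \<xi> * t\<bar> = \<bar>\<eta> - \<xi>\<bar> * \<bar>t\<bar>"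
          by (simp add: abs_mult[symmetric] algebra_simps abs_minus_commute)
        finally show ?thesis by (simp add: norm_divide divide_right_mono ac_simps)
      qed
      fix x
      have "integrable lborel (\<lambda>t. ?e \<xi> t * cinner J (\<phi> t) x)" for \<xi>
        by (intro test_fun_integrand_integrable \<phi> continuous_intros)
      then show "cinner J (fourier_laplace J \<sigma> \<phi> \<eta> - fourier_laplace J \<sigma> \<phi> \<xi>) x
          = (CLINT t|lborel. (?e \<eta> t - ?e \<xi> t) / complex_of_real (sqrt (2 * pi)) * cinner J (\<phi> t) x)"
        by (simp add: cinner_fourier_laplace[OF \<phi>] left_diff_distrib diff_divide_distrib)
    qed
    then show ?thesis
      unfolding M_def mult.assoc integral_mult_right_zero by (simp only: mult.left_commute)
  qed
  have "((\<lambda>\<eta>. fourier_laplace J \<sigma> \<phi> \<eta> - fourier_laplace J \<sigma> \<phi> \<xi>) \<longlongrightarrow> 0) (at \<xi>)"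
  proof (rule Lim_null_comparison[OF always_eventually])
    show "\<forall>\<eta>. norm (fourier_laplace J \<sigma> \<phi> \<eta> - fourier_laplace J \<sigma> \<phi> \<xi>) \<le> \<bar>\<eta> - \<xi>\<bar> * M" using lip by blast
    have "((\<lambda>\<eta>. \<bar>\<eta> - \<xi>\<bar> * M) \<longlongrightarrow> \<bar>\<xi> - \<xi>\<bar> * M) (at \<xi>)" by (intro tendsto_intros)
    then show "((\<lambda>\<eta>. \<bar>\<eta> - \<xi>\<bar> * M) \<longlongrightarrow> 0) (at \<xi>)" by simp
  qed
  then show ?thesis by (simp add: isCont_def LIM_zero_iff)
qed

section \<open>Derivatives and decay of the transform\<close>

lemma laplace_derivative:
  fixes f :: "real \<Rightarrow> complex"
  assumes f: "\<And>t. (f has_vector_derivative f' t) (at t)" "continuous_on UNIV f'"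
    and supp: "\<And>t. \<bar>t\<bar> > R \<Longrightarrow> f t = 0" "\<And>t. \<bar>t\<bar> > R \<Longrightarrow> f' t = 0"
  shows "(CLINT t|lborel. exp (- (z * complex_of_real t)) * f' t) = z * (CLINT t|lborel. exp (- (z * complex_of_real t)) * f t)"
proof -
  \<comment> \<open>Integration by parts runs over the interval from -S to S. As \<open>S\<close> is
    positive and exceeds \<open>R\<close>, the boundary terms vanish and nothing of the integrand
    lies outside.\<close>
  define S where "S = max R 0 + 1"
  have S: "S > R" "S > 0" by (auto simp: S_def)
  have fc: "continuous_on UNIV f"
    using has_vector_derivative_continuous[OF f(1)] by (simp add: continuous_at_imp_continuous_on)
  let ?e = "\<lambda>t. exp (- (z * complex_of_real t))"
  let ?G = "\<lambda>t. ?e t * f' t - z * (?e t * f t)"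
  have ec: "continuous_on UNIV ?e" by (intro continuous_intros)
  have e: "(?e has_vector_derivative (- z * ?e t)) (at t)" for t
  proof -
    have "((\<lambda>w. exp (- (z * w))) has_field_derivative (- z * ?e t)) (at (complex_of_real t))"
      by (auto intro!: derivative_eq_intros)
    from has_vector_derivative_real_field[OF this] show ?thesis .
  qed
  have deriv: "((\<lambda>t. ?e t * f t) has_vector_derivative ?G t) (at t)" for t
    using has_vector_derivative_mult[OF e f(1), of t] by (simp add: algebra_simps)
  have "(\<integral>t. indicator {- S..S} t *\<^sub>R ?G t \<partial>lborel) = ?e S * f S - ?e (- S) * f (- S)"
    using S f(2) fc ec
    by (intro integral_FTC_atLeastAtMost has_vector_derivative_at_within[OF deriv] continuous_on_diff
        continuous_on_mult continuous_on_const) (auto intro: continuous_on_subset)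
  also have "\<dots> = 0" using S supp(1)[of S] supp(1)[of "- S"] by simp
  also have "(\<lambda>t. indicator {- S..S} t *\<^sub>R ?G t) = ?G"
  proof
    fix t show "indicator {- S..S} t *\<^sub>R ?G t = ?G t"
      using S supp[of t] by (cases "\<bar>t\<bar> > R") (auto simp: indicator_def)
  qed
  finally have "(CLINT t|lborel. ?G t) = 0" .
  moreover have "integrable lborel (\<lambda>t. ?e t * f' t)" "integrable lborel (\<lambda>t. z * (?e t * f t))"
    using f(2) fc ec supp
    by (auto intro!: integrable_continuous_compact_support[where R = R] continuous_on_mult)
  ultimately show ?thesis by (simp add: Bochner_Integration.integral_diff)
qed

lemma fourier_laplace_derivative:
  assumes \<phi>: "test_fun \<phi>" and \<phi>': "test_fun \<phi>'" and deriv: "\<And>t. (\<phi> has_vector_derivative \<phi>' t) (at t)"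
  shows "fourier_laplace J \<sigma> \<phi>' \<xi> = scaleJ J (Complex \<sigma> \<xi>) (fourier_laplace J \<sigma> \<phi> \<xi>)"
proof (rule cinner_eqI)
  fix x
  obtain R where R: "\<And>t. \<bar>t\<bar> > R \<Longrightarrow> \<phi> t = 0" using \<phi> by (auto simp: test_fun_iff)
  obtain R' where R': "\<And>t. \<bar>t\<bar> > R' \<Longrightarrow> \<phi>' t = 0" using \<phi>' by (auto simp: test_fun_iff)
  have "(CLINT t|lborel. exp (- (Complex \<sigma> \<xi> * complex_of_real t)) * cinner J (\<phi>' t) x)
      = Complex \<sigma> \<xi> * (CLINT t|lborel. exp (- (Complex \<sigma> \<xi> * complex_of_real t)) * cinner J (\<phi> t) x)"
  proof (rule laplace_derivative[where R = "max R R'"])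
    show "((\<lambda>t. cinner J (\<phi> t) x) has_vector_derivative cinner J (\<phi>' t) x) (at t)" for t
      by (rule bounded_linear.has_vector_derivative[OF bounded_linear_cinner_left deriv])
    show "continuous_on UNIV (\<lambda>t. cinner J (\<phi>' t) x)"
      by (intro continuous_on_cinner continuous_on_const test_fun_continuous \<phi>')
  qed (auto simp: R R')
  then show "cinner J (fourier_laplace J \<sigma> \<phi>' \<xi>) x = cinner J (scaleJ J (Complex \<sigma> \<xi>) (fourier_laplace J \<sigma> \<phi> \<xi>)) x"
    by (simp add: cinner_fourier_laplace \<phi> \<phi>')
qed

text \<open>Each power of the symbol is traded for one derivative of \<open>\<phi>\<close>, which is
  again a test function.\<close>

lemma fourier_laplace_decay:
  assumes "test_fun \<phi>"
  shows "\<exists>M. \<forall>\<xi>. norm (Complex \<sigma> \<xi>) ^ n * norm (fourier_laplace J \<sigma> \<phi> \<xi>) \<le> M"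
  using assms
proof (induction n arbitrary: \<phi>)
  case 0
  then show ?case using fourier_laplace_bounded by simp
next
  case (Suc n)
  obtain \<phi>' where \<phi>': "test_fun \<phi>'" "\<And>t. (\<phi> has_vector_derivative \<phi>' t) (at t)"
    using test_fun_derivative[OF Suc.prems] by metis
  have "norm (Complex \<sigma> \<xi>) ^ Suc n * norm (fourier_laplace J \<sigma> \<phi> \<xi>)
      = norm (Complex \<sigma> \<xi>) ^ n * norm (fourier_laplace J \<sigma> \<phi>' \<xi>)" for \<xi>
    by (simp add: fourier_laplace_derivative[OF Suc.prems \<phi>'] ac_simps)
  then show ?case using Suc.IH[OF \<phi>'(1)] by (simp only:)
qed

lemma cnj_exp_Complex: "cnj (exp (- (Complex \<sigma> \<xi> * complex_of_real t))) = complex_of_real (exp (- \<sigma> * t)) * iexp (\<xi> * t)"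
proof -
  have "cnj (cis (- \<xi> * t)) = cis (- (- \<xi> * t))" by (rule cis_cnj)
  also have "- (- \<xi> * t) = \<xi> * t" by simp
  finally have "cnj (cis (- \<xi> * t)) = iexp (\<xi> * t)" by (simp only: cis_conv_exp)
  then show ?thesis unfolding exp_Complex by simp
qed

text \<open>Two powers of the symbol beyond \<gamma> buy the factor 1 / (1 + \<xi>^2), with
  \<open>c\<close> comparing the squared modulus of \<sigma> + i \<xi> to 1 + \<xi>^2. The leftover
  exponent \<gamma> + 2 - n is nonpositive, so that power is largest at the least modulus
  |\<sigma>|. Both comparisons rest on \<sigma> being nonzero.\<close>

lemma fourier_laplace_weighted_decay:
  assumes \<phi>: "test_fun \<phi>" and \<sigma>: "\<sigma> \<noteq> 0"
  shows "\<exists>M\<ge>0. \<forall>\<xi>. norm (Complex \<sigma> \<xi>) powr \<gamma> * norm (fourier_laplace J \<sigma> \<phi> \<xi>) \<le> M / (1 + \<xi>\<^sup>2)"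
proof -
  obtain n :: nat where n: "\<gamma> + 2 \<le> n" using real_arch_simple by blast
  obtain M where M: "\<And>\<xi>. norm (Complex \<sigma> \<xi>) ^ n * norm (fourier_laplace J \<sigma> \<phi> \<xi>) \<le> M"
    using fourier_laplace_decay[OF \<phi>] by blast
  have M0: "M \<ge> 0" using M[of 0] by (rule order_trans[rotated]) simp
  define c where "c = min 1 (\<sigma>\<^sup>2)"
  have c: "c > 0" using \<sigma> by (simp add: c_def)
  have "norm (Complex \<sigma> \<xi>) powr \<gamma> * norm (fourier_laplace J \<sigma> \<phi> \<xi>) \<le> (\<bar>\<sigma>\<bar> powr (\<gamma> + 2 - n) * M / c) / (1 + \<xi>\<^sup>2)" for \<xi>
  proof -
    let ?w = "norm (Complex \<sigma> \<xi>)" and ?F = "norm (fourier_laplace J \<sigma> \<phi> \<xi>)"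
    have w: "\<bar>\<sigma>\<bar> \<le> ?w" using abs_Re_le_cmod[of "Complex \<sigma> \<xi>"] by simp
    with \<sigma> have w0: "?w > 0" by linarith
    have "c * (1 + \<xi>\<^sup>2) \<le> ?w\<^sup>2"
    proof -
      have "c * (1 + \<xi>\<^sup>2) = c + c * \<xi>\<^sup>2" by (simp add: algebra_simps)
      also have "\<dots> \<le> \<sigma>\<^sup>2 + 1 * \<xi>\<^sup>2" by (intro add_mono mult_right_mono) (auto simp: c_def)
      finally show ?thesis by (simp add: cmod_power2)
    qed
    then have "(?w powr \<gamma> * ?F) * (c * (1 + \<xi>\<^sup>2)) \<le> (?w powr \<gamma> * ?F) * ?w\<^sup>2"
      by (intro mult_left_mono) auto
    also have "\<dots> = ?w powr (\<gamma> + 2 - n) * (?w ^ n * ?F)"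
      using w0 by (simp add: powr_realpow[symmetric] powr_add[symmetric] mult.assoc[symmetric] powr_numeral[symmetric]
          del: powr_numeral)
    also have "\<dots> \<le> \<bar>\<sigma>\<bar> powr (\<gamma> + 2 - n) * M"
      using n w \<sigma> M[of \<xi>] by (intro mult_mono powr_mono2') auto
    finally have "(?w powr \<gamma> * ?F) \<le> (\<bar>\<sigma>\<bar> powr (\<gamma> + 2 - n) * M) / (c * (1 + \<xi>\<^sup>2))"
      using c by (subst pos_le_divide_eq) (auto intro!: mult_pos_pos add_pos_nonneg)
    then show ?thesis by simp
  qed
  then show ?thesis using M0 c by (intro exI[of _ "\<bar>\<sigma>\<bar> powr (\<gamma> + 2 - n) * M / c"]) auto
qed

lemma fourier_laplace_norm_integrable:
  assumes \<phi>: "test_fun \<phi>" and \<sigma>: "\<sigma> \<noteq> 0"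
  shows "integrable lborel (\<lambda>\<xi>. norm (fourier_laplace J \<sigma> \<phi> \<xi>))"
proof -
  obtain M where M: "M \<ge> 0" "\<And>\<xi>. norm (Complex \<sigma> \<xi>) powr 0 * norm (fourier_laplace J \<sigma> \<phi> \<xi>) \<le> M / (1 + \<xi>\<^sup>2)"
    using fourier_laplace_weighted_decay[OF assms] by blast
  have nz: "Complex \<sigma> \<xi> \<noteq> 0" for \<xi> using \<sigma> by (simp add: complex_eq_iff)
  show ?thesis
  proof (rule Bochner_Integration.integrable_bound)
    show "integrable lborel (\<lambda>\<xi>. M * (1 / (1 + \<xi>\<^sup>2)))"
      by (intro integrable_mult_right integrable_inverse_one_plus_square)
    show "(\<lambda>\<xi>. norm (fourier_laplace J \<sigma> \<phi> \<xi>)) \<in> borel_measurable lborel"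
      by (simp, intro borel_measurable_continuous_onI continuous_at_imp_continuous_on)
        (auto intro!: continuous_intros fourier_laplace_continuous \<phi>)
    show "AE \<xi> in lborel. norm (norm (fourier_laplace J \<sigma> \<phi> \<xi>)) \<le> norm (M * (1 / (1 + \<xi>\<^sup>2)))"
    proof (rule AE_I2)
      fix \<xi>
      show "norm (norm (fourier_laplace J \<sigma> \<phi> \<xi>)) \<le> norm (M * (1 / (1 + \<xi>\<^sup>2)))"
        using M(2)[of \<xi>] M(1) nz[of \<xi>] by simp
    qed
  qed
qed

section \<open>Weak inversion and Parseval's identity\<close>

lemma continuous_on_fourier_laplace: "test_fun \<phi> \<Longrightarrow> continuous_on S (fourier_laplace J \<sigma> \<phi>)"
  by (intro continuous_at_imp_continuous_on ballI fourier_laplace_continuous)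

text \<open>Translating the weighted test function by \<open>t\<close> moves the point of evaluation
  to 0, where \<open>fourier_inversion_at_0\<close> applies; on the transform side the translation
  is the phase factor.\<close>

lemma fourier_laplace_weak_inversion:
  assumes \<psi>: "test_fun \<psi>" and \<sigma>: "\<sigma> \<noteq> 0"
  shows "(CLINT \<xi>|lborel. cinner J (fourier_laplace J \<sigma> \<psi> \<xi>) x * iexp (\<xi> * t))
    = sqrt (2 * pi) * exp (- \<sigma> * t) * cinner J (\<psi> t) x"
proof -
  obtain R where R: "\<And>t. \<bar>t\<bar> > R \<Longrightarrow> \<psi> t = 0" using \<psi> by (auto simp: test_fun_iff)
  define f where "f s = complex_of_real (exp (- \<sigma> * (s + t))) * cinner J (\<psi> (s + t)) x" for s
  define K where "K \<xi> = (CLINT s|lborel. f s * iexp (- \<xi> * s))" for \<xi>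
  have fc: "continuous_on UNIV f"
    unfolding f_def
    by (intro continuous_intros continuous_on_cinner continuous_on_compose2[OF test_fun_continuous[OF \<psi>, of UNIV]]) auto
  have fs: "f s = 0" if "\<bar>s\<bar> > R + \<bar>t\<bar>" for s
  proof -
    have "\<bar>s + t\<bar> > R" using that by linarith
    then show ?thesis by (simp add: f_def R)
  qed
  have K: "K \<xi> = sqrt (2 * pi) * (cinner J (fourier_laplace J \<sigma> \<psi> \<xi>) x * iexp (\<xi> * t))" for \<xi>
  proof -
    have "K \<xi> = (CLINT u|lborel. f (- t + 1 * u) * iexp (- \<xi> * (- t + 1 * u)))"
      unfolding K_def by (subst lborel_integral_real_affine[of 1 _ "- t"]) auto
    also have "\<dots> = (CLINT u|lborel. iexp (\<xi> * t) * (exp (- (Complex \<sigma> \<xi> * complex_of_real u)) * cinner J (\<psi> u) x))"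
    proof (rule Bochner_Integration.integral_cong[OF refl])
      fix u
      have "iexp (- \<xi> * (- t + 1 * u)) = iexp (\<xi> * t) * iexp (- \<xi> * u)"
        by (simp add: exp_add[symmetric] algebra_simps)
      then show "f (- t + 1 * u) * iexp (- \<xi> * (- t + 1 * u))
          = iexp (\<xi> * t) * (exp (- (Complex \<sigma> \<xi> * complex_of_real u)) * cinner J (\<psi> u) x)"
        unfolding f_def exp_Complex cis_conv_exp by (simp add: mult.assoc mult.left_commute)
    qed
    also have "\<dots> = iexp (\<xi> * t) * (sqrt (2 * pi) * cinner J (fourier_laplace J \<sigma> \<psi> \<xi>) x)"
      by (simp add: cinner_fourier_laplace[OF \<psi>])
    finally show ?thesis by (simp add: ac_simps)
  qed
  have "integrable lborel (\<lambda>\<xi>. cinner J (fourier_laplace J \<sigma> \<psi> \<xi>) x * iexp (\<xi> * t))"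
  proof (rule Bochner_Integration.integrable_bound)
    show "integrable lborel (\<lambda>\<xi>. norm (fourier_laplace J \<sigma> \<psi> \<xi>) * (2 * norm x))"
      by (intro integrable_mult_left fourier_laplace_norm_integrable assms)
    show "(\<lambda>\<xi>. cinner J (fourier_laplace J \<sigma> \<psi> \<xi>) x * iexp (\<xi> * t)) \<in> borel_measurable lborel"
      by (simp, intro borel_measurable_continuous_onI)
        (intro continuous_intros continuous_on_cinner continuous_on_fourier_laplace \<psi>)
    show "AE \<xi> in lborel. norm (cinner J (fourier_laplace J \<sigma> \<psi> \<xi>) x * iexp (\<xi> * t))
        \<le> norm (norm (fourier_laplace J \<sigma> \<psi> \<xi>) * (2 * norm x))"
    proof (rule AE_I2)
      fix \<xi>
      show "norm (cinner J (fourier_laplace J \<sigma> \<psi> \<xi>) x * iexp (\<xi> * t))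
          \<le> norm (norm (fourier_laplace J \<sigma> \<psi> \<xi>) * (2 * norm x))"
        using norm_cinner_le[of "fourier_laplace J \<sigma> \<psi> \<xi>" x] by (simp add: norm_mult ac_simps)
    qed
  qed
  then have "integrable lborel (\<lambda>\<xi>. sqrt (2 * pi) * (cinner J (fourier_laplace J \<sigma> \<psi> \<xi>) x * iexp (\<xi> * t)))"
    by (rule integrable_mult_right)
  then have Kint: "integrable lborel K" unfolding K[symmetric] .
  have "(CLINT \<xi>|lborel. K \<xi>) = 2 * pi * f 0"
    unfolding K_def by (rule fourier_inversion_at_0[OF fc fs Kint[unfolded K_def[abs_def]]])
  moreover have "2 * complex_of_real pi = complex_of_real (sqrt (2 * pi)) * complex_of_real (sqrt (2 * pi))"
    unfolding of_real_mult[symmetric] by simp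
  ultimately have "complex_of_real (sqrt (2 * pi)) * (CLINT \<xi>|lborel. cinner J (fourier_laplace J \<sigma> \<psi> \<xi>) x * iexp (\<xi> * t))
      = complex_of_real (sqrt (2 * pi)) * (complex_of_real (sqrt (2 * pi)) * f 0)"
    unfolding K by (simp only: integral_mult_right_zero of_real_mult of_real_numeral mult.assoc)
  then have "(CLINT \<xi>|lborel. cinner J (fourier_laplace J \<sigma> \<psi> \<xi>) x * iexp (\<xi> * t))
      = complex_of_real (sqrt (2 * pi)) * f 0"
    unfolding mult_cancel_left by simp
  then show ?thesis by (simp add: f_def)
qed

text \<open>The transform of \<open>\<phi>\<close> is written out, Fubini's theorem makes the
  integration over \<xi> the inner one, and that integral is evaluated by weak inversion for
  \<open>\<psi>\<close>. The opposite signs of the two weights let exp (\<sigma> t) and exp (-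
  \<sigma> t) cancel, so the result does not depend on \<sigma>.\<close>

lemma parseval:
  assumes \<psi>: "test_fun \<psi>" and \<phi>: "test_fun \<phi>" and \<sigma>: "\<sigma> \<noteq> 0"
  shows "(CLINT \<xi>|lborel. cinner J (fourier_laplace J \<sigma> \<psi> \<xi>) (fourier_laplace J (- \<sigma>) \<phi> \<xi>))
    = (CLINT t|lborel. cinner J (\<psi> t) (\<phi> t))"
proof -
  let ?F = "fourier_laplace J \<sigma> \<psi>"
  define h where "h t \<xi> = complex_of_real (exp (\<sigma> * t)) * iexp (\<xi> * t) * cinner J (?F \<xi>) (\<phi> t)" for t \<xi>
  obtain R where R: "\<And>t. \<bar>t\<bar> > R \<Longrightarrow> \<phi> t = 0" using \<phi> by (auto simp: test_fun_iff)
  have 1: "cinner J a (fourier_laplace J (- \<sigma>) \<phi> \<xi>)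
      = (CLINT t|lborel. complex_of_real (exp (\<sigma> * t)) * iexp (\<xi> * t) * cinner J a (\<phi> t)) / sqrt (2 * pi)" for a \<xi>
  proof -
    have "cinner J a (fourier_laplace J (- \<sigma>) \<phi> \<xi>) = cnj (cinner J (fourier_laplace J (- \<sigma>) \<phi> \<xi>) a)"
      by (rule cinner_commute)
    also have "\<dots> = (CLINT t|lborel. cnj (exp (- (Complex (- \<sigma>) \<xi> * complex_of_real t)) * cinner J (\<phi> t) a)) / sqrt (2 * pi)"
      by (simp add: cinner_fourier_laplace[OF \<phi>] del: complex_cnj_mult)
    also have "\<dots> = (CLINT t|lborel. complex_of_real (exp (\<sigma> * t)) * iexp (\<xi> * t) * cinner J a (\<phi> t)) / sqrt (2 * pi)"
      unfolding complex_cnj_mult cnj_exp_Complex cinner_commute[of a] by simp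
    finally show ?thesis .
  qed
  have prodint: "integrable (lborel \<Otimes>\<^sub>M lborel) (\<lambda>(t, \<xi>). (2 * (exp (\<sigma> * t) * norm (\<phi> t))) * norm (?F \<xi>))"
  proof (rule lborel_pair.Fubini_integrable)
    have "integrable lborel (\<lambda>t. 2 * (exp (\<sigma> * t) * norm (\<phi> t)))"
      by (rule integrable_continuous_compact_support[where R = R])
        (auto intro!: continuous_intros test_fun_continuous[OF \<phi>] simp: R)
    then show "integrable lborel (\<lambda>t. \<integral>\<xi>. norm (case (t, \<xi>) of (t, \<xi>) \<Rightarrow> (2 * (exp (\<sigma> * t) * norm (\<phi> t))) * norm (?F \<xi>)) \<partial>lborel)"
      by (simp add: abs_mult)
    show "AE t in lborel. integrable lborel (\<lambda>\<xi>. case (t, \<xi>) of (t, \<xi>) \<Rightarrow> (2 * (exp (\<sigma> * t) * norm (\<phi> t))) * norm (?F \<xi>))"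
      using fourier_laplace_norm_integrable[OF \<psi> \<sigma>] by simp
    have "(\<lambda>t. norm (\<phi> t)) \<in> borel_measurable borel" "(\<lambda>\<xi>. norm (?F \<xi>)) \<in> borel_measurable borel"
      by (auto intro!: borel_measurable_continuous_onI continuous_intros test_fun_continuous[OF \<phi>]
          continuous_on_fourier_laplace[OF \<psi>])
    then show "(\<lambda>(t, \<xi>). (2 * (exp (\<sigma> * t) * norm (\<phi> t))) * norm (?F \<xi>)) \<in> borel_measurable (lborel \<Otimes>\<^sub>M lborel)"
      by measurable
  qed
  have hint: "integrable (lborel \<Otimes>\<^sub>M lborel) (case_prod h)"
  proof (rule Bochner_Integration.integrable_bound[OF prodint])
    have "continuous_on UNIV (\<lambda>p. h (fst p) (snd p))"
      unfolding h_def
      by (intro continuous_intros continuous_on_cinner continuous_on_compose2[OF test_fun_continuous[OF \<phi>, of UNIV]]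
          continuous_on_compose2[OF continuous_on_fourier_laplace[OF \<psi>, of UNIV]]) auto
    then show "case_prod h \<in> borel_measurable (lborel \<Otimes>\<^sub>M lborel)"
      by (simp add: lborel_prod case_prod_unfold borel_measurable_continuous_onI)
    show "AE p in lborel \<Otimes>\<^sub>M lborel. norm (case_prod h p)
        \<le> norm (case p of (t, \<xi>) \<Rightarrow> (2 * (exp (\<sigma> * t) * norm (\<phi> t))) * norm (?F \<xi>))"
    proof (rule AE_I2, clarify)
      fix t \<xi>
      show "norm (h t \<xi>) \<le> norm ((2 * (exp (\<sigma> * t) * norm (\<phi> t))) * norm (?F \<xi>))"
        using norm_cinner_le[of "?F \<xi>" "\<phi> t"] by (simp add: h_def norm_mult abs_mult ac_simps)
    qed
  qed
  have "(CLINT \<xi>|lborel. cinner J (?F \<xi>) (fourier_laplace J (- \<sigma>) \<phi> \<xi>))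
      = (CLINT \<xi>|lborel. CLINT t|lborel. h t \<xi>) / sqrt (2 * pi)"
    unfolding 1 h_def by simp
  also have "(CLINT \<xi>|lborel. CLINT t|lborel. h t \<xi>) = (CLINT t|lborel. CLINT \<xi>|lborel. h t \<xi>)"
    by (rule lborel_pair.Fubini_integral[OF hint])
  also have "\<dots> = (CLINT t|lborel. sqrt (2 * pi) * cinner J (\<psi> t) (\<phi> t))"
  proof (rule Bochner_Integration.integral_cong[OF refl])
    fix t
    have "(CLINT \<xi>|lborel. h t \<xi>) = complex_of_real (exp (\<sigma> * t))
        * (CLINT \<xi>|lborel. cinner J (?F \<xi>) (\<phi> t) * iexp (\<xi> * t))"
      unfolding h_def by (subst integral_mult_right_zero[symmetric]) (simp add: ac_simps)
    also have "\<dots> = (complex_of_real (exp (\<sigma> * t)) * complex_of_real (exp (- \<sigma> * t))) * (sqrt (2 * pi) * cinner J (\<psi> t) (\<phi> t))"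
      unfolding fourier_laplace_weak_inversion[OF \<psi> \<sigma>] by (simp only: of_real_mult ac_simps)
    also have "complex_of_real (exp (\<sigma> * t)) * complex_of_real (exp (- \<sigma> * t)) = 1"
      by (simp only: of_real_mult[symmetric] exp_add[symmetric]) simp
    finally show "(CLINT \<xi>|lborel. h t \<xi>) = sqrt (2 * pi) * cinner J (\<psi> t) (\<phi> t)" by simp
  qed
  finally show ?thesis by simp
qed

lemma test_dist_independent:
  assumes \<psi>: "test_fun \<psi>" and "\<sigma> \<noteq> 0" "\<sigma>' \<noteq> 0"
  shows "test_dist J \<sigma> \<psi> = test_dist J \<sigma>' \<psi>"
proof (rule ext)
  fix \<phi>
  have "(CLINT \<xi>|lebesgue. cinner J (fourier_laplace J \<sigma> \<psi> \<xi>) (fourier_laplace J (- \<sigma>) \<phi> \<xi>))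
      = (CLINT t|lborel. cinner J (\<psi> t) (\<phi> t))" if \<phi>: "test_fun \<phi>" and "\<sigma> \<noteq> 0" for \<sigma>
  proof (subst integral_completion)
    show "(\<lambda>\<xi>. cinner J (fourier_laplace J \<sigma> \<psi> \<xi>) (fourier_laplace J (- \<sigma>) \<phi> \<xi>)) \<in> borel_measurable lborel"
      by (simp, intro borel_measurable_continuous_onI continuous_on_cinner continuous_on_fourier_laplace \<psi> \<phi>)
  qed (rule parseval[OF \<psi> that])
  then show "test_dist J \<sigma> \<psi> \<phi> = test_dist J \<sigma>' \<psi> \<phi>"
    using assms by (simp add: test_dist_def dist_of_def)
qed

section \<open>Test functions separate points\<close>

text \<open>The scalar transform of a bump squeezed into the interval from 0 to 1 / n. The squeezing
  parameter stays free because one such transform may have zeros.\<close>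

definition bump_laplace :: "real \<Rightarrow> nat \<Rightarrow> real \<Rightarrow> complex" where
  "bump_laplace \<sigma> n \<xi> = (CLINT t|lborel. exp (- (Complex \<sigma> \<xi> * complex_of_real t)) * complex_of_real (bump (real n * t))) / sqrt (2 * pi)"

lemma test_fun_bump:
  assumes "n \<ge> 1"
  shows "test_fun (\<lambda>t. bump (real n * (t - a)) *\<^sub>R x)"
proof -
  have "bump (real n * (t - a)) = 0" if "\<bar>t\<bar> > \<bar>a\<bar> + 1" for t
  proof (rule bump_zero, rule notI)
    assume *: "0 < real n * (t - a) \<and> real n * (t - a) < 1"
    then have "0 < t - a" using assms by (simp add: zero_less_mult_iff)
    moreover have "t - a \<le> real n * (t - a)" using assms calculation by simp
    ultimately show False using * that by linarith
  qed
  moreover have "smooth_fun (\<lambda>t. bump (real n * t + - real n * a) *\<^sub>R x)"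
    by (intro smooth_fun_linear[of "\<lambda>r. r *\<^sub>R x"] smooth_fun_affine smooth_bump bounded_linear_scaleR_left)
  ultimately show ?thesis
    unfolding test_fun_iff by (intro conjI exI[of _ "\<bar>a\<bar> + 1"]) (auto simp: algebra_simps)
qed

text \<open>Translation by \<open>a\<close> turns into an exponential factor, so letting
  \<open>a\<close> vary in a pairing runs through all frequencies of a scalar Fourier
  transform.\<close>

lemma fourier_laplace_bump:
  assumes n: "n \<ge> 1"
  shows "fourier_laplace J \<sigma> (\<lambda>t. bump (real n * (t - a)) *\<^sub>R x) \<xi>
    = scaleJ J (exp (- (Complex \<sigma> \<xi> * complex_of_real a)) * bump_laplace \<sigma> n \<xi>) x"
proof (rule cinner_eqI)
  fix y
  let ?e = "\<lambda>t. exp (- (Complex \<sigma> \<xi> * complex_of_real t))"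
  have "(CLINT t|lborel. ?e t * cinner J (bump (real n * (t - a)) *\<^sub>R x) y)
      = (CLINT t|lborel. (?e t * complex_of_real (bump (real n * (t - a)))) * cinner J x y)"
    by (simp add: mult.assoc)
  also have "\<dots> = (CLINT t|lborel. ?e t * complex_of_real (bump (real n * (t - a)))) * cinner J x y"
    by (rule integral_mult_left_zero)
  also have "(CLINT t|lborel. ?e t * complex_of_real (bump (real n * (t - a))))
      = (CLINT u|lborel. ?e (a + 1 * u) * complex_of_real (bump (real n * (a + 1 * u - a))))"
    by (subst lborel_integral_real_affine[of 1 _ a]) auto
  also have "\<dots> = (CLINT u|lborel. ?e a * (?e u * complex_of_real (bump (real n * u))))"
    by (simp add: exp_add[symmetric] distrib_left mult.assoc[symmetric] add.commute)
  also have "\<dots> = ?e a * (CLINT u|lborel. ?e u * complex_of_real (bump (real n * u)))"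
    by (rule integral_mult_right_zero)
  finally show "cinner J (fourier_laplace J \<sigma> (\<lambda>t. bump (real n * (t - a)) *\<^sub>R x) \<xi>) y
      = cinner J (scaleJ J (?e a * bump_laplace \<sigma> n \<xi>) x) y"
    unfolding cinner_fourier_laplace[OF test_fun_bump[OF n]] by (simp add: bump_laplace_def)
qed

text \<open>If the support is so small that \<open>\<bar>\<xi> t\<bar> \<le> 1\<close> on it, then \<open>cos (\<xi> t)\<close> is positive there.\<close>

lemma bump_laplace_nonzero:
  assumes n: "n \<ge> 1" "\<bar>\<xi>\<bar> \<le> real n"
  shows "bump_laplace \<sigma> n \<xi> \<noteq> 0"
proof
  assume 0: "bump_laplace \<sigma> n \<xi> = 0"
  let ?f = "\<lambda>t. exp (- (Complex \<sigma> \<xi> * complex_of_real t)) * complex_of_real (bump (real n * t))"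
  have bc: "continuous_on UNIV (\<lambda>t. bump (real n * t))"
    by (intro continuous_at_imp_continuous_on ballI smooth_fun_isCont)
      (use smooth_fun_affine[OF smooth_bump, of "real n" 0] in simp)
  have supp: "0 < t" "t < 1 / real n" if "bump (real n * t) \<noteq> 0" for t
    using that bump_zero[of "real n * t"] n by (auto simp: zero_less_mult_iff less_divide_eq mult.commute)
  have int: "integrable lborel ?f"
  proof (rule integrable_continuous_compact_support[where R = 1])
    show "continuous_on UNIV ?f" by (intro continuous_intros bc)
    fix t :: real assume "\<bar>t\<bar> > 1"
    moreover have "1 / real n \<le> 1" using n by simp
    ultimately have "bump (real n * t) = 0" using supp[of t] by force
    then show "?f t = 0" by simp
  qed
  have Re: "Re (?f t) = exp (- \<sigma> * t) * cos (\<xi> * t) * bump (real n * t)" for t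
    by (simp add: exp_Complex)
  have pos: "Re (?f t) > 0" if t: "0 < t" "t < 1 / real n" for t
  proof -
    have nt: "real n * t < 1" using t n by (simp add: less_divide_eq mult.commute)
    have "\<bar>\<xi> * t\<bar> \<le> real n * t" using n t by (simp add: abs_mult mult_right_mono)
    then have "\<bar>\<xi> * t\<bar> < pi / 2" using nt pi_gt3 by linarith
    then have "cos (\<xi> * t) > 0" by (intro cos_gt_zero_pi) auto
    moreover have "bump (real n * t) > 0" using t n nt by (intro bump_pos) auto
    ultimately show ?thesis unfolding Re by simp
  qed
  have nonneg: "Re (?f t) \<ge> 0" for t
    using pos[of t] supp[of t] Re[of t] by (cases "bump (real n * t) = 0") auto
  have "(\<integral>t. Re (?f t) \<partial>lborel) = 0"
    using 0 integral_Re[OF int] by (simp add: bump_laplace_def)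
  then have "AE t in lborel. Re (?f t) = 0"
    using integral_nonneg_eq_0_iff_AE[OF integrable_Re[OF int]] nonneg by simp
  then have "AE t in lborel. t \<notin> {0<..<1 / real n}"
    by eventually_elim (use pos in fastforce)
  then have "emeasure lborel {0<..<1 / real n} = 0"
    by (subst (asm) AE_iff_measurable[of "{0<..<1 / real n}"]) auto
  then show False using n by simp
qed

text \<open>For fixed \<open>x\<close> and \<open>n\<close> the Fourier argument gives an equation
  outside a null set that depends on them. Restricting \<open>x\<close> to a countable
  \<open>D\<close> whose closure contains almost all values of \<open>g\<close> leaves a single null
  set. Off it, \<open>n\<close> is taken beyond |\<xi>| so that the bump transform can be divided
  out; then \<open>g \<xi>\<close> is orthogonal to \<open>D\<close> and lies in its closure, hence
  is orthogonal to itself.\<close>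

lemma zero_if_pairings_zero:
  assumes g: "strongly_measurable g"
    and int: "\<And>\<phi>. test_fun \<phi> \<Longrightarrow> integrable lebesgue (\<lambda>\<xi>. cinner J (g \<xi>) (fourier_laplace J \<sigma> \<phi> \<xi>))"
    and zero: "\<And>\<phi>. test_fun \<phi> \<Longrightarrow> (CLINT \<xi>|lebesgue. cinner J (g \<xi>) (fourier_laplace J \<sigma> \<phi> \<xi>)) = 0"
  shows "AE \<xi> in lebesgue. g \<xi> = 0"
proof -
  obtain D where D: "countable D" "AE t in lebesgue. g t \<in> closure D"
    using strongly_measurable_imp_separable[OF g] by metis
  have pair: "cinner J (g \<xi>) (fourier_laplace J \<sigma> (\<lambda>t. bump (real n * (t - a)) *\<^sub>R x) \<xi>)
      = complex_of_real (exp (- \<sigma> * a)) * (cnj (bump_laplace \<sigma> n \<xi>) * cinner J (g \<xi>) x * iexp (a * \<xi>))"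
    if "n \<ge> 1" for n a x \<xi>
    unfolding fourier_laplace_bump[OF that] cinner_simps complex_cnj_mult cnj_exp_Complex
    by (simp add: mult.commute mult.left_commute)
  have "AE \<xi> in lebesgue. cnj (bump_laplace \<sigma> n \<xi>) * cinner J (g \<xi>) x = 0" if n: "n \<ge> 1" for n x
  proof (rule fourier_zero_imp_zero)
    show "integrable lebesgue (\<lambda>\<xi>. cnj (bump_laplace \<sigma> n \<xi>) * cinner J (g \<xi>) x)"
      using int[OF test_fun_bump[OF n, of 0 x]] unfolding pair[OF n] by simp
    fix a
    have "complex_of_real (exp (- \<sigma> * a)) * (CLINT \<xi>|lebesgue. cnj (bump_laplace \<sigma> n \<xi>) * cinner J (g \<xi>) x * iexp (a * \<xi>)) = 0"
      using zero[OF test_fun_bump[OF n, of a x]] unfolding pair[OF n] integral_mult_right_zero .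
    then show "(CLINT \<xi>|lebesgue. cnj (bump_laplace \<sigma> n \<xi>) * cinner J (g \<xi>) x * iexp (a * \<xi>)) = 0" by simp
  qed
  then have "AE \<xi> in lebesgue. \<forall>n\<in>{1..}. cnj (bump_laplace \<sigma> n \<xi>) * cinner J (g \<xi>) x = 0" for x
    by (subst AE_ball_countable) auto
  then have "AE \<xi> in lebesgue. \<forall>x\<in>D. \<forall>n\<in>{1..}. cnj (bump_laplace \<sigma> n \<xi>) * cinner J (g \<xi>) x = 0"
    by (subst AE_ball_countable[OF D(1)]) auto
  with D(2) show ?thesis
  proof eventually_elim
    case (elim \<xi>)
    obtain m :: nat where "\<bar>\<xi>\<bar> \<le> real m" using real_arch_simple by blast
    then have m: "\<bar>\<xi>\<bar> \<le> real (Suc m)" by simp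
    have "bump_laplace \<sigma> (Suc m) \<xi> \<noteq> 0" using m by (intro bump_laplace_nonzero) auto
    then have "cinner J (g \<xi>) x = 0" if "x \<in> D" for x
      using elim(2)[rule_format, OF that, of "Suc m"] by simp
    then have "D \<subseteq> {x. inner (g \<xi>) x = 0}" by (auto simp flip: Re_cinner)
    moreover have "closed {x. inner (g \<xi>) x = 0}"
      by (intro closed_Collect_eq continuous_intros)
    ultimately have "inner (g \<xi>) (g \<xi>) = 0" using elim(1) closure_minimal by blast
    then show ?case by simp
  qed
qed

end

section \<open>The spaces of the scale as copies of the square-integrable functions\<close>

lemma norm_weight: "norm (weight \<rho> \<gamma> t) = norm (Complex \<rho> t) powr \<gamma>"
  by (simp add: weight_def norm_powr_real_powr')

lemma weight_add: "weight \<rho> a t * weight \<rho> b t = weight \<rho> (a + b) t"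
  by (simp add: weight_def powr_add)

lemma weight_0: "\<rho> \<noteq> 0 \<Longrightarrow> weight \<rho> 0 t = 1"
  by (simp add: weight_def complex_eq_iff)

lemma weight_nonzero: "\<rho> \<noteq> 0 \<Longrightarrow> weight \<rho> \<gamma> t \<noteq> 0"
  by (auto simp: weight_def complex_eq_iff[of "Complex \<rho> t"])

text \<open>For positive \<rho> the base \<rho> + i t stays in the right half-plane, away from the
  branch cut of the principal power.\<close>

lemma continuous_on_weight: "\<rho> > 0 \<Longrightarrow> continuous_on S (weight \<rho> \<gamma>)"
proof -
  assume "\<rho> > 0"
  moreover have "weight \<rho> \<gamma> = (\<lambda>t. (complex_of_real \<rho> + \<i> * complex_of_real t) powr complex_of_real \<gamma>)"
    by (simp add: weight_def fun_eq_iff complex_eq_iff Complex_eq)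
  ultimately show ?thesis by (auto intro!: continuous_intros simp: complex_eq_iff)
qed

lemma strongly_measurable_continuous_on:
  "continuous_on UNIV f \<Longrightarrow> strongly_measurable (f :: real \<Rightarrow> 'a::real_normed_vector)"
  by (rule strongly_measurable_continuous) (simp add: continuous_on_eq_continuous_at)

context complex_hilbert
begin

lemma strongly_measurable_scaleJ_weight:
  "\<rho> > 0 \<Longrightarrow> strongly_measurable h \<Longrightarrow> strongly_measurable (\<lambda>t. scaleJ J (weight \<rho> \<gamma> t) (h t))"
  by (rule strongly_measurable_compose2[OF tendsto_scaleJ])
    (auto intro: strongly_measurable_continuous_on continuous_on_weight)

lemma borel_measurable_cinner_fourier_laplace:
  assumes "strongly_measurable g" "test_fun \<phi>"
  shows "(\<lambda>\<xi>. cinner J (g \<xi>) (fourier_laplace J \<sigma> \<phi> \<xi>)) \<in> borel_measurable lebesgue"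
  by (rule strongly_measurable_imp_measurable, rule strongly_measurable_compose2[OF tendsto_cinner])
    (auto intro: assms strongly_measurable_continuous_on continuous_on_fourier_laplace)

lemma dist_of_cong_AE:
  assumes "strongly_measurable g" "AE t in lebesgue. g t = g' t"
  shows "dist_of J \<rho> g = dist_of J \<rho> g'"
proof (rule ext)
  fix \<phi>
  have "strongly_measurable g'" using assms by (rule strongly_measurable_cong_AE)
  then have "(CLINT t|lebesgue. cinner J (g t) (fourier_laplace J (- \<rho>) \<phi> t))
      = (CLINT t|lebesgue. cinner J (g' t) (fourier_laplace J (- \<rho>) \<phi> t))" if "test_fun \<phi>"
    using assms that by (intro integral_cong_AE borel_measurable_cinner_fourier_laplace) auto
  then show "dist_of J \<rho> g \<phi> = dist_of J \<rho> g' \<phi>" by (simp add: dist_of_def)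
qed

text \<open>\<open>realize \<rho> \<beta>\<close> is the unitary \<open>L\<^sup>2 \<rightarrow> H\<^sup>\<beta>\<^sub>\<rho>\<close>, up to equality almost everywhere; conjugated by it,
  fractional derivatives become the identity.\<close>

definition realize :: "real \<Rightarrow> real \<Rightarrow> (real \<Rightarrow> 'h) \<Rightarrow> 'h distr" where
  "realize \<rho> \<beta> h = dist_of J \<rho> (\<lambda>t. scaleJ J (weight \<rho> (- \<beta>) t) (h t))"

lemma scaleJ_weight_cancel:
  "\<rho> > 0 \<Longrightarrow> scaleJ J (weight \<rho> a t) (scaleJ J (weight \<rho> (- a) t) x) = x"
  "\<rho> > 0 \<Longrightarrow> scaleJ J (weight \<rho> (- a) t) (scaleJ J (weight \<rho> a t) x) = x"
  by (simp_all add: weight_add weight_0)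

lemma Hsp_imp_L2:
  assumes "\<rho> > 0" "g \<in> Hsp J \<rho> \<gamma>"
  shows "(\<lambda>t. scaleJ J (weight \<rho> \<gamma> t) (g t)) \<in> L2"
  using assms by (auto simp: Hsp_def L2_iff_nn_integral loc_bochner_integrable_def
      intro: strongly_measurable_scaleJ_weight simp del: norm_scaleJ)

text \<open>Only local integrability needs an argument: the inverse weight is bounded by some
  \<open>B\<close> on a compact interval, and B x \<le> B^2 + x^2 reduces the claim to square
  integrability of \<open>h\<close>.\<close>

lemma L2_imp_Hsp:
  assumes \<rho>: "\<rho> > 0" and h: "h \<in> L2"
  shows "(\<lambda>t. scaleJ J (weight \<rho> (- \<gamma>) t) (h t)) \<in> Hsp J \<rho> \<gamma>"
proof -
  let ?g = "\<lambda>t. scaleJ J (weight \<rho> (- \<gamma>) t) (h t)"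
  have sm: "strongly_measurable h" using h by (simp add: L2_def)
  have g: "strongly_measurable ?g" by (intro strongly_measurable_scaleJ_weight \<rho> sm)
  have fin: "(\<integral>\<^sup>+t. ennreal ((norm (h t))\<^sup>2) \<partial>lebesgue) < \<infinity>" using h by (simp add: L2_iff_nn_integral)
  have "(\<integral>\<^sup>+t \<in> {a..b}. ennreal (norm (?g t)) \<partial>lebesgue) < \<infinity>" for a b
  proof -
    have "bounded (weight \<rho> (- \<gamma>) ` {a..b})"
      by (intro compact_imp_bounded compact_continuous_image continuous_on_weight \<rho> compact_Icc)
    then obtain B where B: "B > 0" "\<And>t. t \<in> {a..b} \<Longrightarrow> norm (weight \<rho> (- \<gamma>) t) \<le> B"
      unfolding bounded_pos by auto
    have "norm (?g t) \<le> B\<^sup>2 + (norm (h t))\<^sup>2" if "t \<in> {a..b}" for t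
    proof -
      have "norm (?g t) \<le> B * norm (h t)" using B(2)[OF that] by (simp add: mult_right_mono)
      also have "\<dots> \<le> B\<^sup>2 + (norm (h t))\<^sup>2"
        using sum_squares_bound[of B "norm (h t)"] mult_nonneg_nonneg[OF less_imp_le[OF B(1)] norm_ge_zero[of "h t"]]
        by linarith
      finally show ?thesis .
    qed
    then have "(\<integral>\<^sup>+t \<in> {a..b}. ennreal (norm (?g t)) \<partial>lebesgue)
        \<le> (\<integral>\<^sup>+t. ennreal (B\<^sup>2) * indicator {a..b} t + ennreal ((norm (h t))\<^sup>2) \<partial>lebesgue)"
      by (intro nn_integral_mono) (auto simp: indicator_def ennreal_plus[symmetric] simp del: ennreal_plus norm_scaleJ)
    also have "\<dots> = ennreal (B\<^sup>2) * emeasure lebesgue {a..b} + (\<integral>\<^sup>+t. ennreal ((norm (h t))\<^sup>2) \<partial>lebesgue)"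
    proof -
      have "(\<lambda>t. ennreal (B\<^sup>2) * indicator {a..b} t) \<in> borel_measurable lebesgue"
        by (intro borel_measurable_times_ennreal borel_measurable_const borel_measurable_indicator
            sets_completionI_sets) auto
      then show ?thesis
        using borel_measurable_norm_strong[OF sm] by (subst nn_integral_add) (auto simp: nn_integral_cmult_indicator)
    qed
    also have "\<dots> < \<infinity>" using fin by (simp add: ennreal_mult_less_top emeasure_lborel_Icc_eq)
    finally show ?thesis .
  qed
  moreover have "(\<integral>\<^sup>+t. ennreal ((norm (scaleJ J (weight \<rho> \<gamma> t) (?g t)))\<^sup>2) \<partial>lebesgue) < \<infinity>"
    using fin by (simp only: scaleJ_weight_cancel[OF \<rho>])
  ultimately show ?thesis using g by (simp only: Hsp_def loc_bochner_integrable_def mem_Collect_eq) blast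
qed

lemma Hrho_eq: "\<rho> > 0 \<Longrightarrow> Hrho J \<rho> \<beta> = realize \<rho> \<beta> ` L2"
proof (intro set_eqI iffI)
  fix T assume \<rho>: "\<rho> > 0" and "T \<in> Hrho J \<rho> \<beta>"
  then obtain g where g: "g \<in> Hsp J \<rho> \<beta>" "T = dist_of J \<rho> g" by (auto simp: Hrho_def)
  then have "T = realize \<rho> \<beta> (\<lambda>t. scaleJ J (weight \<rho> \<beta> t) (g t))"
    unfolding realize_def by (simp only: scaleJ_weight_cancel[OF \<rho>])
  then show "T \<in> realize \<rho> \<beta> ` L2" using Hsp_imp_L2[OF \<rho> g(1)] by blast
next
  fix T assume "\<rho> > 0" and "T \<in> realize \<rho> \<beta> ` L2"
  then show "T \<in> Hrho J \<rho> \<beta>" using L2_imp_Hsp by (auto simp: realize_def Hrho_def)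
qed

text \<open>Stated for both signs of the weight: the sign + concerns test functions as elements of
  the space, the sign - their role as partners in the pairing. The symbols \<rho> + i t and \<sigma>
  + i t have the same modulus.\<close>

lemma weighted_fourier_laplace_L2:
  assumes \<rho>: "\<rho> > 0" and \<phi>: "test_fun \<phi>" and \<sigma>: "\<bar>\<sigma>\<bar> = \<rho>"
  shows "(\<lambda>t. scaleJ J (weight \<rho> \<gamma> t) (fourier_laplace J \<sigma> \<phi> t)) \<in> L2"
proof -
  have \<sigma>0: "\<sigma> \<noteq> 0" using \<rho> \<sigma> by auto
  have cm: "norm (Complex \<sigma> t) = norm (Complex \<rho> t)" for t using \<sigma> by (auto simp: cmod_def)
  obtain M where M: "M \<ge> 0" "\<And>\<xi>. norm (Complex \<sigma> \<xi>) powr \<gamma> * norm (fourier_laplace J \<sigma> \<phi> \<xi>) \<le> M / (1 + \<xi>\<^sup>2)"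
    using fourier_laplace_weighted_decay[OF \<phi> \<sigma>0] by blast
  have sm: "strongly_measurable (\<lambda>t. scaleJ J (weight \<rho> \<gamma> t) (fourier_laplace J \<sigma> \<phi> t))"
    by (intro strongly_measurable_scaleJ_weight \<rho> strongly_measurable_continuous_on continuous_on_fourier_laplace \<phi>)
  have "integrable lebesgue (\<lambda>t. (norm (scaleJ J (weight \<rho> \<gamma> t) (fourier_laplace J \<sigma> \<phi> t)))\<^sup>2)"
  proof (rule Bochner_Integration.integrable_bound)
    have "integrable lborel (\<lambda>t::real. M\<^sup>2 * (1 / (1 + t\<^sup>2)))"
      by (intro integrable_mult_right integrable_inverse_one_plus_square)
    then show "integrable lebesgue (\<lambda>t::real. M\<^sup>2 * (1 / (1 + t\<^sup>2)))"
      by (subst integrable_completion) auto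
    show "(\<lambda>t. (norm (scaleJ J (weight \<rho> \<gamma> t) (fourier_laplace J \<sigma> \<phi> t)))\<^sup>2) \<in> borel_measurable lebesgue"
      by (intro borel_measurable_power borel_measurable_norm_strong sm)
    have "(norm (scaleJ J (weight \<rho> \<gamma> t) (fourier_laplace J \<sigma> \<phi> t)))\<^sup>2 \<le> M\<^sup>2 * (1 / (1 + t\<^sup>2))" for t
    proof -
      have "(norm (scaleJ J (weight \<rho> \<gamma> t) (fourier_laplace J \<sigma> \<phi> t)))\<^sup>2 \<le> (M / (1 + t\<^sup>2))\<^sup>2"
        using M(2)[of t] by (intro power_mono) (auto simp: norm_weight cm)
      also have "\<dots> = M\<^sup>2 * (1 / (1 + t\<^sup>2)) * (1 / (1 + t\<^sup>2))"
        by (simp add: power2_eq_square)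
      also have "\<dots> \<le> M\<^sup>2 * (1 / (1 + t\<^sup>2)) * 1"
        by (intro mult_left_mono divide_le_eq_1_pos[THEN iffD2]) (auto simp: add_pos_nonneg)
      finally show ?thesis by simp
    qed
    then show "AE t in lebesgue. norm ((norm (scaleJ J (weight \<rho> \<gamma> t) (fourier_laplace J \<sigma> \<phi> t)))\<^sup>2)
        \<le> norm (M\<^sup>2 * (1 / (1 + t\<^sup>2)))" by (simp del: norm_scaleJ)
  qed
  then show ?thesis using sm by (simp add: L2_def del: norm_scaleJ)
qed

section \<open>Pairings, norms and derivatives in terms of the realization\<close>

lemma integrable_cinner_L2:
  assumes "h \<in> L2" "k \<in> L2"
  shows "integrable lebesgue (\<lambda>t. cinner J (h t) (k t))"
proof (rule Bochner_Integration.integrable_bound)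
  show "integrable lebesgue (\<lambda>t. (norm (h t))\<^sup>2 + (norm (k t))\<^sup>2)"
    using assms by (simp add: L2_def)
  show "(\<lambda>t. cinner J (h t) (k t)) \<in> borel_measurable lebesgue"
    by (rule strongly_measurable_imp_measurable, rule strongly_measurable_compose2[OF tendsto_cinner])
      (use assms in \<open>auto simp: L2_def\<close>)
  have "norm (cinner J (h t) (k t)) \<le> (norm (h t))\<^sup>2 + (norm (k t))\<^sup>2" for t
    using norm_cinner_le[of "h t" "k t"] sum_squares_bound[of "norm (h t)" "norm (k t)"] by simp
  then show "AE t in lebesgue. norm (cinner J (h t) (k t)) \<le> norm ((norm (h t))\<^sup>2 + (norm (k t))\<^sup>2)"
    by simp
qed

text \<open>In the estimate of the modulus the weight is shifted from \<open>h\<close> to the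
  transform of \<open>\<phi>\<close>, whose decay absorbs any power.\<close>

lemma pairing_integrable:
  assumes \<rho>: "\<rho> > 0" and h: "h \<in> L2" and \<phi>: "test_fun \<phi>"
  shows "integrable lebesgue (\<lambda>t. cinner J (scaleJ J (weight \<rho> (- \<beta>) t) (h t)) (fourier_laplace J (- \<rho>) \<phi> t))"
proof (rule Bochner_Integration.integrable_bound)
  let ?k = "\<lambda>t. scaleJ J (weight \<rho> (- \<beta>) t) (fourier_laplace J (- \<rho>) \<phi> t)"
  have k: "?k \<in> L2" using \<rho> \<phi> by (intro weighted_fourier_laplace_L2) auto
  show "integrable lebesgue (\<lambda>t. (norm (h t))\<^sup>2 + (norm (?k t))\<^sup>2)"
    using h k by (simp add: L2_def del: norm_scaleJ)
  show "(\<lambda>t. cinner J (scaleJ J (weight \<rho> (- \<beta>) t) (h t)) (fourier_laplace J (- \<rho>) \<phi> t)) \<in> borel_measurable lebesgue"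
    using h by (intro borel_measurable_cinner_fourier_laplace strongly_measurable_scaleJ_weight \<rho> \<phi>) (simp add: L2_def)
  have "norm (cinner J (scaleJ J (weight \<rho> (- \<beta>) t) (h t)) (fourier_laplace J (- \<rho>) \<phi> t))
      \<le> (norm (h t))\<^sup>2 + (norm (?k t))\<^sup>2" for t
    using norm_cinner_le[of "scaleJ J (weight \<rho> (- \<beta>) t) (h t)" "fourier_laplace J (- \<rho>) \<phi> t"]
      sum_squares_bound[of "norm (h t)" "norm (?k t)"] by (simp add: ac_simps)
  then show "AE t in lebesgue. norm (cinner J (scaleJ J (weight \<rho> (- \<beta>) t) (h t)) (fourier_laplace J (- \<rho>) \<phi> t))
      \<le> norm ((norm (h t))\<^sup>2 + (norm (?k t))\<^sup>2)" by (simp del: norm_scaleJ cinner_simps)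
qed

lemma dminus_realize:
  assumes \<rho>: "\<rho> > 0" and "h \<in> L2" "k \<in> L2"
  shows "dminus (realize \<rho> \<beta> h) (realize \<rho> \<beta> k) = realize \<rho> \<beta> (\<lambda>t. h t - k t)"
  using pairing_integrable[OF \<rho> assms(2)] pairing_integrable[OF \<rho> assms(3)]
  by (auto simp: dminus_def realize_def dist_of_def fun_eq_iff cinner_simps(2) simp del: cinner_simps(9))

text \<open>The exponents are allowed to differ because \<open>rep\<close> may pick its function
  from any space of the scale; this is what identifies that function in
  \<open>rep_realize\<close>.\<close>

lemma realize_inj:
  assumes \<rho>: "\<rho> > 0" and h: "h \<in> L2" and k: "k \<in> L2" and eq: "realize \<rho> \<beta> h = realize \<rho> \<gamma> k"
  shows "AE t in lebesgue. scaleJ J (weight \<rho> (- \<beta>) t) (h t) = scaleJ J (weight \<rho> (- \<gamma>) t) (k t)"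
proof -
  let ?h = "\<lambda>t. scaleJ J (weight \<rho> (- \<beta>) t) (h t)" and ?k = "\<lambda>t. scaleJ J (weight \<rho> (- \<gamma>) t) (k t)"
  have int: "integrable lebesgue (\<lambda>t. cinner J (?h t) (fourier_laplace J (- \<rho>) \<phi> t))"
    "integrable lebesgue (\<lambda>t. cinner J (?k t) (fourier_laplace J (- \<rho>) \<phi> t))" if "test_fun \<phi>" for \<phi>
    using pairing_integrable[OF \<rho> h that] pairing_integrable[OF \<rho> k that] by blast+
  have "AE t in lebesgue. ?h t - ?k t = 0"
  proof (rule zero_if_pairings_zero[where \<sigma> = "- \<rho>"])
    show "strongly_measurable (\<lambda>t. ?h t - ?k t)"
      using h k by (intro strongly_measurable_diff strongly_measurable_scaleJ_weight \<rho>) (auto simp: L2_def)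
    fix \<phi> :: "real \<Rightarrow> 'h" assume \<phi>: "test_fun \<phi>"
    show "integrable lebesgue (\<lambda>t. cinner J (?h t - ?k t) (fourier_laplace J (- \<rho>) \<phi> t))"
      using int[OF \<phi>] by (simp only: cinner_simps(2) Bochner_Integration.integrable_diff)
    have "realize \<rho> \<beta> h \<phi> = realize \<rho> \<gamma> k \<phi>" using eq by simp
    then show "(CLINT t|lebesgue. cinner J (?h t - ?k t) (fourier_laplace J (- \<rho>) \<phi> t)) = 0"
      using int[OF \<phi>] \<phi> by (simp only: cinner_simps(2) Bochner_Integration.integral_diff realize_def dist_of_def if_True) simp
  qed
  then show ?thesis by simp
qed

lemma realize_eq_iff:
  assumes \<rho>: "\<rho> > 0" and h: "h \<in> L2" and k: "k \<in> L2"
  shows "realize \<rho> \<beta> h = realize \<rho> \<beta> k \<longleftrightarrow> (AE t in lebesgue. h t = k t)"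
proof
  assume "realize \<rho> \<beta> h = realize \<rho> \<beta> k"
  from realize_inj[OF \<rho> h k this] show "AE t in lebesgue. h t = k t"
    by eventually_elim (metis scaleJ_weight_cancel(1)[OF \<rho>])
next
  assume "AE t in lebesgue. h t = k t"
  then show "realize \<rho> \<beta> h = realize \<rho> \<beta> k"
    unfolding realize_def using h
    by (intro dist_of_cong_AE strongly_measurable_scaleJ_weight \<rho>) (auto simp: L2_def)
qed

lemma rep_realize:
  assumes \<rho>: "\<rho> > 0" and h: "h \<in> L2"
  shows "strongly_measurable (rep J \<rho> (realize \<rho> \<beta> h))"
    and "AE t in lebesgue. rep J \<rho> (realize \<rho> \<beta> h) t = scaleJ J (weight \<rho> (- \<beta>) t) (h t)"
proof -
  let ?g = "rep J \<rho> (realize \<rho> \<beta> h)"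
  have "\<exists>g. (\<exists>\<gamma>. g \<in> Hsp J \<rho> \<gamma>) \<and> dist_of J \<rho> g = realize \<rho> \<beta> h"
    using L2_imp_Hsp[OF \<rho> h] by (auto simp: realize_def)
  from someI_ex[OF this] obtain \<gamma> where \<gamma>: "?g \<in> Hsp J \<rho> \<gamma>" "dist_of J \<rho> ?g = realize \<rho> \<beta> h"
    unfolding rep_def by blast
  show sm: "strongly_measurable ?g" using \<gamma>(1) by (simp add: Hsp_def loc_bochner_integrable_def)
  let ?k = "\<lambda>t. scaleJ J (weight \<rho> \<gamma> t) (?g t)"
  have "realize \<rho> \<gamma> ?k = realize \<rho> \<beta> h"
    using \<gamma>(2) unfolding realize_def[of \<rho> \<gamma>] by (simp only: scaleJ_weight_cancel[OF \<rho>])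
  from realize_inj[OF \<rho> Hsp_imp_L2[OF \<rho> \<gamma>(1)] h this]
  show "AE t in lebesgue. ?g t = scaleJ J (weight \<rho> (- \<beta>) t) (h t)"
    by (simp only: scaleJ_weight_cancel[OF \<rho>])
qed

lemma hnorm_realize:
  assumes \<rho>: "\<rho> > 0" and h: "h \<in> L2"
  shows "hnorm J \<rho> \<beta> (realize \<rho> \<beta> h) = L2norm h"
proof -
  have "(\<integral>\<^sup>+t. ennreal ((norm (scaleJ J (weight \<rho> \<beta> t) (rep J \<rho> (realize \<rho> \<beta> h) t)))\<^sup>2) \<partial>lebesgue)
      = (\<integral>\<^sup>+t. ennreal ((norm (h t))\<^sup>2) \<partial>lebesgue)"
  proof (rule nn_integral_cong_AE)
    show "AE t in lebesgue. ennreal ((norm (scaleJ J (weight \<rho> \<beta> t) (rep J \<rho> (realize \<rho> \<beta> h) t)))\<^sup>2)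
        = ennreal ((norm (h t))\<^sup>2)"
      using rep_realize(2)[OF \<rho> h, of \<beta>] by eventually_elim (simp only: scaleJ_weight_cancel[OF \<rho>])
  qed
  then show ?thesis by (simp add: hnorm_def nn_integral_L2[OF h] del: norm_scaleJ)
qed

lemma frac_deriv_realize:
  assumes \<rho>: "\<rho> > 0" and h: "h \<in> L2"
  shows "frac_deriv J \<rho> \<alpha> (realize \<rho> \<beta> h) = realize \<rho> (\<beta> - \<alpha>) h"
  unfolding frac_deriv_def realize_def[of \<rho> "\<beta> - \<alpha>"]
proof (rule dist_of_cong_AE)
  show "strongly_measurable (\<lambda>t. scaleJ J (weight \<rho> \<alpha> t) (rep J \<rho> (realize \<rho> \<beta> h) t))"
    by (intro strongly_measurable_scaleJ_weight \<rho> rep_realize h)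
  show "AE t in lebesgue. scaleJ J (weight \<rho> \<alpha> t) (rep J \<rho> (realize \<rho> \<beta> h) t) = scaleJ J (weight \<rho> (- (\<beta> - \<alpha>)) t) (h t)"
    using rep_realize(2)[OF \<rho> h, of \<beta>] by eventually_elim (simp add: weight_add)
qed

lemma hnorm_dminus_realize:
  assumes "\<rho> > 0" "h \<in> L2" "k \<in> L2"
  shows "hnorm J \<rho> \<beta> (dminus (realize \<rho> \<beta> h) (realize \<rho> \<beta> k)) = L2norm (\<lambda>t. h t - k t)"
  using assms by (simp add: dminus_realize hnorm_realize L2_diff)

section \<open>Density of the test functions\<close>

lemma fourier_laplace_scaleJ:
  assumes \<phi>: "test_fun \<phi>"
  shows "fourier_laplace J \<sigma> (\<lambda>t. scaleJ J c (\<phi> t)) \<xi> = scaleJ J c (fourier_laplace J \<sigma> \<phi> \<xi>)"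
proof (rule cinner_eqI)
  fix x
  have "(CLINT t|lborel. exp (- (Complex \<sigma> \<xi> * complex_of_real t)) * cinner J (scaleJ J c (\<phi> t)) x)
      = (CLINT t|lborel. c * (exp (- (Complex \<sigma> \<xi> * complex_of_real t)) * cinner J (\<phi> t) x))"
    by (simp add: mult.left_commute)
  also have "\<dots> = c * (CLINT t|lborel. exp (- (Complex \<sigma> \<xi> * complex_of_real t)) * cinner J (\<phi> t) x)"
    by (rule integral_mult_right_zero)
  finally show "cinner J (fourier_laplace J \<sigma> (\<lambda>t. scaleJ J c (\<phi> t)) \<xi>) x
      = cinner J (scaleJ J c (fourier_laplace J \<sigma> \<phi> \<xi>)) x"
    unfolding cinner_fourier_laplace[OF test_fun_linear[OF bounded_linear_scaleJ \<phi>]]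
    by (simp add: cinner_fourier_laplace[OF \<phi>])
qed

lemma fourier_laplace_add:
  assumes \<phi>: "test_fun \<phi>" and \<psi>: "test_fun \<psi>"
  shows "fourier_laplace J \<sigma> (\<lambda>t. \<phi> t + \<psi> t) \<xi> = fourier_laplace J \<sigma> \<phi> \<xi> + fourier_laplace J \<sigma> \<psi> \<xi>"
proof (rule cinner_eqI)
  fix x
  have int: "integrable lborel (\<lambda>t. exp (- (Complex \<sigma> \<xi> * complex_of_real t)) * cinner J (\<phi> t) x)"
    if "test_fun \<phi>" for \<phi>
    by (intro test_fun_integrand_integrable that continuous_intros)
  show "cinner J (fourier_laplace J \<sigma> (\<lambda>t. \<phi> t + \<psi> t) \<xi>) x
      = cinner J (fourier_laplace J \<sigma> \<phi> \<xi> + fourier_laplace J \<sigma> \<psi> \<xi>) x"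
    using int[OF \<phi>] int[OF \<psi>]
    by (simp add: cinner_fourier_laplace test_fun_add \<phi> \<psi> distrib_left add_divide_distrib)
qed

text \<open>By the projection criterion it is enough that a function orthogonal to all weighted
  transforms vanishes, and this is \<open>zero_if_pairings_zero\<close> once the weight has been
  moved to the other factor.\<close>

lemma test_dist_dense:
  assumes \<rho>: "\<rho> > 0" and h: "h \<in> L2" and "e > 0"
  shows "\<exists>\<psi> v. test_fun \<psi> \<and> v \<in> L2 \<and> realize \<rho> \<beta> v = test_dist J \<rho> \<psi> \<and> L2norm (\<lambda>t. h t - v t) < e"
proof -
  define v where "v \<psi> = (\<lambda>t. scaleJ J (weight \<rho> \<beta> t) (fourier_laplace J \<rho> \<psi> t))" for \<psi>
  have vL: "v \<psi> \<in> L2" if "test_fun \<psi>" for \<psi>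
    unfolding v_def using \<rho> that by (intro weighted_fourier_laplace_L2) auto
  have v_scaleJ: "v (\<lambda>t. scaleJ J c (\<psi> t)) = (\<lambda>t. scaleJ J c (v \<psi> t))" if "test_fun \<psi>" for \<psi> c
    by (simp add: v_def fourier_laplace_scaleJ[OF that] mult.commute)
  have "\<exists>w\<in>v ` Collect test_fun. L2norm (\<lambda>t. h t - w t) < e"
  proof (rule L2_dense_if_orthogonal_trivial[OF _ _ _ _ _ h \<open>e > 0\<close>])
    show "v ` Collect test_fun \<subseteq> L2" using vL by auto
    show "v ` Collect test_fun \<noteq> {}" using test_fun_zero by auto
    show "(\<lambda>t. a t + b t) \<in> v ` Collect test_fun" if ab: "a \<in> v ` Collect test_fun" "b \<in> v ` Collect test_fun" for a b
    proof -
      obtain \<phi> \<psi> where "test_fun \<phi>" "test_fun \<psi>" "a = v \<phi>" "b = v \<psi>" using ab by auto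
      then have "(\<lambda>t. a t + b t) = v (\<lambda>t. \<phi> t + \<psi> t)" "test_fun (\<lambda>t. \<phi> t + \<psi> t)"
        by (auto simp: v_def fourier_laplace_add test_fun_add)
      then show ?thesis by blast
    qed
    show "(\<lambda>t. c *\<^sub>R a t) \<in> v ` Collect test_fun" if a: "a \<in> v ` Collect test_fun" for c a
    proof -
      obtain \<phi> where \<phi>: "test_fun \<phi>" "a = v \<phi>" using a by auto
      have "(\<lambda>t. c *\<^sub>R a t) = v (\<lambda>t. scaleJ J (complex_of_real c) (\<phi> t))"
        unfolding v_scaleJ[OF \<phi>(1)] \<phi>(2) by (simp add: scaleJ_def)
      moreover have "test_fun (\<lambda>t. scaleJ J (complex_of_real c) (\<phi> t))"
        by (rule test_fun_linear[OF bounded_linear_scaleJ \<phi>(1)])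
      ultimately show ?thesis by blast
    qed
    fix k :: "real \<Rightarrow> 'h" assume k: "k \<in> L2" and orth: "\<And>w. w \<in> v ` Collect test_fun \<Longrightarrow> L2inner k w = 0"
    \<comment> \<open>Moving the weight from the second argument of the sesquilinear form to the
      first conjugates it; its modulus, and so the vanishing of \<open>k\<close>, is
      unaffected.\<close>
    let ?g = "\<lambda>t. scaleJ J (cnj (weight \<rho> \<beta> t)) (k t)"
    have pair: "cinner J (?g t) (fourier_laplace J \<rho> \<psi> t) = cinner J (k t) (v \<psi> t)" for \<psi> t
      by (simp add: v_def)
    have "AE t in lebesgue. ?g t = 0"
    proof (rule zero_if_pairings_zero[where \<sigma> = \<rho>])
      have c: "continuous_on UNIV (\<lambda>t. cnj (weight \<rho> \<beta> t))" by (intro continuous_intros continuous_on_weight \<rho>)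
      show "strongly_measurable ?g"
        using k by (intro strongly_measurable_compose2[OF tendsto_scaleJ strongly_measurable_continuous_on[OF c]])
          (auto simp: L2_def)
      fix \<psi> :: "real \<Rightarrow> 'h" assume \<psi>: "test_fun \<psi>"
      have int: "integrable lebesgue (\<lambda>t. cinner J (k t) (v \<psi> t))"
        by (intro integrable_cinner_L2 k vL \<psi>)
      then show "integrable lebesgue (\<lambda>t. cinner J (?g t) (fourier_laplace J \<rho> \<psi> t))"
        by (simp only: pair)
      \<comment> \<open>Orthogonality is given for the real inner product only. Testing with i times
        \<open>\<psi>\<close> as well supplies the imaginary part.\<close>
      have \<psi>': "test_fun (\<lambda>t. scaleJ J \<i> (\<psi> t))" by (rule test_fun_linear[OF bounded_linear_scaleJ \<psi>])
      have "Re (CLINT t|lebesgue. cinner J (k t) (v \<psi> t)) = L2inner k (v \<psi>)"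
        using integral_Re[OF int] by (simp add: L2inner_def)
      moreover have "Im (CLINT t|lebesgue. cinner J (k t) (v \<psi> t)) = L2inner k (v (\<lambda>t. scaleJ J \<i> (\<psi> t)))"
      proof -
        have "v (\<lambda>t. scaleJ J \<i> (\<psi> t)) = (\<lambda>t. J (v \<psi> t))"
          unfolding v_scaleJ[OF \<psi>] by (simp add: scaleJ_def)
        then show ?thesis using integral_Im[OF int] by (simp only: L2inner_def) (simp add: cinner_def)
      qed
      ultimately have "(CLINT t|lebesgue. cinner J (k t) (v \<psi> t)) = 0"
        using orth \<psi> \<psi>' by (simp add: complex_eq_iff)
      then show "(CLINT t|lebesgue. cinner J (?g t) (fourier_laplace J \<rho> \<psi> t)) = 0" by (simp only: pair)
    qed
    then have "AE t in lebesgue. k t = 0"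
    proof eventually_elim
      case (elim t)
      then have "norm (?g t) = 0" by (simp only: norm_zero)
      then show ?case using weight_nonzero[of \<rho> \<beta> t] \<rho> by simp
    qed
    then show "L2norm k = 0" using L2norm_eq_0[OF k] by simp
  qed
  then obtain \<psi> where \<psi>: "test_fun \<psi>" "L2norm (\<lambda>t. h t - v \<psi> t) < e" by auto
  moreover have "realize \<rho> \<beta> (v \<psi>) = test_dist J \<rho> \<psi>"
    unfolding realize_def test_dist_def v_def by (simp only: scaleJ_weight_cancel[OF \<rho>])
  ultimately show ?thesis using vL by blast
qed

section \<open>The fixed point argument\<close>

text \<open>Transfers the contraction estimate from the family given by the hypothesis to an
  arbitrary extension: both are Lipschitz and agree on the dense set of test distributions. The
  comparison is made on square-integrable representatives.\<close>

lemma lip_extension_unique: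
  assumes \<rho>: "\<rho> > 0" and G: "lip_extension J \<rho> \<beta> \<gamma> Dom F G" and G': "lip_extension J \<rho> \<beta> \<gamma> Dom F G'"
    and dense: "\<And>\<psi>. test_fun \<psi> \<Longrightarrow> test_dist J \<rho> \<psi> \<in> Dom"
    and u: "u \<in> Hrho J \<rho> \<beta>"
  shows "G u = G' u"
proof -
  obtain L where L: "\<And>f g. f \<in> Hrho J \<rho> \<beta> \<Longrightarrow> g \<in> Hrho J \<rho> \<beta> \<Longrightarrow>
      hnorm J \<rho> \<gamma> (dminus (G f) (G g)) \<le> L * hnorm J \<rho> \<beta> (dminus f g)"
    using G unfolding lip_extension_def by metis
  obtain L' where L': "\<And>f g. f \<in> Hrho J \<rho> \<beta> \<Longrightarrow> g \<in> Hrho J \<rho> \<beta> \<Longrightarrow>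
      hnorm J \<rho> \<gamma> (dminus (G' f) (G' g)) \<le> L' * hnorm J \<rho> \<beta> (dminus f g)"
    using G' unfolding lip_extension_def by metis
  obtain h where h: "h \<in> L2" "u = realize \<rho> \<beta> h" using u Hrho_eq[OF \<rho>] by auto
  have "G u \<in> Hrho J \<rho> \<gamma>" "G' u \<in> Hrho J \<rho> \<gamma>" using G G' u by (auto simp: lip_extension_def)
  then obtain k k' where k: "k \<in> L2" "G u = realize \<rho> \<gamma> k" and k': "k' \<in> L2" "G' u = realize \<rho> \<gamma> k'"
    using Hrho_eq[OF \<rho>] by auto
  have "L2norm (\<lambda>t. k t - k' t) \<le> 0"
  proof (rule field_le_epsilon)
    fix e :: real assume e: "e > 0"
    \<comment> \<open>The constants of the two extensions are not assumed nonnegative, hence the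
      absolute values; the summand 1 keeps the denominator positive.\<close>
    define d where "d = e / (\<bar>L\<bar> + \<bar>L'\<bar> + 1)"
    have d: "d > 0" using e by (simp add: d_def add_nonneg_pos)
    obtain \<psi> v where \<psi>: "test_fun \<psi>" "v \<in> L2" "realize \<rho> \<beta> v = test_dist J \<rho> \<psi>" "L2norm (\<lambda>t. h t - v t) < d"
      using test_dist_dense[OF \<rho> h(1) d] by blast
    let ?w = "realize \<rho> \<beta> v"
    have w: "?w \<in> Hrho J \<rho> \<beta>" using \<psi>(2) Hrho_eq[OF \<rho>] by auto
    have "?w \<in> Dom" using \<psi> dense by simp
    then have eq: "G ?w = G' ?w" using G G' by (simp add: lip_extension_def)
    have "G ?w \<in> Hrho J \<rho> \<gamma>" using G w by (auto simp: lip_extension_def)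
    then obtain j where j: "j \<in> L2" "G ?w = realize \<rho> \<gamma> j" using Hrho_eq[OF \<rho>] by auto
    have "L2norm (\<lambda>t. k t - j t) \<le> L * L2norm (\<lambda>t. h t - v t)"
      using L[OF u w] by (simp only: h(2) k(2)[unfolded h(2)] j(2) hnorm_dminus_realize[OF \<rho>] h(1) k(1) j(1) \<psi>(2))
    also have "\<dots> \<le> \<bar>L\<bar> * d" using \<psi>(4) by (intro mult_mono) auto
    finally have 1: "L2norm (\<lambda>t. k t - j t) \<le> \<bar>L\<bar> * d" .
    have "L2norm (\<lambda>t. k' t - j t) \<le> L' * L2norm (\<lambda>t. h t - v t)"
      using L'[OF u w] by (simp only: h(2) k'(2)[unfolded h(2)] eq[symmetric] j(2) hnorm_dminus_realize[OF \<rho>] h(1) k'(1) j(1) \<psi>(2))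
    also have "\<dots> \<le> \<bar>L'\<bar> * d" using \<psi>(4) by (intro mult_mono) auto
    finally have 2: "L2norm (\<lambda>t. j t - k' t) \<le> \<bar>L'\<bar> * d" using L2norm_commute[of j k'] by simp
    have "L2norm (\<lambda>t. k t - k' t) \<le> \<bar>L\<bar> * d + \<bar>L'\<bar> * d"
      using L2norm_triangle_diff[OF k(1) j(1) k'(1)] 1 2 by linarith
    also have "\<dots> \<le> (\<bar>L\<bar> + \<bar>L'\<bar> + 1) * d" using d by (simp add: algebra_simps)
    also have "\<dots> = e" unfolding d_def by (simp add: add_nonneg_pos less_imp_neq[symmetric])
    finally show "L2norm (\<lambda>t. k t - k' t) \<le> 0 + e" by simp
  qed
  then have "L2norm (\<lambda>t. k t - k' t) = 0" using L2norm_nonneg by (rule antisym)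
  then have "AE t in lebesgue. k t = k' t" using L2norm_eq_0[OF L2_diff[OF k(1) k'(1)]] by simp
  then show ?thesis using realize_eq_iff[OF \<rho> k(1) k'(1)] k k' by simp
qed

text \<open>A real \<open>Sup\<close> is an upper bound only of a set that is bounded above; here
  the constant from \<open>lip_extension\<close> bounds the quotients. At distance zero the quotient
  carries no information and the claim follows from that constant directly.\<close>

lemma lip_norm_bound:
  assumes \<rho>: "\<rho> > 0" and G: "lip_extension J \<rho> \<beta> \<gamma> Dom F G"
    and f: "f \<in> Hrho J \<rho> \<beta>" and g: "g \<in> Hrho J \<rho> \<beta>"
  shows "hnorm J \<rho> \<gamma> (dminus (G f) (G g)) \<le> lip_norm J \<rho> \<beta> \<gamma> G * hnorm J \<rho> \<beta> (dminus f g)"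
proof -
  obtain L where L: "\<And>f g. f \<in> Hrho J \<rho> \<beta> \<Longrightarrow> g \<in> Hrho J \<rho> \<beta> \<Longrightarrow>
      hnorm J \<rho> \<gamma> (dminus (G f) (G g)) \<le> L * hnorm J \<rho> \<beta> (dminus f g)"
    using G unfolding lip_extension_def by metis
  have pos: "hnorm J \<rho> \<beta> (dminus f g) \<ge> 0" for f g by (simp add: hnorm_def)
  have pos': "hnorm J \<rho> \<gamma> (dminus f g) \<ge> 0" for f g by (simp add: hnorm_def)
  show ?thesis
  proof (cases "hnorm J \<rho> \<beta> (dminus f g) = 0")
    case True
    then show ?thesis using L[OF f g] by simp
  next
    case False
    then have pos_fg: "hnorm J \<rho> \<beta> (dminus f g) > 0" using pos[of f g] by simp
    have "f \<noteq> g"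
    proof
      assume "f = g"
      obtain h where "h \<in> L2" "f = realize \<rho> \<beta> h" using f Hrho_eq[OF \<rho>] by auto
      then have "hnorm J \<rho> \<beta> (dminus f g) = L2norm (\<lambda>t. h t - h t)"
        using \<open>f = g\<close> hnorm_dminus_realize[OF \<rho>, of h h] by simp
      then show False using False by (simp add: L2norm_def)
    qed
    let ?P = "{(f, g). f \<in> Hrho J \<rho> \<beta> \<and> g \<in> Hrho J \<rho> \<beta> \<and> f \<noteq> g}"
    let ?r = "\<lambda>(f, g). hnorm J \<rho> \<gamma> (dminus (G f) (G g)) / hnorm J \<rho> \<beta> (dminus f g)"
    have fg: "(f, g) \<in> ?P" using f g \<open>f \<noteq> g\<close> by simp
    have "?r p \<le> \<bar>L\<bar>" if "p \<in> ?P" for p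
    proof -
      obtain a b where p: "p = (a, b)" by fastforce
      have "hnorm J \<rho> \<gamma> (dminus (G a) (G b)) \<le> \<bar>L\<bar> * hnorm J \<rho> \<beta> (dminus a b)"
        using L[of a b] that pos[of a b] mult_right_mono[of L "\<bar>L\<bar>" "hnorm J \<rho> \<beta> (dminus a b)"] p by force
      \<comment> \<open>A vanishing denominator makes the quotient 0 by convention, which is below
        the bound as well.\<close>
      then show ?thesis using pos[of a b] p by (cases "hnorm J \<rho> \<beta> (dminus a b) = 0") (auto simp: divide_le_eq)
    qed
    then have bdd: "bdd_above (?r ` ?P)" by (intro bdd_aboveI2)
    have "?r (f, g) \<le> Sup (?r ` ?P)" using fg bdd by (intro cSup_upper imageI)
    also have "\<dots> = lip_norm J \<rho> \<beta> \<gamma> G" using fg by (auto simp: lip_norm_def Let_def)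
    finally show ?thesis using pos_fg by (simp add: divide_le_eq)
  qed
qed

text \<open>Existence is Banach's theorem for \<open>G\<close> followed by the inverse fractional
  derivative, an isometry, so that the constant \<open>c\<close> survives. Uniqueness is read off
  directly: two solutions at distance \<open>d\<close> satisfy (1 - c) d \<le> 0.\<close>

lemma contraction_unique_solution:
  assumes \<rho>: "\<rho> > 0"
    and G: "G ` Hrho J \<rho> \<beta> \<subseteq> Hrho J \<rho> (\<beta> - \<alpha>)"
    and lip: "\<And>f g. f \<in> Hrho J \<rho> \<beta> \<Longrightarrow> g \<in> Hrho J \<rho> \<beta> \<Longrightarrow>
      hnorm J \<rho> (\<beta> - \<alpha>) (dminus (G f) (G g)) \<le> c * hnorm J \<rho> \<beta> (dminus f g)"
    and c: "c < 1"
  shows "\<exists>!u. u \<in> Hrho J \<rho> \<beta> \<and> frac_deriv J \<rho> \<alpha> u = G u"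
proof -
  let ?M = "Hrho J \<rho> \<beta>"
  define p where "p u = (SOME h. h \<in> L2 \<and> realize \<rho> \<beta> h = u)" for u
  have p: "p u \<in> L2" "realize \<rho> \<beta> (p u) = u" if "u \<in> ?M" for u
  proof -
    have "\<exists>h. h \<in> L2 \<and> realize \<rho> \<beta> h = u" using that Hrho_eq[OF \<rho>] by auto
    from someI_ex[OF this] show "p u \<in> L2" "realize \<rho> \<beta> (p u) = u" unfolding p_def by auto
  qed
  \<comment> \<open>The distance goes through chosen representatives so that the metric axioms are
    inherited from \<open>L2norm\<close>; \<open>d_hnorm\<close> and \<open>d_realize\<close> show
    that the choice does not matter.\<close>
  define d where "d u v = L2norm (\<lambda>t. p u t - p v t)" for u v
  have d_hnorm: "d u v = hnorm J \<rho> \<beta> (dminus u v)" if "u \<in> ?M" "v \<in> ?M" for u v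
    unfolding d_def using hnorm_dminus_realize[OF \<rho> p(1)[OF that(1)] p(1)[OF that(2)], of \<beta>] p(2) that by simp
  have d_realize: "d (realize \<rho> \<beta> h) (realize \<rho> \<beta> k) = L2norm (\<lambda>t. h t - k t)" if "h \<in> L2" "k \<in> L2" for h k
    using d_hnorm[of "realize \<rho> \<beta> h" "realize \<rho> \<beta> k"] that Hrho_eq[OF \<rho>] hnorm_dminus_realize[OF \<rho> that] by simp
  interpret Metric_space ?M d
  proof
    show "0 \<le> d u v" for u v by (simp add: d_def)
    show "d u v = d v u" for u v unfolding d_def by (rule L2norm_commute)
    show "(d u v = 0) = (u = v)" if "u \<in> ?M" "v \<in> ?M" for u v
      using p[OF that(1)] p[OF that(2)] L2norm_eq_0[OF L2_diff[OF p(1)[OF that(1)] p(1)[OF that(2)]]]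
        realize_eq_iff[OF \<rho> p(1)[OF that(1)] p(1)[OF that(2)], of \<beta>] by (simp add: d_def)
    show "d u w \<le> d u v + d v w" if "u \<in> ?M" "v \<in> ?M" "w \<in> ?M" for u v w
      unfolding d_def by (intro L2norm_triangle_diff p that)
  qed
  have complete: mcomplete
    unfolding mcomplete_def
  proof (intro allI impI)
    fix s assume s: "MCauchy s"
    then have sM: "s n \<in> ?M" for n by (auto simp: MCauchy_def)
    have "\<exists>N. \<forall>m\<ge>N. \<forall>n\<ge>N. L2norm (\<lambda>t. p (s m) t - p (s n) t) < e" if "e > 0" for e
      using s that by (auto simp: MCauchy_def d_def)
    from L2_complete[OF p(1)[OF sM] this] obtain g
      where g: "g \<in> L2" "(\<lambda>n. L2norm (\<lambda>t. p (s n) t - g t)) \<longlonglongrightarrow> 0" by blast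
    have gM: "realize \<rho> \<beta> g \<in> ?M" using g Hrho_eq[OF \<rho>] by auto
    have "d (s n) (realize \<rho> \<beta> g) = L2norm (\<lambda>t. p (s n) t - g t)" for n
      using d_realize[OF p(1)[OF sM[of n]] g(1)] p(2)[OF sM[of n]] by simp
    then have "limitin mtopology s (realize \<rho> \<beta> g) sequentially"
      using g(2) gM sM by (simp add: limitin_metric_dist_null)
    then show "\<exists>x. limitin mtopology s x sequentially" by blast
  qed
  \<comment> \<open>\<open>q u\<close> represents \<open>G u\<close> at exponent \<beta> - \<alpha>.
    Realizing the same function at exponent \<beta> inverts the fractional derivative, so fixed
    points of that map are the solutions.\<close>
  define q where "q u = (SOME h. h \<in> L2 \<and> realize \<rho> (\<beta> - \<alpha>) h = G u)" for u
  have q: "q u \<in> L2" "realize \<rho> (\<beta> - \<alpha>) (q u) = G u" if "u \<in> ?M" for u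
  proof -
    have "G u \<in> Hrho J \<rho> (\<beta> - \<alpha>)" using G that by auto
    then have "\<exists>h. h \<in> L2 \<and> realize \<rho> (\<beta> - \<alpha>) h = G u" using Hrho_eq[OF \<rho>] by auto
    from someI_ex[OF this] show "q u \<in> L2" "realize \<rho> (\<beta> - \<alpha>) (q u) = G u" unfolding q_def by auto
  qed
  have "\<exists>u\<in>?M. realize \<rho> \<beta> (q u) = u"
  proof -
    have "realize \<rho> \<beta> (\<lambda>t. 0) \<in> ?M"
      using Hrho_eq[OF \<rho>] L2_scaleR[of _ 0] p by (auto simp: L2_def strongly_measurable_continuous)
    then have "?M \<noteq> {}" by blast
    moreover have "(\<lambda>u. realize \<rho> \<beta> (q u)) \<in> ?M \<rightarrow> ?M" using q(1) Hrho_eq[OF \<rho>] by auto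
    moreover have "d (realize \<rho> \<beta> (q u)) (realize \<rho> \<beta> (q v)) \<le> c * d u v" if uv: "u \<in> ?M" "v \<in> ?M" for u v
    proof -
      have "d (realize \<rho> \<beta> (q u)) (realize \<rho> \<beta> (q v)) = hnorm J \<rho> (\<beta> - \<alpha>) (dminus (G u) (G v))"
        using d_realize[OF q(1)[OF uv(1)] q(1)[OF uv(2)]]
          hnorm_dminus_realize[OF \<rho> q(1)[OF uv(1)] q(1)[OF uv(2)], of "\<beta> - \<alpha>"] q(2) uv by simp
      also have "\<dots> \<le> c * d u v" using lip[OF uv] d_hnorm[OF uv] by simp
      finally show ?thesis .
    qed
    ultimately show ?thesis using Banach_fixedpoint_thm[OF complete _ _ c, of "\<lambda>u. realize \<rho> \<beta> (q u)"] by metis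
  qed
  then obtain u where u: "u \<in> ?M" "realize \<rho> \<beta> (q u) = u" by blast
  have "frac_deriv J \<rho> \<alpha> u = G u"
    using frac_deriv_realize[OF \<rho> q(1)[OF u(1)], of \<alpha> \<beta>] q(2)[OF u(1)] u(2) by simp
  moreover have "v = w" if v: "v \<in> ?M" "frac_deriv J \<rho> \<alpha> v = G v" and w: "w \<in> ?M" "frac_deriv J \<rho> \<alpha> w = G w" for v w
  proof -
    have "G v = realize \<rho> (\<beta> - \<alpha>) (p v)" "G w = realize \<rho> (\<beta> - \<alpha>) (p w)"
      using frac_deriv_realize[OF \<rho> p(1)[OF v(1)], of \<alpha> \<beta>] frac_deriv_realize[OF \<rho> p(1)[OF w(1)], of \<alpha> \<beta>]
        p(2) v w by auto
    then have "d v w = hnorm J \<rho> (\<beta> - \<alpha>) (dminus (G v) (G w))"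
      using hnorm_dminus_realize[OF \<rho> p(1)[OF v(1)] p(1)[OF w(1)], of "\<beta> - \<alpha>"] by (simp add: d_def)
    also have "\<dots> \<le> c * d v w" using lip[OF v(1) w(1)] d_hnorm[OF v(1) w(1)] by simp
    finally have "(1 - c) * d v w \<le> 0" by (simp add: algebra_simps)
    then have "d v w = 0" using c nonneg[of v w] by (simp add: mult_le_0_iff)
    then show ?thesis using zero[OF v(1) w(1)] by simp
  qed
  ultimately show ?thesis using u(1) by blast
qed

end

theorem theorem5p2:
  fixes J :: "'h::{real_inner, complete_space} \<Rightarrow> 'h"
    and \<alpha> \<beta> \<rho>\<^sub>0 :: real
    and Dom :: "'h distr set"
    and F :: "'h distr \<Rightarrow> 'h distr"
  assumes "complex_structure J"
    and "\<alpha> > 0" and "\<rho>\<^sub>0 > 0"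
    and "Dom \<subseteq> (\<Inter>\<rho>\<in>{\<rho>\<^sub>0..}. Hrho J \<rho> \<beta>)"
    and "F ` Dom \<subseteq> (\<Inter>\<rho>\<in>{\<rho>\<^sub>0..}. Hrho J \<rho> (\<beta> - \<alpha>))"
    and "eventually_contracting J \<rho>\<^sub>0 \<beta> (\<beta> - \<alpha>) Dom F"
  shows "\<exists>\<nu>\<ge>\<rho>\<^sub>0. \<forall>\<rho>\<ge>\<nu>. \<forall>G. lip_extension J \<rho> \<beta> (\<beta> - \<alpha>) Dom F G \<longrightarrow>
           (\<exists>!u. u \<in> Hrho J \<rho> \<beta> \<and> frac_deriv J \<rho> \<alpha> u = G u)"
proof -
  interpret complex_hilbert J by unfold_locales (rule assms(1))
  obtain \<nu> Fr where \<nu>: "\<nu> \<ge> \<rho>\<^sub>0" and Fr: "\<And>\<rho>. \<rho> \<ge> \<nu> \<Longrightarrow> lip_extension J \<rho> \<beta> (\<beta> - \<alpha>) Dom F (Fr \<rho>)"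
    and lim: "Limsup at_top (\<lambda>\<rho>. ereal (lip_norm J \<rho> \<beta> (\<beta> - \<alpha>) (Fr \<rho>))) < 1"
    and test: "\<And>\<psi>. test_fun \<psi> \<Longrightarrow> test_dist J \<rho>\<^sub>0 \<psi> \<in> Dom"
    using assms(6) unfolding eventually_contracting_def by blast
  have "\<forall>\<^sub>F \<rho> in at_top. ereal (lip_norm J \<rho> \<beta> (\<beta> - \<alpha>) (Fr \<rho>)) < 1"
    using lim by (rule Limsup_lessD)
  then obtain \<mu> where \<mu>: "\<And>\<rho>. \<rho> \<ge> \<mu> \<Longrightarrow> lip_norm J \<rho> \<beta> (\<beta> - \<alpha>) (Fr \<rho>) < 1"
    by (auto simp: eventually_at_top_linorder)
  show ?thesis
  \<comment> \<open>Beyond \<open>\<nu>\<close> the extensions \<open>Fr\<close> exist, beyond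
    \<open>\<mu>\<close> their Lipschitz norms are below 1.\<close>
  proof (intro exI[of _ "max \<nu> \<mu>"] conjI allI impI)
    show "max \<nu> \<mu> \<ge> \<rho>\<^sub>0" using \<nu> by simp
    fix \<rho> G assume \<rho>: "\<rho> \<ge> max \<nu> \<mu>" and G: "lip_extension J \<rho> \<beta> (\<beta> - \<alpha>) Dom F G"
    have \<rho>0: "\<rho> > 0" using \<rho> \<nu> assms(3) by simp
    have ext: "lip_extension J \<rho> \<beta> (\<beta> - \<alpha>) Dom F (Fr \<rho>)" using Fr \<rho> by simp
    \<comment> \<open>The hypothesis gives membership for the transform at
      \<open>\<rho>\<^sub>0\<close>; the distribution is the same one at \<rho>, where density is
      going to be used.\<close>
    have "test_dist J \<rho> \<psi> \<in> Dom" if "test_fun \<psi>" for \<psi>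
      using test[OF that] test_dist_independent[OF that, of \<rho> \<rho>\<^sub>0] \<rho>0 assms(3) by simp
    then have eq: "G u = Fr \<rho> u" if "u \<in> Hrho J \<rho> \<beta>" for u
      using lip_extension_unique[OF \<rho>0 G ext _ that] by blast
    have "\<exists>!u. u \<in> Hrho J \<rho> \<beta> \<and> frac_deriv J \<rho> \<alpha> u = Fr \<rho> u"
    proof (rule contraction_unique_solution[OF \<rho>0])
      show "Fr \<rho> ` Hrho J \<rho> \<beta> \<subseteq> Hrho J \<rho> (\<beta> - \<alpha>)" using ext by (simp add: lip_extension_def)
      show "lip_norm J \<rho> \<beta> (\<beta> - \<alpha>) (Fr \<rho>) < 1" using \<mu> \<rho> by simp
    qed (rule lip_norm_bound[OF \<rho>0 ext])
    then show "\<exists>!u. u \<in> Hrho J \<rho> \<beta> \<and> frac_deriv J \<rho> \<alpha> u = G u" using eq by metis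
  qed
qed

end
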